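(* In the setting of the context, suppose Assumptions (A1), (A2), (A3) hold. Fix $i\in[d^\star]$ and a premium rate $r>0$ satisfying the net profit condition $r>\mathbb{E}[\boldsymbol{U}_{(i)}](\boldsymbol{I}-\boldsymbol{H})^{-1}\overline{\boldsymbol{\lambda}}$, and suppose there exists $\theta^\star>0$ with $\Psi_i(\theta^\star)=0$. Let $Y_i(t)=Z_i(t)-rt$, $\tau_u=\inf\{t>0:Y_i(t)>u\}$ and $p(u)=\mathbb{P}(\tau_u<\infty)$ for $u>0$. Then $$\lim_{u\to\infty}\frac1u\log p(u)=-\theta^\star,$$ where $\theta^\star$ is the unique positive solution of $\Psi_i(\theta)=0$.
   Context: Fix $d,d^\star\in\mathbb{N}$ (possibly different); $[d]=\{1,\dots,d\}$, $\mathbb{R}_+=[0,\infty)$; vector inequalities are componentwise. Hawkes process. Given: base rates $\overline\lambda_j\ge0$, $j\in[d]$, at least one strictly positive, $\overline{\boldsymbol\lambda}=(\overline\lambda_1,\dots,\overline\lambda_d)^\top$; decay functions $g_{ij}:\mathbb{R}_+\to\mathbb{R}_+$, $i,j\in[d]$, non-increasing and integrable, with $c_{ij}=\int_0^\infty g_{ij}(v)\,dv$; for each $j\in[d]$ a non-negative, non-degenerate random mark vector $\boldsymbol{B}_j=(B_{1j},\dots,B_{dj})$ (entries may be dependent). Each event in component $j$ carries an independent copy of $\boldsymbol{B}_j$. Immigrant events in component $j$ arrive on $(0,\infty)$ according to a homogeneous Poisson process of rate $\overline\lambda_j$, independently over $j$. Each event (immigrant or not) in component $j$ at time $T$ with mark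 $\boldsymbol{B}_{j,r}$ generates, independently of everything else given its mark, offspring events in each component $m\in[d]$ on $(T,\infty)$ according to an inhomogeneous Poisson process with intensity $B_{mj,r}\,g_{mj}(\cdot-T)$; iterate over generations. $N_j(t)$ is the number of events (over all generations) in component $j$ in $(0,t]$, $\boldsymbol{N}(0)=\boldsymbol{0}$. The cluster of an immigrant in component $j$ consists of the immigrant and all its descendants; $S_{i\leftarrow j}$ is the total number of events in component $i$ in such a cluster (the immigrant being counted in component $j$). Compound process. For each $j\in[d]$ let $\boldsymbol{U}_{j,r}=(U_{1j,r},\dots,U_{d^\star j,r})^\top$, $r\in\mathbb{N}$, be i.i.d. copies of a non-negative, non-degenerate random vector $\boldsymbol{U}_j=(U_{1j},\dots,U_{d^\star j})^\top$ (entries may be dependent), drawn independently for every event; $Z_i(t)=\sum_{j=1}^d\sum_{r=1}^{N_j(t)}U_{ij,r}$, $i\in[d^\star]$. Write $m_{\boldsymbol{U}_l}(\boldsymbol{\theta})=\mathbb{E}[e^{\boldsymbol{\theta}^\top\boldsymbol{U}_l}]$, $\boldsymbol{m}_{\boldsymbol{U}}(\boldsymbol{\theta})=(m_{\boldsymbol{U}_1}(\boldsymbol{\theta}),\dots,m_{\boldsymbol{U}_d}(\boldsymbol{\theta}))^\top$, $m_{U_{il}}(\theta)=\mathbb{E}[e^{\theta U_{il}}]$ and $\mathbb{E}[\boldsymbol{U}_{(i)}]=(\mathbb{E}[U_{i1}],\dots,\mathbb{E}[U_{id}])$ (row vector). Limiting cumulants: $\Lambda_i(\theta)=\sum_{j=1}^d\overline\lambda_j\big(\mathbb{E}\big[\prod_{l=1}^dm_{U_{il}}(\theta)^{S_{l\leftarrow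 j}}\big]-1\big)=\lim_{t\to\infty}\frac1t\log\mathbb{E}[e^{\theta Z_i(t)}]$ and $\Psi_i(\theta)=\Lambda_i(\theta)-r\theta=\lim_{t\to\infty}\frac1t\log\mathbb{E}[e^{\theta Y_i(t)}]$. Assumptions. (A1) The matrix $\boldsymbol{H}=(h_{mj})_{m,j\in[d]}$, $h_{mj}=\mathbb{E}[B_{mj}]c_{mj}$, has spectral radius strictly less than $1$. (A2) There is $\boldsymbol{\vartheta}\in\mathbb{R}^d$ with strictly positive entries such that $\mathbb{E}\big[\exp(\sum_{m=1}^dB_{mj}\vartheta_m)\big]<\infty$ for all $j\in[d]$. (A3) For a vector $\boldsymbol{r}$ with positive entries, let $\hat{\boldsymbol{x}}$ be the solution $\boldsymbol{x}$ of the system, $j\in[d]$, $$x_j\sum_{k=1}^d r_k\,\mathbb{E}\Big[B_{kj}c_{kj}\exp\Big(\sum_{m=1}^dB_{mj}c_{mj}(x_m-1)\Big)\Big]=r_j\,\mathbb{E}\Big[\exp\Big(\sum_{m=1}^dB_{mj}c_{mj}(x_m-1)\Big)\Big],$$ and let $\hat z_j=r_j\Big(\sum_{k=1}^dr_k\,\mathbb{E}\big[B_{kj}c_{kj}\exp(\sum_{m=1}^dB_{mj}c_{mj}(\hat x_m-1))\big]\Big)^{-1}$. For any $\hat{\boldsymbol{z}}=(\hat z_1,\dots,\hat z_d)^\top$ so obtained (from any positive $\boldsymbol{r}$) there exists $\hat{\boldsymbol{\theta}}\in\mathbb{R}^{d^\star}$ with $\boldsymbol{m}_{\boldsymbol{U}}(\hat{\boldsymbol{\theta}})=\hat{\boldsymbol{z}}$.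 *)

theory Defs
  imports "HOL-Probability.Probability"
begin

section \<open>Poisson processes given a random environment\<close>

text \<open>A point process on the positive half-line is an enumeration of its points in arbitrary order,
  where the value \<open>\<infinity>\<close> means that the label is not used by any point.\<close>

definition points_in :: "(nat \<Rightarrow> ereal) \<Rightarrow> real set \<Rightarrow> nat set" where
  "points_in p A = {k. p k \<in> ereal ` A}"

definition poisson_weight :: "real \<Rightarrow> nat \<Rightarrow> real" where
  "poisson_weight \<mu> n = \<mu> ^ n / fact n * exp (- \<mu>)"

text \<open>Given \<open>Y\<close>, the point processes \<open>X m\<close> are independent over \<open>m\<close>, and \<open>X m\<close> is a Poisson process on
  \<open>{0<..}\<close> with intensity \<open>f Y m\<close>. The conditional law is expressed through the joint law of \<open>Y\<close>
  (valued in \<open>N\<close>) and the counts on finitely many disjoint bounded Borel sets.\<close>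

definition poisson_given ::
  "'w measure \<Rightarrow> 'b measure \<Rightarrow> ('w \<Rightarrow> 'b) \<Rightarrow> ('b \<Rightarrow> 'd::finite \<Rightarrow> real \<Rightarrow> real)
     \<Rightarrow> ('d \<Rightarrow> nat \<Rightarrow> 'w \<Rightarrow> ereal) \<Rightarrow> bool" where
  "poisson_given M N Y f X \<longleftrightarrow>
     (\<forall>m k. X m k \<in> borel_measurable M) \<and>
     (\<forall>m k. AE \<omega> in M. 0 < X m k \<omega>) \<and>
     (\<forall>C \<in> sets N. \<forall>n. \<forall>A :: 'd \<Rightarrow> nat \<Rightarrow> real set. \<forall>c :: 'd \<Rightarrow> nat \<Rightarrow> nat.
        (\<forall>m. disjoint_family_on (A m) {..<n}
           \<and> (\<forall>i<n. A m i \<in> sets borel \<and> bounded (A m i) \<and> A m i \<subseteq> {0<..})) \<longrightarrow>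
        measure M {\<omega> \<in> space M. Y \<omega> \<in> C \<and>
            (\<forall>m. \<forall>i<n. finite (points_in (\<lambda>k. X m k \<omega>) (A m i))
                     \<and> card (points_in (\<lambda>k. X m k \<omega>) (A m i)) = c m i)}
        = (\<integral>\<omega>. indicator C (Y \<omega>) *
              (\<Prod>m\<in>UNIV. \<Prod>i<n. poisson_weight (LBINT t:A m i. f (Y \<omega>) m t) (c m i)) \<partial>M))"

section \<open>Cluster representation of the Hawkes process\<close>

text \<open>Event labels are read from the right: \<open>[(j, n)]\<close> is the immigrant in component \<open>j\<close> with label \<open>n\<close>, and
  \<open>(m, k) # v\<close> is the offspring of \<open>v\<close> in component \<open>m\<close> with label \<open>k\<close>. The empty list is not an event; its
  ``offspring'' are the immigrants.\<close>

type_synonym 'd event = "('d \<times> nat) list"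

definition comp_of :: "'d event \<Rightarrow> 'd" where
  "comp_of v = fst (hd v)"

text \<open>\<open>X v m k \<omega>\<close> is the time from the event \<open>v\<close> to its offspring \<open>(m, k) # v\<close>, and
  \<open>delay X \<omega> v u\<close> is the time from \<open>v\<close> to its descendant \<open>u @ v\<close>, which is \<open>\<infinity>\<close> if and only if
  there is no such descendant of \<open>v\<close>.\<close>

fun delay ::
  "('d event \<Rightarrow> 'd \<Rightarrow> nat \<Rightarrow> 'w \<Rightarrow> ereal) \<Rightarrow> 'w \<Rightarrow> 'd event \<Rightarrow> 'd event \<Rightarrow> ereal" where
  "delay X \<omega> v [] = 0"
| "delay X \<omega> v ((m, k) # u) = delay X \<omega> v u + X (u @ v) m k \<omega>"

text \<open>The number of events in component \<open>j\<close> in \<open>(0,t]\<close>, possibly infinite.\<close>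

definition hawkes_count ::
  "('d event \<Rightarrow> 'd \<Rightarrow> nat \<Rightarrow> 'w \<Rightarrow> ereal) \<Rightarrow> 'd \<Rightarrow> real \<Rightarrow> 'w \<Rightarrow> ennreal" where
  "hawkes_count X j t \<omega> = emeasure (count_space UNIV)
     {v. v \<noteq> [] \<and> comp_of v = j \<and> 0 < delay X \<omega> [] v \<and> delay X \<omega> [] v \<le> ereal t}"

text \<open>\<open>cluster_count X l j\<close> is $S_{l \leftarrow j}$. All clusters started in component \<open>j\<close> have the same law, so
  the one with root \<open>[(j, 0)]\<close> is taken; the offspring of this label are defined whether or not the immigrant
  \<open>[(j, 0)]\<close> arrives. Infinite clusters, which have probability zero in the subcritical case, are counted
  as \<open>0\<close> by \<open>card\<close>.\<close>

definition cluster_count ::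
  "('d event \<Rightarrow> 'd \<Rightarrow> nat \<Rightarrow> 'w \<Rightarrow> ereal) \<Rightarrow> 'd \<Rightarrow> 'd \<Rightarrow> 'w \<Rightarrow> nat" where
  "cluster_count X l j \<omega> =
     card {u. comp_of (u @ [(j, 0)]) = l \<and> delay X \<omega> [(j, 0)] u < \<infinity>}"

section \<open>The compound Hawkes model\<close>

definition nondegenerate :: "'a measure \<Rightarrow> bool" where
  "nondegenerate D \<longleftrightarrow> \<not> (\<exists>a. AE x in D. x = a)"

text \<open>The independent sources of randomness: the immigrants and the offspring of each event
  (together with its mark), and the claims.\<close>

datatype 'd source = Family "'d event" | Claim 'd nat

fun source_sets ::
  "'w measure \<Rightarrow> ('d event \<Rightarrow> 'd \<Rightarrow> nat \<Rightarrow> 'w \<Rightarrow> ereal) \<Rightarrow> ('d event \<Rightarrow> 'w \<Rightarrow> real ^ 'd::finite)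
     \<Rightarrow> ('d \<Rightarrow> nat \<Rightarrow> 'w \<Rightarrow> real ^ 'e::finite) \<Rightarrow> 'd source \<Rightarrow> 'w set set" where
  "source_sets M X B U (Family v) =
     (if v = [] then
        sets (vimage_algebra (space M) (\<lambda>\<omega> (m, k). X [] m k \<omega>) (Pi\<^sub>M UNIV (\<lambda>_. borel)))
      else
        sets (vimage_algebra (space M) (\<lambda>\<omega>. (B v \<omega>, \<lambda>(m, k). X v m k \<omega>))
          (borel \<Otimes>\<^sub>M Pi\<^sub>M UNIV (\<lambda>_. borel))))"
| "source_sets M X B U (Claim j r) = sets (vimage_algebra (space M) (U j r) borel)"

text \<open>\<open>mark_law j\<close> is the law of the mark vector $B_j$ with entries $B_{mj}$ (indexed by \<open>m\<close>), and
  \<open>claim_law j\<close> is the law of $U_j$. \<open>U j r\<close> belongs to the event number \<open>r\<close>, counted from \<open>0\<close>,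
  in component \<open>j\<close>.\<close>

locale compound_hawkes = prob_space M
  for M :: "'w measure" +
  fixes base :: "real ^ 'd::finite"
    and g :: "'d \<Rightarrow> 'd \<Rightarrow> real \<Rightarrow> real"
    and mark_law :: "'d \<Rightarrow> (real ^ 'd) measure"
    and claim_law :: "'d \<Rightarrow> (real ^ 'e::finite) measure"
    and X :: "'d event \<Rightarrow> 'd \<Rightarrow> nat \<Rightarrow> 'w \<Rightarrow> ereal"
    and B :: "'d event \<Rightarrow> 'w \<Rightarrow> real ^ 'd"
    and U :: "'d \<Rightarrow> nat \<Rightarrow> 'w \<Rightarrow> real ^ 'e"
  assumes base_nonneg: "0 \<le> base $ j"
    and base_pos: "\<exists>j. 0 < base $ j"
    and decay_nonneg: "0 \<le> t \<Longrightarrow> 0 \<le> g m j t"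
    and decay_antimono: "0 \<le> s \<Longrightarrow> s \<le> t \<Longrightarrow> g m j t \<le> g m j s"
    and decay_integrable: "set_integrable lborel {0..} (g m j)"
    and mark_nonneg: "AE b in mark_law j. \<forall>m. 0 \<le> b $ m"
    and mark_nondegenerate: "nondegenerate (mark_law j)"
    and claim_nonneg: "AE u in claim_law j. \<forall>i. 0 \<le> u $ i"
    and claim_nondegenerate: "nondegenerate (claim_law j)"
    and mark_measurable: "v \<noteq> [] \<Longrightarrow> B v \<in> borel_measurable M"
    and mark_distr: "v \<noteq> [] \<Longrightarrow> distr M borel (B v) = mark_law (comp_of v)"
    and claim_measurable: "U j r \<in> borel_measurable M"
    and claim_distr: "distr M borel (U j r) = claim_law j"
    and immigrants: "poisson_given M (count_space UNIV) (\<lambda>_. ()) (\<lambda>_ j _. base $ j) (X [])"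
    and offspring: "v \<noteq> [] \<Longrightarrow>
      poisson_given M borel (B v) (\<lambda>b m t. b $ m * g m (comp_of v) t) (X v)"
    and independent: "indep_sets (source_sets M X B U) UNIV"

definition decay_mass :: "('d \<Rightarrow> 'd \<Rightarrow> real \<Rightarrow> real) \<Rightarrow> 'd \<Rightarrow> 'd \<Rightarrow> real" where
  "decay_mass g m j = (LBINT t:{0..}. g m j t)"

definition branching_matrix ::
  "('d \<Rightarrow> 'd \<Rightarrow> real \<Rightarrow> real) \<Rightarrow> ('d \<Rightarrow> (real ^ 'd::finite) measure) \<Rightarrow> real ^ 'd ^ 'd" where
  "branching_matrix g mark_law = (\<chi> m j. (\<integral>b. b $ m \<partial>mark_law j) * decay_mass g m j)"

definition spectral_radius :: "real ^ 'd ^ 'd::finite \<Rightarrow> real" where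
  "spectral_radius A = Max {cmod z | z.
     \<exists>x :: complex ^ 'd. x \<noteq> 0 \<and> (\<chi> i j. complex_of_real (A $ i $ j)) *v x = z *s x}"

section \<open>Moment conditions\<close>

definition marks_light_tailed :: "('d \<Rightarrow> (real ^ 'd::finite) measure) \<Rightarrow> bool" where
  "marks_light_tailed mark_law \<longleftrightarrow>
     (\<exists>\<theta> :: real ^ 'd. (\<forall>m. 0 < \<theta> $ m) \<and>
        (\<forall>j. integrable (mark_law j) (\<lambda>b. exp (\<Sum>m\<in>UNIV. b $ m * \<theta> $ m))))"

definition tilt ::
  "('d \<Rightarrow> 'd \<Rightarrow> real \<Rightarrow> real) \<Rightarrow> 'd \<Rightarrow> real ^ 'd::finite \<Rightarrow> real ^ 'd \<Rightarrow> real" where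
  "tilt g j x b = exp (\<Sum>m\<in>UNIV. b $ m * decay_mass g m j * (x $ m - 1))"

definition tilted_mean ::
  "('d \<Rightarrow> 'd \<Rightarrow> real \<Rightarrow> real) \<Rightarrow> ('d \<Rightarrow> (real ^ 'd::finite) measure)
     \<Rightarrow> real ^ 'd \<Rightarrow> real ^ 'd \<Rightarrow> 'd \<Rightarrow> real" where
  "tilted_mean g mark_law \<rho> x j =
     (\<Sum>k\<in>UNIV. \<rho> $ k * (\<integral>b. b $ k * decay_mass g k j * tilt g j x b \<partial>mark_law j))"

text \<open>A solution is required to make all expectations in the system finite.\<close>

definition solves_tilted_system ::
  "('d \<Rightarrow> 'd \<Rightarrow> real \<Rightarrow> real) \<Rightarrow> ('d \<Rightarrow> (real ^ 'd::finite) measure)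
     \<Rightarrow> real ^ 'd \<Rightarrow> real ^ 'd \<Rightarrow> bool" where
  "solves_tilted_system g mark_law \<rho> x \<longleftrightarrow>
     (\<forall>j. integrable (mark_law j) (tilt g j x)
        \<and> (\<forall>k. integrable (mark_law j) (\<lambda>b. b $ k * decay_mass g k j * tilt g j x b))
        \<and> x $ j * tilted_mean g mark_law \<rho> x j = \<rho> $ j * (\<integral>b. tilt g j x b \<partial>mark_law j))"

definition joint_mgf :: "('d \<Rightarrow> (real ^ 'e::finite) measure) \<Rightarrow> 'd \<Rightarrow> real ^ 'e \<Rightarrow> ennreal" where
  "joint_mgf claim_law l \<theta> = (\<integral>\<^sup>+u. ennreal (exp (\<theta> \<bullet> u)) \<partial>claim_law l)"

definition claims_attain_tilts ::
  "('d \<Rightarrow> 'd \<Rightarrow> real \<Rightarrow> real) \<Rightarrow> ('d \<Rightarrow> (real ^ 'd::finite) measure)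
     \<Rightarrow> ('d \<Rightarrow> (real ^ 'e::finite) measure) \<Rightarrow> bool" where
  "claims_attain_tilts g mark_law claim_law \<longleftrightarrow>
     (\<forall>\<rho> x. (\<forall>j. 0 < \<rho> $ j) \<longrightarrow> solves_tilted_system g mark_law \<rho> x \<longrightarrow>
        (\<exists>\<theta> :: real ^ 'e. \<forall>l.
           joint_mgf claim_law l \<theta> = ennreal (\<rho> $ l / tilted_mean g mark_law \<rho> x l)))"

section \<open>Risk process\<close>

definition aggregate_claims ::
  "('d::finite event \<Rightarrow> 'd \<Rightarrow> nat \<Rightarrow> 'w \<Rightarrow> ereal) \<Rightarrow> ('d \<Rightarrow> nat \<Rightarrow> 'w \<Rightarrow> real ^ 'e::finite)
     \<Rightarrow> 'e \<Rightarrow> real \<Rightarrow> 'w \<Rightarrow> ennreal" where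
  "aggregate_claims X U i t \<omega> =
     (\<Sum>j\<in>UNIV. \<Sum>r. if of_nat r < hawkes_count X j t \<omega> then ennreal (U j r \<omega> $ i) else 0)"

definition net_claims ::
  "('d::finite event \<Rightarrow> 'd \<Rightarrow> nat \<Rightarrow> 'w \<Rightarrow> ereal) \<Rightarrow> ('d \<Rightarrow> nat \<Rightarrow> 'w \<Rightarrow> real ^ 'e::finite)
     \<Rightarrow> real \<Rightarrow> 'e \<Rightarrow> real \<Rightarrow> 'w \<Rightarrow> ereal" where
  "net_claims X U r i t \<omega> = enn2ereal (aggregate_claims X U i t \<omega>) - ereal (r * t)"

definition ruin_time ::
  "('d::finite event \<Rightarrow> 'd \<Rightarrow> nat \<Rightarrow> 'w \<Rightarrow> ereal) \<Rightarrow> ('d \<Rightarrow> nat \<Rightarrow> 'w \<Rightarrow> real ^ 'e::finite)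
     \<Rightarrow> real \<Rightarrow> 'e \<Rightarrow> real \<Rightarrow> 'w \<Rightarrow> ereal" where
  "ruin_time X U r i u \<omega> = Inf {ereal t | t. 0 < t \<and> ereal u < net_claims X U r i t \<omega>}"

definition ruin_prob ::
  "'w measure \<Rightarrow> ('d::finite event \<Rightarrow> 'd \<Rightarrow> nat \<Rightarrow> 'w \<Rightarrow> ereal)
     \<Rightarrow> ('d \<Rightarrow> nat \<Rightarrow> 'w \<Rightarrow> real ^ 'e::finite) \<Rightarrow> real \<Rightarrow> 'e \<Rightarrow> real \<Rightarrow> real" where
  "ruin_prob M X U r i u = measure M {\<omega> \<in> space M. ruin_time X U r i u \<omega> < \<infinity>}"

definition net_profit ::
  "real ^ 'd \<Rightarrow> ('d \<Rightarrow> 'd \<Rightarrow> real \<Rightarrow> real) \<Rightarrow> ('d \<Rightarrow> (real ^ 'd::finite) measure)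
     \<Rightarrow> ('d \<Rightarrow> (real ^ 'e::finite) measure) \<Rightarrow> real \<Rightarrow> 'e \<Rightarrow> bool" where
  "net_profit base g mark_law claim_law r i \<longleftrightarrow>
     (\<Sum>l\<in>UNIV. (\<integral>\<^sup>+u. ennreal (u $ i) \<partial>claim_law l) *
        ennreal ((matrix_inv (mat 1 - branching_matrix g mark_law) *v base) $ l)) < ennreal r"

text \<open>The limiting cumulants take values in the extended reals, so that a root of
  \<open>limit_cumulant_net\<close> has finite moment generating functions.\<close>

definition claim_mgf :: "('d \<Rightarrow> (real ^ 'e::finite) measure) \<Rightarrow> 'e \<Rightarrow> 'd \<Rightarrow> real \<Rightarrow> ennreal" where
  "claim_mgf claim_law i l \<theta> = (\<integral>\<^sup>+u. ennreal (exp (\<theta> * u $ i)) \<partial>claim_law l)"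

definition limit_cumulant ::
  "'w measure \<Rightarrow> real ^ 'd::finite \<Rightarrow> ('d \<Rightarrow> (real ^ 'e::finite) measure)
     \<Rightarrow> ('d event \<Rightarrow> 'd \<Rightarrow> nat \<Rightarrow> 'w \<Rightarrow> ereal) \<Rightarrow> 'e \<Rightarrow> real \<Rightarrow> ereal" where
  "limit_cumulant M base claim_law X i \<theta> =
     (\<Sum>j\<in>UNIV. ereal (base $ j) *
        (enn2ereal (\<integral>\<^sup>+\<omega>. (\<Prod>l\<in>UNIV. claim_mgf claim_law i l \<theta> ^ cluster_count X l j \<omega>) \<partial>M) - 1))"

definition limit_cumulant_net ::
  "'w measure \<Rightarrow> real ^ 'd::finite \<Rightarrow> ('d \<Rightarrow> (real ^ 'e::finite) measure)
     \<Rightarrow> ('d event \<Rightarrow> 'd \<Rightarrow> nat \<Rightarrow> 'w \<Rightarrow> ereal) \<Rightarrow> real \<Rightarrow> 'e \<Rightarrow> real \<Rightarrow> ereal" where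
  "limit_cumulant_net M base claim_law X r i \<theta> =
     limit_cumulant M base claim_law X i \<theta> - ereal (r * \<theta>)"

end

theory Submission
  imports Defs
begin

text \<open>
  The claim process is enclosed between two compound Poisson processes, so that the ruin probability
  can be treated with the classical tools for random walks with exponential moments.

  If all claims of a cluster are paid when its immigrant arrives, they are only paid earlier. The
  resulting total at time \<open>t\<close> is compound Poisson and has moment generating function
  \<open>exp (t \<Lambda>(\<theta>))\<close>, where \<open>\<Lambda>\<close> is the limiting cumulant (\<open>nn_integral_exp_claims_le\<close>). In the other
  direction only the claims of truncated clusters are kept: \<open>d\<close> generations, children that arrive
  within time \<open>K\<close> of their parent, and no children at all for an event that has more than \<open>K\<close> of
  them; moreover, claim sizes are replaced by simple functions below them. These claims have been paid
  at most \<open>d * K\<close> after the arrival of the immigrant, and the total over the immigrants up to time \<open>T\<close>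
  has moment generating function \<open>exp (T * L(s))\<close> with \<open>L\<close> finite and differentiable everywhere
  (\<open>nn_integral_exp_truncated_claims\<close>, \<open>tree_pgf_smooth\<close>).

  Upper bound. The cumulant \<open>\<Lambda>\<close> is strictly convex with \<open>\<Lambda>(0) = 0\<close> (\<open>cumulant_scale\<close>), hence
  \<open>\<Lambda>(\<theta>) < r \<theta>\<close> to the left of the root and \<open>\<Lambda>(\<theta>) > r \<theta>\<close> to the right of it; this also gives
  uniqueness of the root. To the left of the root, ruin in \<open>[n, n + 1]\<close> forces the total at time
  \<open>n + 1\<close> above \<open>u + r n\<close>, and the Markov inequality bounds the probability of this by \<open>exp (- \<theta> u)\<close>
  times a term that is geometric in \<open>n\<close> (\<open>ruin_prob_le\<close>).

  Lower bound. To the right of the root, Fatou's lemma yields a truncation with \<open>L(\<theta>) > r \<theta>\<close>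
  (\<open>truncated_cumulant_exceeds\<close>), and then a point \<open>s \<le> \<theta>\<close> with \<open>L(s) \<ge> r s\<close> and \<open>L'(s) > r\<close>
  (\<open>exists_excess_slope\<close>). Under the law tilted by \<open>s\<close> the truncated total grows at speed \<open>L'(s)\<close>, so
  that it exceeds \<open>u + r T\<close> at the time \<open>T = u / (L'(s) - r)\<close>; undoing the tilt costs
  \<open>exp (T (L(s) - s L'(s))) \<ge> exp (- s u)\<close> (\<open>tilted_lower_bound\<close>, \<open>ruin_prob_ge\<close>).

  Apart from first moments, independence enters through a single statement on products over a random
  set of indices (\<open>nn_integral_thinned_iprod\<close>). It is applied to the claims given the events, to the clusters given
  the immigrants and to the subtrees given the children of an event. Because the points of a Poisson
  process are labelled in an arbitrary way, clusters with different roots are not copies of each other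
  as families of random times. Their weights still have the same expectation, since the recursion over the
  generations of a truncated cluster involves only the numbers of children (\<open>nn_integral_tree_weight\<close>,
  \<open>nn_integral_cluster_weight_cong\<close>). Clusters are finite since a subcritical nonnegative matrix \<open>H\<close>
  admits weights \<open>w\<close> with \<open>w j \<ge> 1 + (\<Sum>m. H m j * w m)\<close>, which bound the expected cluster sizes
  (\<open>subcritical_weights\<close>, \<open>AE_finite_cluster\<close>).
\<close>

section \<open>Products over marked points\<close>

text \<open>An infinite product of factors that are at least \<open>1\<close>, taken along growing boxes of indices. The
index \<open>(m, k)\<close> stands for the point with label \<open>k\<close> in component \<open>m\<close>.\<close>

definition iprod :: "('d::finite \<times> nat \<Rightarrow> ennreal) \<Rightarrow> ennreal" where
  "iprod f = (SUP n. \<Prod>p\<in>UNIV \<times> {..<n}. f p)"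

lemma incseq_prod_box:
  fixes f :: "'d::finite \<times> nat \<Rightarrow> ennreal"
  assumes "\<And>p. 1 \<le> f p"
  shows "incseq (\<lambda>n. \<Prod>p\<in>UNIV \<times> {..<n}. f p)"
proof (rule incseq_SucI)
  fix n
  have "UNIV \<times> {..<Suc n} = UNIV \<times> {..<n} \<union> UNIV \<times> {n::nat}" by auto
  then have "(\<Prod>p\<in>UNIV \<times> {..<Suc n}. f p) = (\<Prod>p\<in>UNIV \<times> {..<n} \<union> UNIV \<times> {n}. f p)"
    by (rule arg_cong)
  also have "\<dots> = (\<Prod>p\<in>UNIV \<times> {..<n}. f p) * (\<Prod>p\<in>UNIV \<times> {n}. f p)"
    by (rule prod.union_disjoint) auto
  finally have "(\<Prod>p\<in>UNIV \<times> {..<Suc n}. f p)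
      = (\<Prod>p\<in>UNIV \<times> {..<n}. f p) * (\<Prod>p\<in>UNIV \<times> {n}. f p)" .
  moreover have "1 \<le> (\<Prod>p\<in>(UNIV :: 'd set) \<times> {n}. f p)"
    using assms by (intro prod_ge_1) auto
  ultimately show "(\<Prod>p\<in>UNIV \<times> {..<n}. f p) \<le> (\<Prod>p\<in>UNIV \<times> {..<Suc n}. f p)"
    using mult_left_mono[of 1 "\<Prod>p\<in>UNIV \<times> {n}. f p" "\<Prod>p\<in>UNIV \<times> {..<n}. f p"] by simp
qed

lemma finite_subset_box:
  fixes S :: "('d::finite \<times> nat) set"
  assumes "finite S"
  obtains N where "S \<subseteq> UNIV \<times> {..<N}"
proof -
  have "finite (snd ` S)" using assms by simp
  then obtain N where N: "\<forall>x\<in>snd ` S. x < N" using finite_nat_set_iff_bounded by blast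
  have "S \<subseteq> UNIV \<times> {..<N}"
  proof
    fix p assume "p \<in> S"
    then have "snd p \<in> snd ` S" by simp
    then show "p \<in> UNIV \<times> {..<N}" using N by (cases p) auto
  qed
  then show ?thesis by (rule that)
qed

lemma prod_mono2_ge_1:
  fixes f :: "'i \<Rightarrow> ennreal"
  assumes "finite T" "S \<subseteq> T" "\<And>p. p \<in> T \<Longrightarrow> 1 \<le> f p"
  shows "prod f S \<le> prod f T"
proof -
  have "prod f T = prod f S * prod f (T - S)"
    using assms by (metis mult.commute prod.subset_diff)
  moreover have "1 \<le> prod f (T - S)" using assms by (intro prod_ge_1) auto
  ultimately show ?thesis using mult_left_mono[of 1 "prod f (T - S)" "prod f S"] by simp
qed

lemma iprod_finite_support:
  assumes "finite S" "\<And>p. 1 \<le> f p"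
  shows "iprod (\<lambda>p. if p \<in> S then f p else 1) = (\<Prod>p\<in>S. f p)"
proof -
  let ?g = "\<lambda>p. if p \<in> S then f p else 1"
  obtain N where N: "S \<subseteq> UNIV \<times> {..<N}" using finite_subset_box[OF assms(1)] .
  have eq: "(\<Prod>p\<in>UNIV \<times> {..<n}. ?g p) = (\<Prod>p\<in>S. f p)" if "N \<le> n" for n
  proof -
    have "S \<subseteq> UNIV \<times> {..<n}" using N that by force
    then show ?thesis
      by (subst prod.mono_neutral_right[of _ S]) (auto intro!: prod.cong)
  qed
  have "(\<lambda>n. \<Prod>p\<in>UNIV \<times> {..<n}. ?g p) \<longlonglongrightarrow> (\<Prod>p\<in>S. f p)"
    by (rule tendsto_eventually) (use eq in \<open>auto simp: eventually_sequentially\<close>)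
  moreover have "(\<lambda>n. \<Prod>p\<in>UNIV \<times> {..<n}. ?g p) \<longlonglongrightarrow> iprod ?g"
    unfolding iprod_def by (rule LIMSEQ_SUP[OF incseq_prod_box]) (use assms in auto)
  ultimately show ?thesis by (rule LIMSEQ_unique[rotated])
qed

lemma borel_measurable_iprod:
  assumes "\<And>p. (\<lambda>\<omega>. f p \<omega>) \<in> borel_measurable N"
  shows "(\<lambda>\<omega>. iprod (\<lambda>p. f p \<omega>)) \<in> borel_measurable N"
  unfolding iprod_def using assms by measurable

lemma (in prob_space) nn_integral_indep_mult:
  fixes f g :: "'a \<Rightarrow> ennreal"
  assumes "indep_var borel f borel g"
  shows "(\<integral>\<^sup>+\<omega>. f \<omega> * g \<omega> \<partial>M) = (\<integral>\<^sup>+\<omega>. f \<omega> \<partial>M) * (\<integral>\<^sup>+\<omega>. g \<omega> \<partial>M)"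
proof -
  have "case_bool borel borel = (\<lambda>_. borel :: ennreal measure)" by (auto split: bool.split)
  then have "indep_vars (\<lambda>_. borel) (case_bool f g) UNIV"
    using assms unfolding indep_var_def by simp
  from indep_vars_nn_integral[OF _ this] show ?thesis by (simp add: UNIV_bool mult.commute)
qed

lemma tendsto_prod_ennreal_ge_1:
  fixes f :: "nat \<Rightarrow> 'i \<Rightarrow> ennreal"
  assumes "finite S" "\<And>x. (\<lambda>n. f n x) \<longlonglongrightarrow> l x" "\<And>x. 1 \<le> l x"
  shows "(\<lambda>n. \<Prod>x\<in>S. f n x) \<longlonglongrightarrow> (\<Prod>x\<in>S. l x)"
  using assms(1)
proof (induction S rule: finite_induct)
  case (insert x S)
  have "1 \<le> (\<Prod>x\<in>S. l x)" using assms(3) by (intro prod_ge_1)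
  moreover have "y \<noteq> 0" if "1 \<le> y" for y :: ennreal using that by auto
  ultimately have "l x \<noteq> 0" "(\<Prod>x\<in>S. l x) \<noteq> 0" using assms(3)[of x] by blast+
  then show ?case using insert assms(2)[of x] by (simp, intro tendsto_mult_ennreal) auto
qed simp

section \<open>Poisson weights\<close>

lemma poisson_weight_nonneg: "0 \<le> \<mu> \<Longrightarrow> 0 \<le> poisson_weight \<mu> n"
  by (simp add: poisson_weight_def)

lemma poisson_weight_pgf_sums:
  "(\<lambda>n. poisson_weight \<mu> n * z ^ n) sums exp (\<mu> * (z - 1))"
proof -
  have "(\<lambda>n. exp (- \<mu>) * ((\<mu> * z) ^ n /\<^sub>R fact n)) sums (exp (- \<mu>) * exp (\<mu> * z))"
    by (intro sums_mult exp_converges)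
  moreover have "exp (- \<mu>) * exp (\<mu> * z) = exp (\<mu> * (z - 1))"
    by (simp add: exp_add[symmetric] algebra_simps)
  moreover have "exp (- \<mu>) * ((\<mu> * z) ^ n /\<^sub>R fact n) = poisson_weight \<mu> n * z ^ n" for n
    by (simp add: poisson_weight_def power_mult_distrib divide_simps)
  ultimately show ?thesis by simp
qed

lemma poisson_weight_sums: "poisson_weight \<mu> sums 1"
  using poisson_weight_pgf_sums[of \<mu> 1] by simp

lemma poisson_weight_le_1: "0 \<le> \<mu> \<Longrightarrow> poisson_weight \<mu> n \<le> 1"
  using sum_le_suminf[of "poisson_weight \<mu>" "{n}"] poisson_weight_sums[of \<mu>]
  by (auto simp: sums_iff poisson_weight_nonneg)

lemma poisson_weight_mean_sums: "(\<lambda>n. real n * poisson_weight \<mu> n) sums \<mu>"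
proof -
  have "(\<lambda>n. \<mu> * poisson_weight \<mu> n) sums (\<mu> * 1)"
    by (intro sums_mult poisson_weight_sums)
  moreover have "\<mu> * poisson_weight \<mu> n = real (Suc n) * poisson_weight \<mu> (Suc n)" for n
    by (simp add: poisson_weight_def divide_simps)
  ultimately have "(\<lambda>n. real (Suc n) * poisson_weight \<mu> (Suc n)) sums \<mu>" by simp
  then show ?thesis by (subst (asm) sums_Suc_iff) simp
qed

definition poisson_weight_pmf :: "real \<Rightarrow> nat pmf" where
  "poisson_weight_pmf \<mu> = embed_pmf (poisson_weight \<mu>)"

lemma pmf_poisson_weight_pmf:
  assumes "0 \<le> \<mu>"
  shows "pmf (poisson_weight_pmf \<mu>) n = poisson_weight \<mu> n"
  unfolding poisson_weight_pmf_def
proof (rule pmf_embed_pmf)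
  show "(\<integral>\<^sup>+n. ennreal (poisson_weight \<mu> n) \<partial>count_space UNIV) = 1"
    using suminf_ennreal_eq[OF poisson_weight_nonneg[OF assms] poisson_weight_sums]
    by (simp add: nn_integral_count_space_nat)
qed (rule poisson_weight_nonneg[OF assms])

lemma prod_fst_power:
  fixes F :: "'d::finite \<Rightarrow> 'c::comm_monoid_mult" and S :: "('d \<times> nat) set"
  assumes "finite S"
  shows "(\<Prod>p\<in>S. F (fst p)) = (\<Prod>m\<in>UNIV. F m ^ card {k. (m, k) \<in> S})"
proof -
  have fin: "finite {k. (m, k) \<in> S}" for m
    by (rule finite_subset[of _ "snd ` S"]) (use assms in \<open>auto intro: rev_image_eqI\<close>)
  have "S = Sigma UNIV (\<lambda>m. {k. (m, k) \<in> S})" by auto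
  then have "(\<Prod>p\<in>S. F (fst p)) = (\<Prod>p\<in>Sigma UNIV (\<lambda>m. {k. (m, k) \<in> S}). F (fst p))"
    by (rule arg_cong)
  also have "\<dots> = (\<Prod>m\<in>UNIV. \<Prod>k\<in>{k. (m, k) \<in> S}. F m)"
    by (subst prod.Sigma) (use fin in \<open>auto simp: case_prod_beta\<close>)
  finally show ?thesis by simp
qed

section \<open>Subcritical matrices\<close>

text \<open>The eigenvalues are the roots of a polynomial, the determinant of \<open>z - C\<close> expanded over the
polynomial ring. It does not vanish at a real number beyond the operator norm of \<open>C\<close>. Finiteness makes
the maximum in the definition of the spectral radius meaningful.\<close>

lemma finite_eigenvalues:
  fixes C :: "complex ^ 'd ^ 'd::finite"
  shows "finite {z. \<exists>x. x \<noteq> 0 \<and> C *v x = z *s x}"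
proof -
  define P :: "complex poly ^ 'd ^ 'd" where "P = (\<chi> i j. (if i = j then [:0, 1:] else 0) - [:C $ i $ j:])"
  define A where "A z = (\<chi> i j. (if i = j then z else 0) - C $ i $ j)" for z
  have poly: "poly (det P) z = det (A z)" for z
    unfolding det_def A_def P_def by (simp add: poly_sum poly_prod sign_def if_distrib[of "\<lambda>p. poly p z"] cong: if_cong)
  have Av: "A z *v x = z *s x - C *v x" for z x
    by (simp add: A_def vec_eq_iff matrix_vector_mult_def left_diff_distrib sum_subtractf if_distrib[of "\<lambda>a. a * _"] cong: if_cong)
  have eig: "det (A z) = 0 \<longleftrightarrow> (\<exists>x. x \<noteq> 0 \<and> C *v x = z *s x)" for z
  proof -
    have "det (A z) = 0 \<longleftrightarrow> \<not> (\<forall>x. A z *v x = 0 \<longrightarrow> x = 0)"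
      by (metis invertible_det_nz invertible_left_inverse matrix_left_invertible_ker)
    then show ?thesis by (auto simp: Av)
  qed
  have lin: "linear (\<lambda>x. C *v x)"
    by (rule linearI) (simp_all add: vec_eq_iff matrix_vector_mult_def scaleR_sum_right distrib_left sum.distrib)
  then have bl: "bounded_linear (\<lambda>x. C *v x)" by (simp add: linear_conv_bounded_linear)
  define R where "R = onorm (\<lambda>x. C *v x) + 1"
  have "det (A (of_real R)) \<noteq> 0"
  proof
    assume "det (A (of_real R)) = 0"
    then obtain x where x: "x \<noteq> 0" "C *v x = of_real R *s x" using eig by blast
    have "complex_of_real R *s x = R *\<^sub>R x" by (simp add: vec_eq_iff) (simp add: scaleR_conv_of_real)
    then have "norm (C *v x) = \<bar>R\<bar> * norm x" using x by simp
    moreover have "norm (C *v x) \<le> onorm (\<lambda>x. C *v x) * norm x" by (rule onorm[OF bl])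
    moreover have "0 < R" unfolding R_def using onorm_pos_le[OF bl] by linarith
    ultimately show False using x by (simp add: R_def algebra_simps)
  qed
  then have "det P \<noteq> 0" using poly by (metis poly_0)
  then have "finite {z. poly (det P) z = 0}" by (rule poly_roots_finite)
  then show ?thesis by (simp add: poly eig)
qed

lemma real_eigenvalue_le_spectral_radius:
  fixes H :: "real ^ 'd ^ 'd::finite"
  assumes "x \<noteq> 0" "H *v x = c *s x"
  shows "\<bar>c\<bar> \<le> spectral_radius H"
proof -
  let ?C = "\<chi> i j. complex_of_real (H $ i $ j)"
  let ?x = "\<chi> i. complex_of_real (x $ i)"
  have "?x \<noteq> 0" using assms(1) by (auto simp: vec_eq_iff)
  moreover have "?C *v ?x = complex_of_real c *s ?x"
    using assms(2)
    by (simp add: vec_eq_iff matrix_vector_mult_def flip: of_real_mult of_real_sum)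
  ultimately have "cmod (complex_of_real c) \<in> {cmod z | z. \<exists>x :: complex ^ 'd. x \<noteq> 0 \<and> ?C *v x = z *s x}"
    by blast
  moreover have "finite {cmod z | z. \<exists>x :: complex ^ 'd. x \<noteq> 0 \<and> ?C *v x = z *s x}"
    using finite_eigenvalues[of ?C] by (simp add: setcompr_eq_image)
  ultimately show ?thesis unfolding spectral_radius_def by (metis (no_types, lifting) Max_ge norm_of_real)
qed

text \<open>The solution \<open>w t\<close> of \<open>w = 1 + t H\<^sup>T w\<close> exists for all \<open>t\<close> in \<open>[0, 1]\<close>, as \<open>1 / t\<close> is not an eigenvalue of
\<open>H\<close>, and is continuous in \<open>t\<close> by Cramer's rule. If it is nonnegative, the equation makes it at least
\<open>1\<close>. The parameters with a nonnegative solution thus form a subset of \<open>[0, 1]\<close> that is open and closed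
and contains \<open>0\<close>.\<close>

lemma subcritical_weights:
  fixes H :: "real ^ 'd ^ 'd::finite"
  assumes pos: "\<And>i j. 0 \<le> H $ i $ j" and sr: "spectral_radius H < 1"
  obtains w :: "'d \<Rightarrow> real" where "\<And>j. 0 \<le> w j" "\<And>j. 1 + (\<Sum>m\<in>UNIV. H $ m $ j * w m) \<le> w j"
proof -
  define A where "A t = (\<chi> i j. (if i = j then 1 else 0) - t * H $ j $ i)" for t
  have det: "det (A t) \<noteq> 0" if t: "t \<in> {0..1}" for t
  proof
    assume d: "det (A t) = 0"
    have "det (transpose (A t)) = 0" using d by (simp add: det_transpose)
    then obtain x where x: "x \<noteq> 0" "transpose (A t) *v x = 0"
      by (metis invertible_det_nz invertible_left_inverse matrix_left_invertible_ker)
    have "transpose (A t) *v x = x - t *s (H *v x)"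
      by (simp add: A_def transpose_def vec_eq_iff matrix_vector_mult_def left_diff_distrib sum_subtractf
          if_distrib[of "\<lambda>a. a * _"] sum_distrib_left mult.assoc cong: if_cong)
    then have eq: "x = t *s (H *v x)" using x by simp
    then have "t \<noteq> 0" using x by auto
    then have "H *v x = (1 / t) *s (t *s (H *v x))" by (simp add: vector_smult_assoc)
    also have "\<dots> = (1 / t) *s x" using eq by simp
    finally have "\<bar>1 / t\<bar> \<le> spectral_radius H" using real_eigenvalue_le_spectral_radius x by blast
    moreover have "1 \<le> \<bar>1 / t\<bar>" using t \<open>t \<noteq> 0\<close> by auto
    ultimately show False using sr by linarith
  qed
  define w where "w t k = det (\<chi> i j. if j = k then 1 else A t $ i $ j) / det (A t)" for t k
  have sol: "w t k = 1 + t * (\<Sum>m\<in>UNIV. H $ m $ k * w t m)" if t: "t \<in> {0..1}" for t k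
  proof -
    have "A t *v (\<chi> k. w t k) = (\<chi> k. 1)"
      by (subst cramer[OF det[OF t]]) (simp add: w_def vec_eq_iff cong: if_cong)
    then have "(A t *v (\<chi> k. w t k)) $ k = 1" by simp
    moreover have "(A t *v (\<chi> k. w t k)) $ k = w t k - t * (\<Sum>m\<in>UNIV. H $ m $ k * w t m)"
      by (simp add: A_def matrix_vector_mult_def left_diff_distrib sum_subtractf
          if_distrib[of "\<lambda>a. a * _"] sum_distrib_left mult.assoc cong: if_cong)
    ultimately show ?thesis by simp
  qed
  have Ac: "continuous_on UNIV (\<lambda>t. A t $ i $ j)" for i j
    unfolding A_def by (auto intro!: continuous_intros)
  have "continuous_on UNIV (\<lambda>t. if j = k then 1 else A t $ i $ j)" for i j k
    using Ac by (cases "j = k") (simp_all add: continuous_on_const)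
  then have cont: "continuous_on {0..1} (\<lambda>t. w t k)" for k
    unfolding w_def using det
    by (intro continuous_on_divide) (auto simp: det_def intro!: continuous_on_sum continuous_on_mult
        continuous_on_prod continuous_on_const intro: continuous_on_subset[OF Ac] continuous_on_subset[of UNIV])
  define T where "T = {t \<in> {0..1}. \<forall>k. 0 \<le> w t k}"
  have T_pos: "T = {t \<in> {0..1}. \<forall>k. 0 < w t k}"
  proof -
    have "0 < w t k" if "t \<in> T" for t k
    proof -
      have t: "t \<in> {0..1}" "\<And>k. 0 \<le> w t k" using that by (auto simp: T_def)
      have "0 \<le> t * (\<Sum>m\<in>UNIV. H $ m $ k * w t m)"
        using t pos by (intro mult_nonneg_nonneg sum_nonneg) auto
      then show ?thesis using sol[OF t(1), of k] by linarith
    qed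
    then show ?thesis by (auto simp: T_def less_imp_le)
  qed
  have "T = (\<Inter>k. {0..1} \<inter> (\<lambda>t. w t k) -` {0..})" by (auto simp: T_def)
  then have "closedin (top_of_set {0..1}) T"
    by (simp only:) (intro closedin_INT continuous_closedin_preimage cont; simp)
  moreover have "T = (\<Inter>k. {0..1} \<inter> (\<lambda>t. w t k) -` {0<..})" by (auto simp: T_pos)
  then have "openin (top_of_set {0..1}) T"
    by (simp only:) (intro openin_INT2 continuous_openin_preimage_gen cont; simp)
  ultimately have "T = {} \<or> T = {0..1}"
    using connected_Icc[of "0::real" 1] unfolding connected_clopen by blast
  moreover have "0 \<in> T" using sol[of 0] by (simp add: T_def)
  ultimately have "1 \<in> T" by auto
  show ?thesis
  proof (rule that[of "w 1"])
    show "0 \<le> w 1 j" for j using \<open>1 \<in> T\<close> by (simp add: T_def)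
    show "1 + (\<Sum>m\<in>UNIV. H $ m $ j * w 1 m) \<le> w 1 j" for j
      using sol[of 1 j] by (intro eq_refl) (simp only: atLeastAtMost_iff order_refl zero_le_one simp_thms mult_1)
  qed
qed

section \<open>Power inequalities and exponential tilting\<close>

text \<open>Strict convexity of \<open>exp\<close>: the two tangent inequalities at \<open>a = s * ln x\<close>, evaluated at \<open>ln x\<close> and at
\<open>0\<close>, are combined with weights \<open>s\<close> and \<open>1 - s\<close>.\<close>

lemma powr_less_linear:
  fixes x s :: real
  assumes "1 < x" "0 < s" "s < 1"
  shows "x powr s < 1 + s * (x - 1)"
proof -
  define y where "y = ln x"
  have y: "0 < y" "x = exp y" using assms by (auto simp: y_def)
  define a where "a = s * y"
  have pos: "0 < y - a" using y assms by (simp add: a_def)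
  then have "exp (ln (1 + (y - a))) < exp (y - a)"
    by (intro exp_less_mono ln_add_one_self_less_self)
  then have "1 + (y - a) < exp (y - a)" using pos by simp
  then have "exp a * (1 + (y - a)) < exp a * exp (y - a)" by (rule mult_strict_left_mono) simp
  then have 1: "exp a * (1 + (y - a)) < exp y" by (simp add: exp_add[symmetric])
  have "1 + (- a) \<le> exp (- a)" by (rule exp_ge_add_one_self)
  then have "exp a * (1 + (- a)) \<le> exp a * exp (- a)" by (intro mult_left_mono) auto
  then have 2: "exp a * (1 - a) \<le> 1" by (simp add: exp_minus)
  have "exp a = s * (exp a * (1 + (y - a))) + (1 - s) * (exp a * (1 - a))"
    by (simp add: a_def algebra_simps)
  also have "\<dots> < s * exp y + (1 - s) * 1"
    using 1 2 assms by (intro add_less_le_mono mult_strict_left_mono mult_left_mono) auto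
  finally have "exp a < 1 + s * (x - 1)" by (simp add: y algebra_simps)
  moreover have "x powr s = exp a" using assms by (simp add: powr_def a_def y_def)
  ultimately show ?thesis by simp
qed

lemma powr_le_linear:
  fixes x s :: real
  assumes "0 < x" "0 < s" "s < 1"
  shows "x powr s \<le> 1 + s * (x - 1)"
proof -
  define y where "y = ln x"
  have y: "x = exp y" using assms by (simp add: y_def)
  have "exp (s * y) * (1 + (1 - s) * y) \<le> exp (s * y) * exp ((1 - s) * y)"
    by (intro mult_left_mono exp_ge_add_one_self) auto
  then have 1: "exp (s * y) * (1 + (1 - s) * y) \<le> exp y"
    by (simp add: exp_add[symmetric] algebra_simps)
  have "exp (s * y) * (1 + (- (s * y))) \<le> exp (s * y) * exp (- (s * y))"
    by (intro mult_left_mono exp_ge_add_one_self) auto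
  then have 2: "exp (s * y) * (1 - s * y) \<le> 1" by (simp add: exp_minus)
  have "exp (s * y) = s * (exp (s * y) * (1 + (1 - s) * y)) + (1 - s) * (exp (s * y) * (1 - s * y))"
    by (simp add: algebra_simps)
  also have "\<dots> \<le> s * exp y + (1 - s) * 1"
    using 1 2 assms by (intro add_mono mult_left_mono) auto
  finally have "exp (s * y) \<le> 1 + s * (x - 1)" by (simp add: y algebra_simps)
  moreover have "x powr s = exp (s * y)" using assms by (simp add: powr_def y_def)
  ultimately show ?thesis by simp
qed

text \<open>Under the law with density proportional to \<open>exp (\<theta> * Z T)\<close> the variable \<open>Z T / T\<close> concentrates at the
derivative \<open>a\<close>: the two tails are bounded by the exponential moments at \<open>\<theta> + \<delta>\<close> and \<open>\<theta> - \<delta>\<close>, which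
are exponentially smaller than that at \<open>\<theta>\<close> by the definition of the derivative. On the event that
remains, the density is at most \<open>exp (\<theta> * (a + \<epsilon>) * T)\<close> up to normalization.\<close>

lemma (in prob_space) tilted_lower_bound:
  fixes Z :: "real \<Rightarrow> 'a \<Rightarrow> real" and L :: "real \<Rightarrow> real"
  assumes Zm: "\<And>T. 0 \<le> T \<Longrightarrow> Z T \<in> borel_measurable M"
    and mgf: "\<And>T s. 0 \<le> T \<Longrightarrow> 0 \<le> s \<Longrightarrow> (\<integral>\<^sup>+\<omega>. ennreal (exp (s * Z T \<omega>)) \<partial>M) = ennreal (exp (T * L s))"
    and deriv: "(L has_real_derivative a) (at \<theta>)" and \<theta>: "0 < \<theta>" and \<epsilon>: "0 < \<epsilon>"
  shows "\<forall>\<^sub>F T in at_top. exp (T * (L \<theta> - \<theta> * (a + \<epsilon>))) / 2 \<le> prob {\<omega> \<in> space M. (a - \<epsilon>) * T \<le> Z T \<omega>}"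
proof -
  have "((\<lambda>h. (L (\<theta> + h) - L \<theta>) / h) \<longlongrightarrow> a) (at 0)" using deriv by (simp add: DERIV_def)
  then have "\<forall>\<^sub>F h in at 0. dist ((L (\<theta> + h) - L \<theta>) / h) a < \<epsilon>" using \<epsilon> by (rule tendstoD)
  then obtain d where d: "0 < d" "\<And>h. h \<noteq> 0 \<Longrightarrow> \<bar>h\<bar> < d \<Longrightarrow> \<bar>(L (\<theta> + h) - L \<theta>) / h - a\<bar> < \<epsilon>"
    by (auto simp: eventually_at dist_real_def)
  define \<delta> where "\<delta> = min (d / 2) (\<theta> / 2)"
  have \<delta>: "0 < \<delta>" "\<delta> < d" "\<delta> < \<theta>" using d \<theta> by (auto simp: \<delta>_def)
  \<comment> \<open>The exponential rates at which the upper and the lower tail lose against the moment at \<open>\<theta>\<close>.\<close>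
  define c1 where "c1 = \<delta> * (a + \<epsilon>) - (L (\<theta> + \<delta>) - L \<theta>)"
  define c2 where "c2 = - \<delta> * (a - \<epsilon>) - (L (\<theta> - \<delta>) - L \<theta>)"
  have "(L (\<theta> + \<delta>) - L \<theta>) / \<delta> < a + \<epsilon>" using d(2)[of \<delta>] \<delta> by (simp add: abs_less_iff)
  then have c1: "0 < c1" using \<delta> by (simp add: c1_def pos_divide_less_eq mult.commute)
  have "a - \<epsilon> < (L (\<theta> - \<delta>) - L \<theta>) / (- \<delta>)" using d(2)[of "- \<delta>"] \<delta> by (simp add: abs_less_iff)
  then have c2: "0 < c2" using \<delta> by (simp add: c2_def field_simps)
  have "((\<lambda>T. exp (- c1 * T) + exp (- c2 * T)) \<longlongrightarrow> 0 + 0) at_top"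
    using c1 c2
    by (intro tendsto_add filterlim_compose[OF exp_at_bot] filterlim_tendsto_neg_mult_at_bot[OF tendsto_const] filterlim_ident) auto
  then have "\<forall>\<^sub>F T in at_top. exp (- c1 * T) + exp (- c2 * T) < 1 / 2"
    by (intro order_tendstoD) auto
  then show ?thesis using eventually_ge_at_top[of 0]
  proof eventually_elim
    case (elim T)
    note [measurable] = Zm[OF elim(2)]
    let ?E = "{\<omega> \<in> space M. (a - \<epsilon>) * T \<le> Z T \<omega>}"
    let ?e = "\<lambda>x. ennreal (exp x)"
    have "?e (T * L \<theta>) = (\<integral>\<^sup>+\<omega>. ?e (\<theta> * Z T \<omega>) \<partial>M)" using elim \<theta> by (simp add: mgf)
    also have "\<dots> \<le> (\<integral>\<^sup>+\<omega>. ?e (\<theta> * (a + \<epsilon>) * T) * indicator ?E \<omega>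
        + (?e (- \<delta> * (a + \<epsilon>) * T) * ?e ((\<theta> + \<delta>) * Z T \<omega>) + ?e (\<delta> * (a - \<epsilon>) * T) * ?e ((\<theta> - \<delta>) * Z T \<omega>)) \<partial>M)"
    proof (rule nn_integral_mono)
      fix \<omega> assume \<omega>: "\<omega> \<in> space M"
      consider "(a + \<epsilon>) * T < Z T \<omega>" | "Z T \<omega> < (a - \<epsilon>) * T"
        | "Z T \<omega> \<le> (a + \<epsilon>) * T" "(a - \<epsilon>) * T \<le> Z T \<omega>" by linarith
      then show "?e (\<theta> * Z T \<omega>) \<le> ?e (\<theta> * (a + \<epsilon>) * T) * indicator ?E \<omega>
        + (?e (- \<delta> * (a + \<epsilon>) * T) * ?e ((\<theta> + \<delta>) * Z T \<omega>) + ?e (\<delta> * (a - \<epsilon>) * T) * ?e ((\<theta> - \<delta>) * Z T \<omega>))"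
      proof cases
        case 1
        have "\<delta> * ((a + \<epsilon>) * T) \<le> \<delta> * Z T \<omega>" using 1 \<delta> by (intro mult_left_mono) auto
        then have "?e (\<theta> * Z T \<omega>) \<le> ?e (- \<delta> * (a + \<epsilon>) * T) * ?e ((\<theta> + \<delta>) * Z T \<omega>)"
          by (simp add: ennreal_mult'[symmetric] exp_add[symmetric] algebra_simps)
        then show ?thesis by (simp add: add_increasing add_increasing2)
      next
        case 2
        have "\<delta> * Z T \<omega> \<le> \<delta> * ((a - \<epsilon>) * T)" using 2 \<delta> by (intro mult_left_mono) auto
        then have "?e (\<theta> * Z T \<omega>) \<le> ?e (\<delta> * (a - \<epsilon>) * T) * ?e ((\<theta> - \<delta>) * Z T \<omega>)"
          by (simp add: ennreal_mult'[symmetric] exp_add[symmetric] algebra_simps)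
        then show ?thesis by (simp add: add_increasing)
      next
        case 3
        have "\<theta> * Z T \<omega> \<le> \<theta> * ((a + \<epsilon>) * T)" using 3 \<theta> by (intro mult_left_mono) auto
        then have "?e (\<theta> * Z T \<omega>) \<le> ?e (\<theta> * (a + \<epsilon>) * T) * indicator ?E \<omega>"
          using 3 \<omega> by (simp add: mult.assoc)
        then show ?thesis by (simp add: add_increasing2)
      qed
    qed
    also have "\<dots> = ?e (\<theta> * (a + \<epsilon>) * T) * emeasure M ?E
        + (?e (- \<delta> * (a + \<epsilon>) * T) * ?e (T * L (\<theta> + \<delta>)) + ?e (\<delta> * (a - \<epsilon>) * T) * ?e (T * L (\<theta> - \<delta>)))"
    proof -
      have "0 \<le> \<theta> + \<delta>" "0 \<le> \<theta> - \<delta>" using \<delta> \<theta> by auto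
      note [simp] = mgf[OF elim(2) this(1)] mgf[OF elim(2) this(2)]
      show ?thesis by (simp add: nn_integral_add nn_integral_cmult del: mult_minus_left)
    qed
    also have "\<dots> = ennreal (exp (\<theta> * (a + \<epsilon>) * T) * prob ?E
        + (exp (- \<delta> * (a + \<epsilon>) * T) * exp (T * L (\<theta> + \<delta>)) + exp (\<delta> * (a - \<epsilon>) * T) * exp (T * L (\<theta> - \<delta>))))"
      by (simp add: emeasure_eq_measure ennreal_mult'[symmetric] flip: ennreal_plus)
    finally have "exp (T * L \<theta>) \<le> exp (\<theta> * (a + \<epsilon>) * T) * prob ?E
        + (exp (- \<delta> * (a + \<epsilon>) * T) * exp (T * L (\<theta> + \<delta>)) + exp (\<delta> * (a - \<epsilon>) * T) * exp (T * L (\<theta> - \<delta>)))"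
      by (subst (asm) ennreal_le_iff) (simp_all add: add_nonneg_nonneg)
    moreover have "exp (- \<delta> * (a + \<epsilon>) * T) * exp (T * L (\<theta> + \<delta>)) = exp (T * L \<theta>) * exp (- c1 * T)"
      by (simp add: exp_add[symmetric] c1_def algebra_simps)
    moreover have "exp (\<delta> * (a - \<epsilon>) * T) * exp (T * L (\<theta> - \<delta>)) = exp (T * L \<theta>) * exp (- c2 * T)"
      by (simp add: exp_add[symmetric] c2_def algebra_simps)
    moreover have "exp (T * L \<theta>) * (exp (- c1 * T) + exp (- c2 * T)) \<le> exp (T * L \<theta>) * (1 / 2)"
      using elim by (intro mult_left_mono) auto
    ultimately have "exp (T * L \<theta>) / 2 \<le> exp (\<theta> * (a + \<epsilon>) * T) * prob ?E"
      by (simp add: distrib_left)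
    then have "exp (- (\<theta> * (a + \<epsilon>) * T)) * (exp (T * L \<theta>) / 2)
        \<le> exp (- (\<theta> * (a + \<epsilon>) * T)) * (exp (\<theta> * (a + \<epsilon>) * T) * prob ?E)"
      by (intro mult_left_mono) auto
    moreover have "exp (- (\<theta> * (a + \<epsilon>) * T)) * (exp (T * L \<theta>) / 2) = exp (T * (L \<theta> - \<theta> * (a + \<epsilon>))) / 2"
      by (simp add: exp_add[symmetric] algebra_simps)
    moreover have "exp (- (\<theta> * (a + \<epsilon>) * T)) * (exp (\<theta> * (a + \<epsilon>) * T) * prob ?E) = prob ?E"
      by (simp add: mult.assoc[symmetric] exp_add[symmetric])
    ultimately show ?case by simp
  qed
qed

text \<open>The mean value theorem applied to \<open>L x - r * x\<close> between its last point in \<open>[0, t]\<close> where it is not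
positive and the point \<open>t\<close>.\<close>

lemma exists_excess_slope:
  fixes L :: "real \<Rightarrow> real"
  assumes d: "\<And>x. (L has_real_derivative L' x) (at x)" and L0: "L 0 = 0" and t: "0 < t" "r * t < L t"
  obtains s where "0 < s" "s \<le> t" "r * s \<le> L s" "r < L' s"
proof -
  define f where "f x = L x - r * x" for x
  have df: "(f has_real_derivative (L' x - r)) (at x)" for x
    unfolding f_def by (auto intro!: derivative_eq_intros d)
  then have cont: "continuous_on S f" for S
    by (intro continuous_at_imp_continuous_on ballI DERIV_isCont[OF df])
  define Z where "Z = {0..t} \<inter> f -` {..0}"
  have "closed Z" unfolding Z_def by (intro continuous_closed_preimage cont) auto
  moreover have "bounded Z"
    by (rule bounded_subset[OF bounded_closed_interval[of 0 t]]) (simp add: Z_def)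
  ultimately have "compact Z" by (simp add: compact_eq_bounded_closed)
  have "0 \<in> Z" using L0 t by (simp add: Z_def f_def)
  then have "Z \<noteq> {}" by blast
  obtain s0 where s0: "s0 \<in> Z" "\<And>x. x \<in> Z \<Longrightarrow> x \<le> s0"
    using compact_attains_sup[OF \<open>compact Z\<close> \<open>Z \<noteq> {}\<close>] by blast
  have s0': "0 \<le> s0" "s0 \<le> t" "f s0 \<le> 0" using s0(1) by (simp_all add: Z_def)
  have ft: "0 < f t" using t by (simp add: f_def)
  have "s0 < t" using s0' ft by (cases "s0 = t") simp_all
  obtain s where s: "s0 < s" "s < t" "f t - f s0 = (t - s0) * (L' s - r)"
    using MVT2[OF \<open>s0 < t\<close> df] by blast
  have "0 < (t - s0) * (L' s - r)" using s(3) s0' ft by linarith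
  then have "0 < L' s - r" using \<open>s0 < t\<close> by (simp add: zero_less_mult_iff)
  moreover have "0 < f s"
  proof (rule ccontr)
    assume "\<not> 0 < f s"
    then have "s \<in> Z" using s s0' by (simp add: Z_def)
    then show False using s0(2) s(1) by fastforce
  qed
  ultimately show ?thesis using s0' s by (intro that[of s]) (simp_all add: f_def)
qed

text \<open>The quotient tends to \<open>s\<close> as \<open>\<epsilon>\<close> tends to \<open>0\<close>.\<close>

lemma tilting_accuracy:
  fixes a r s \<eta> :: real
  assumes "r < a" "0 < s" "0 < \<eta>"
  obtains \<epsilon> where "0 < \<epsilon>" "0 < a - \<epsilon> - r" "s * (a + \<epsilon> - r) / (a - \<epsilon> - r) < s + \<eta>"
proof -
  define D where "D = 2 * s + \<eta>"
  have D: "0 < D" using assms by (simp add: D_def)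
  define \<epsilon> where "\<epsilon> = \<eta> / 2 * (a - r) / D"
  have \<epsilon>0: "0 < \<epsilon>" unfolding \<epsilon>_def using assms D by (intro divide_pos_pos mult_pos_pos) simp_all
  have \<epsilon>D: "\<epsilon> * D = \<eta> / 2 * (a - r)" using D by (simp add: \<epsilon>_def)
  have "(a - r) * (\<eta> / 2) < (a - r) * D"
    by (rule mult_strict_left_mono) (use assms in \<open>simp_all add: D_def\<close>)
  then have "\<epsilon> * D < (a - r) * D" unfolding \<epsilon>D by (simp only: mult.commute)
  then have "\<epsilon> < a - r" by (rule mult_right_less_imp_less) (use D in simp)
  then have pos: "0 < a - \<epsilon> - r" by simp
  have "s * (a + \<epsilon> - r) = (s + \<eta>) * (a - \<epsilon> - r) - (\<eta> * (a - r) - \<epsilon> * D)"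
    by (simp add: D_def algebra_simps)
  also have "\<dots> < (s + \<eta>) * (a - \<epsilon> - r)" unfolding \<epsilon>D using assms by simp
  finally have "s * (a + \<epsilon> - r) / (a - \<epsilon> - r) < s + \<eta>" using pos by (simp add: pos_divide_less_eq)
  then show ?thesis by (intro that[of \<epsilon>] \<epsilon>0 pos)
qed

text \<open>Descendants of descendants are descendants, and their delays add up.\<close>

lemma delay_append: "delay X \<omega> v (u1 @ u2) = delay X \<omega> v u2 + delay X \<omega> (u2 @ v) u1"
proof (induction u1)
  case (Cons p u1)
  then show ?case by (cases p) (simp add: add.assoc)
qed simp

context compound_hawkes
begin

section \<open>Independent sources and thinned products\<close>

lemma source_sets_subset: "source_sets M X B U s \<subseteq> events"
  using independent unfolding indep_sets_def by auto

lemma Int_stable_source_sets: "Int_stable (source_sets M X B U s)"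
proof (cases s)
  case (Family v)
  then show ?thesis by (cases v) (auto intro!: sets.Int_stable)
next
  case (Claim j r)
  then show ?thesis by (auto intro!: sets.Int_stable)
qed

text \<open>The information carried by a set of sources.\<close>

definition info :: "'d source set \<Rightarrow> 'w measure" where
  "info J = sigma (space M) (\<Union>s\<in>J. source_sets M X B U s)"

lemma source_sets_Pow: "(\<Union>s\<in>J. source_sets M X B U s) \<subseteq> Pow (space M)"
  using source_sets_subset sets.sets_into_space by blast

lemma space_info [simp]: "space (info J) = space M"
  unfolding info_def by (rule space_measure_of[OF source_sets_Pow])

lemma sets_info: "sets (info J) = sigma_sets (space M) (\<Union>s\<in>J. source_sets M X B U s)"
  unfolding info_def by (rule sets_measure_of[OF source_sets_Pow])

lemma sets_info_subset: "sets (info J) \<subseteq> sets M"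
  unfolding sets_info using source_sets_subset by (intro sets.sigma_sets_subset) auto

lemma info_measurable: "f \<in> measurable (info J) N \<Longrightarrow> f \<in> measurable M N"
  using sets_info_subset by (auto simp: measurable_def)

lemma sets_info_mono: "J \<subseteq> J' \<Longrightarrow> sets (info J) \<subseteq> sets (info J')"
  unfolding sets_info by (intro sigma_sets_mono') auto

lemma info_measurable_mono:
  assumes "f \<in> measurable (info J) N" "J \<subseteq> J'"
  shows "f \<in> measurable (info J') N"
  using assms sets_info_mono[OF assms(2)] by (auto simp: measurable_def)

lemma source_measurable_info:
  assumes "s \<in> J" "f \<in> space M \<rightarrow> space N"
    "\<And>A. A \<in> sets N \<Longrightarrow> f -` A \<inter> space M \<in> source_sets M X B U s"
  shows "f \<in> measurable (info J) N"
proof (rule measurableI)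
  fix A assume "A \<in> sets N"
  then have "f -` A \<inter> space M \<in> source_sets M X B U s" by (rule assms)
  then show "f -` A \<inter> space (info J) \<in> sets (info J)"
    using assms(1) by (auto simp: sets_info)
qed (use assms(2) in auto)

lemma X_measurable_info:
  assumes "Family v \<in> J"
  shows "X v m k \<in> borel_measurable (info J)"
proof (rule source_measurable_info[OF assms])
  fix A :: "ereal set" assume A: "A \<in> sets borel"
  show "X v m k -` A \<inter> space M \<in> source_sets M X B U (Family v)"
  proof (cases "v = []")
    case True
    let ?P = "\<lambda>\<omega>. \<lambda>(m, k). X [] m k \<omega>"
    have "?P \<in> measurable (vimage_algebra (space M) ?P (Pi\<^sub>M UNIV (\<lambda>_. borel))) (Pi\<^sub>M UNIV (\<lambda>_. borel))"
      by (rule measurable_vimage_algebra1) (auto simp: space_PiM)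
    from measurable_compose[OF this, of "\<lambda>f. f (m, k)" borel]
    have "X [] m k \<in> measurable (vimage_algebra (space M) ?P (Pi\<^sub>M UNIV (\<lambda>_. borel))) borel"
      by simp
    from measurable_sets[OF this A] show ?thesis using True by simp
  next
    case False
    let ?P = "\<lambda>\<omega>. (B v \<omega>, \<lambda>(m, k). X v m k \<omega>)"
    have "?P \<in> measurable (vimage_algebra (space M) ?P (borel \<Otimes>\<^sub>M Pi\<^sub>M UNIV (\<lambda>_. borel))) (borel \<Otimes>\<^sub>M Pi\<^sub>M UNIV (\<lambda>_. borel))"
      by (rule measurable_vimage_algebra1) (auto simp: space_pair_measure space_PiM)
    from measurable_compose[OF this, of "\<lambda>q. snd q (m, k)" borel]
    have "X v m k \<in> measurable (vimage_algebra (space M) ?P (borel \<Otimes>\<^sub>M Pi\<^sub>M UNIV (\<lambda>_. borel))) borel"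
      by simp
    from measurable_sets[OF this A] show ?thesis using False by simp
  qed
qed auto

lemma U_measurable_info:
  assumes "Claim j r \<in> J"
  shows "U j r \<in> borel_measurable (info J)"
proof (rule source_measurable_info[OF assms])
  fix A :: "(real ^ 'e) set" assume A: "A \<in> sets borel"
  have "U j r \<in> measurable (vimage_algebra (space M) (U j r) borel) borel"
    by (rule measurable_vimage_algebra1) auto
  from measurable_sets[OF this A] show "U j r -` A \<inter> space M \<in> source_sets M X B U (Claim j r)"
    by simp
qed auto

lemma X_measurable [measurable]: "X v m k \<in> borel_measurable M"
  using X_measurable_info[of v UNIV] info_measurable by blast

text \<open>Grouping independent sources into disjoint blocks preserves independence.\<close>

lemma indep_info:
  fixes f h :: "'w \<Rightarrow> ennreal"
  assumes "f \<in> borel_measurable (info J)" "h \<in> borel_measurable (info J')" "J \<inter> J' = {}"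
  shows "(\<integral>\<^sup>+\<omega>. f \<omega> * h \<omega> \<partial>M) = (\<integral>\<^sup>+\<omega>. f \<omega> \<partial>M) * (\<integral>\<^sup>+\<omega>. h \<omega> \<partial>M)"
proof (rule nn_integral_indep_mult)
  let ?J = "case_bool J J'"
  have "indep_sets (\<lambda>b. sigma_sets (space M) (\<Union>s\<in>?J b. source_sets M X B U s)) UNIV"
    by (rule indep_sets_collect_sigma)
      (use assms(3) in \<open>auto simp: disjoint_family_on_def Int_stable_source_sets split: bool.splits
        intro!: indep_sets_mono_index[OF _ independent]\<close>)
  then have *: "indep_sets (\<lambda>b. sets (info (?J b))) UNIV" by (simp add: sets_info)
  show "indep_var borel f borel h"
    unfolding indep_var_eq indep_set_def
  proof (intro conjI)
    show "indep_sets (case_bool (sigma_sets (space M) {f -` A \<inter> space M |A. A \<in> sets borel})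
            (sigma_sets (space M) {h -` A \<inter> space M |A. A \<in> sets borel})) UNIV"
    proof (rule indep_sets_mono_sets[OF *])
      fix b :: bool
      have "sigma_sets (space (info J)) {f -` A \<inter> space (info J) |A. A \<in> sets borel} \<subseteq> sets (info J)"
        using assms(1) by (intro sets.sigma_sets_subset) (auto dest: measurable_sets simp del: space_info)
      moreover have "sigma_sets (space (info J')) {h -` A \<inter> space (info J') |A. A \<in> sets borel} \<subseteq> sets (info J')"
        using assms(2) by (intro sets.sigma_sets_subset) (auto dest: measurable_sets simp del: space_info)
      ultimately show "(case b of True \<Rightarrow> sigma_sets (space M) {f -` A \<inter> space M |A. A \<in> sets borel}
         | False \<Rightarrow> sigma_sets (space M) {h -` A \<inter> space M |A. A \<in> sets borel}) \<subseteq> sets (info (?J b))"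
        by (cases b) auto
    qed
  qed (use assms info_measurable in blast)+
qed

text \<open>The weights are replaced by their expectations one at a time. On the event that the index is
selected, the weight is independent of everything else, and otherwise it does not occur. The
factor \<open>\<psi>\<close> absorbs the expectations of the weights already treated.\<close>

lemma nn_integral_thinned_prod_finite:
  fixes W :: "'p \<Rightarrow> 'w \<Rightarrow> ennreal"
  assumes "finite F"
    and "\<psi> \<in> borel_measurable (info J0)"
    and "\<And>p. {\<omega> \<in> space M. p \<in> A \<omega>} \<in> sets (info J0)"
    and "\<And>p. W p \<in> borel_measurable (info (J p))"
    and "\<And>p. J0 \<inter> J p = {}" and "\<And>p q. p \<noteq> q \<Longrightarrow> J p \<inter> J q = {}"
  shows "(\<integral>\<^sup>+\<omega>. \<psi> \<omega> * (\<Prod>p\<in>F. if p \<in> A \<omega> then W p \<omega> else 1) \<partial>M)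
       = (\<integral>\<^sup>+\<omega>. \<psi> \<omega> * (\<Prod>p\<in>F. if p \<in> A \<omega> then (\<integral>\<^sup>+\<omega>'. W p \<omega>' \<partial>M) else 1) \<partial>M)"
  using assms(1,2)
proof (induction F arbitrary: \<psi> rule: finite_induct)
  case (insert p F)
  let ?e = "\<integral>\<^sup>+\<omega>. W p \<omega> \<partial>M"
  let ?R = "\<lambda>\<omega>. \<Prod>q\<in>F. if q \<in> A \<omega> then W q \<omega> else 1"
  define J1 where "J1 = J0 \<union> (\<Union>q\<in>F. J q)"
  have disj: "J1 \<inter> J p = {}" 
  proof -
    have "J q \<inter> J p = {}" if "q \<in> F" for q using insert(2) that by (intro assms(6)) auto
    then show ?thesis using assms(5) by (auto simp: J1_def)
  qed
  have Ameas: "Measurable.pred (info J0) (\<lambda>\<omega>. q \<in> A \<omega>)" for q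
    unfolding pred_def using assms(3)[of q] by simp
  have Rm: "?R \<in> borel_measurable (info J1)"
  proof (rule borel_measurable_prod_ennreal)
    fix q assume "q \<in> F"
    have [measurable]: "Measurable.pred (info J1) (\<lambda>\<omega>. q \<in> A \<omega>)"
      by (rule info_measurable_mono[OF Ameas]) (auto simp: J1_def)
    have [measurable]: "W q \<in> borel_measurable (info J1)"
      by (rule info_measurable_mono[OF assms(4)]) (use \<open>q \<in> F\<close> in \<open>auto simp: J1_def\<close>)
    show "(\<lambda>\<omega>. if q \<in> A \<omega> then W q \<omega> else 1) \<in> borel_measurable (info J1)" by measurable
  qed
  have [measurable]: "Measurable.pred (info J1) (\<lambda>\<omega>. p \<in> A \<omega>)"
    by (rule info_measurable_mono[OF Ameas]) (auto simp: J1_def)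
  have [measurable]: "\<psi> \<in> borel_measurable (info J1)"
    by (rule info_measurable_mono[OF insert.prems]) (auto simp: J1_def)
  note [measurable] = Rm
  let ?f = "\<lambda>\<omega>. \<psi> \<omega> * (if p \<in> A \<omega> then 1 else 0) * ?R \<omega>"
  let ?g = "\<lambda>\<omega>. \<psi> \<omega> * (if p \<in> A \<omega> then 0 else 1) * ?R \<omega>"
  have fm: "?f \<in> borel_measurable (info J1)" and gm: "?g \<in> borel_measurable (info J1)"
    by measurable
  have Wm: "W p \<in> borel_measurable (info (J p))" by (rule assms(4))
  note fm' = info_measurable[OF fm] and gm' = info_measurable[OF gm] and Wm' = info_measurable[OF Wm]
  have "(\<integral>\<^sup>+\<omega>. \<psi> \<omega> * (\<Prod>q\<in>insert p F. if q \<in> A \<omega> then W q \<omega> else 1) \<partial>M)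
      = (\<integral>\<^sup>+\<omega>. ?f \<omega> * W p \<omega> + ?g \<omega> \<partial>M)"
    using insert(1,2) by (intro nn_integral_cong) (auto simp: mult_ac)
  also have "\<dots> = (\<integral>\<^sup>+\<omega>. ?f \<omega> * W p \<omega> \<partial>M) + (\<integral>\<^sup>+\<omega>. ?g \<omega> \<partial>M)"
    using fm' gm' Wm' by (intro nn_integral_add borel_measurable_times) auto
  also have "(\<integral>\<^sup>+\<omega>. ?f \<omega> * W p \<omega> \<partial>M) = (\<integral>\<^sup>+\<omega>. ?f \<omega> \<partial>M) * ?e"
    by (rule indep_info[OF fm Wm disj])
  also have "(\<integral>\<^sup>+\<omega>. ?f \<omega> \<partial>M) * ?e = (\<integral>\<^sup>+\<omega>. ?f \<omega> * ?e \<partial>M)"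
    using fm' by (intro nn_integral_multc[symmetric])
  also have "\<dots> + (\<integral>\<^sup>+\<omega>. ?g \<omega> \<partial>M) = (\<integral>\<^sup>+\<omega>. ?f \<omega> * ?e + ?g \<omega> \<partial>M)"
    using fm' gm' by (intro nn_integral_add[symmetric] borel_measurable_times) auto
  also have "\<dots> = (\<integral>\<^sup>+\<omega>. (\<psi> \<omega> * (if p \<in> A \<omega> then ?e else 1)) * ?R \<omega> \<partial>M)"
    by (intro nn_integral_cong) (auto simp: mult_ac)
  also have "\<dots> = (\<integral>\<^sup>+\<omega>. (\<psi> \<omega> * (if p \<in> A \<omega> then ?e else 1))
      * (\<Prod>p\<in>F. if p \<in> A \<omega> then (\<integral>\<^sup>+\<omega>'. W p \<omega>' \<partial>M) else 1) \<partial>M)"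
  proof (rule insert.IH)
    note [measurable] = insert.prems Ameas
    show "(\<lambda>\<omega>. \<psi> \<omega> * (if p \<in> A \<omega> then ?e else 1)) \<in> borel_measurable (info J0)" by measurable
  qed
  also have "\<dots> = (\<integral>\<^sup>+\<omega>. \<psi> \<omega> * (\<Prod>q\<in>insert p F. if q \<in> A \<omega> then (\<integral>\<^sup>+\<omega>'. W q \<omega>' \<partial>M) else 1) \<partial>M)"
    using insert(1,2) by (intro nn_integral_cong) (auto simp: mult_ac)
  finally show ?case .
qed simp

text \<open>Weights of at least \<open>1\<close> turn the passage to the infinite product into monotone convergence.\<close>

lemma nn_integral_thinned_iprod:
  fixes W :: "'d \<times> nat \<Rightarrow> 'w \<Rightarrow> ennreal"
  assumes "\<psi> \<in> borel_measurable (info J0)"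
    and "\<And>p. {\<omega> \<in> space M. p \<in> A \<omega>} \<in> sets (info J0)"
    and "\<And>p. W p \<in> borel_measurable (info (J p))"
    and "\<And>p. J0 \<inter> J p = {}" and "\<And>p q. p \<noteq> q \<Longrightarrow> J p \<inter> J q = {}"
    and "\<And>p \<omega>. 1 \<le> W p \<omega>"
  shows "(\<integral>\<^sup>+\<omega>. \<psi> \<omega> * iprod (\<lambda>p. if p \<in> A \<omega> then W p \<omega> else 1) \<partial>M)
       = (\<integral>\<^sup>+\<omega>. \<psi> \<omega> * iprod (\<lambda>p. if p \<in> A \<omega> then (\<integral>\<^sup>+\<omega>'. W p \<omega>' \<partial>M) else 1) \<partial>M)"
proof -
  have [measurable]: "Measurable.pred M (\<lambda>\<omega>. p \<in> A \<omega>)" for p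
    unfolding pred_def using assms(2)[of p] sets_info_subset by auto
  have [measurable]: "W p \<in> borel_measurable M" for p using assms(3) info_measurable by blast
  have [measurable]: "\<psi> \<in> borel_measurable M" using assms(1) info_measurable by blast
  have ge: "1 \<le> (\<integral>\<^sup>+\<omega>. W p \<omega> \<partial>M)" for p
    using nn_integral_mono[of M "\<lambda>_. 1" "W p"] assms(6) by (simp add: emeasure_space_1)
  have lim: "(\<integral>\<^sup>+\<omega>. \<psi> \<omega> * iprod (\<lambda>p. if p \<in> A \<omega> then V p \<omega> else 1) \<partial>M)
     = (SUP n. \<integral>\<^sup>+\<omega>. \<psi> \<omega> * (\<Prod>p\<in>UNIV \<times> {..<n}. if p \<in> A \<omega> then V p \<omega> else 1) \<partial>M)"
    if [measurable]: "\<And>p. V p \<in> borel_measurable M" and V: "\<And>p \<omega>. 1 \<le> V p \<omega>" for V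
    unfolding iprod_def SUP_mult_left_ennreal
  proof (rule nn_integral_monotone_convergence_SUP)
    show "incseq (\<lambda>n \<omega>. \<psi> \<omega> * (\<Prod>p\<in>UNIV \<times> {..<n}. if p \<in> A \<omega> then V p \<omega> else 1))"
    proof (intro incseq_SucI le_funI mult_left_mono)
      fix n \<omega>
      show "(\<Prod>p\<in>UNIV \<times> {..<n}. if p \<in> A \<omega> then V p \<omega> else 1)
           \<le> (\<Prod>p\<in>UNIV \<times> {..<Suc n}. if p \<in> A \<omega> then V p \<omega> else 1)"
        by (rule incseq_SucD[OF incseq_prod_box]) (use V in auto)
    qed simp
  qed measurable
  show ?thesis
    by (subst (1 2) lim)
      (use assms(6) ge in \<open>auto intro!: SUP_cong nn_integral_thinned_prod_finite[OF _ assms(1-5)]\<close>)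
qed

section \<open>Offspring and immigrant counts\<close>

text \<open>The children of \<open>v\<close> with delay in \<open>(0, T]\<close>. For \<open>v = []\<close> these are the immigrants up to time \<open>T\<close>.\<close>

definition offs :: "'d event \<Rightarrow> real \<Rightarrow> 'w \<Rightarrow> ('d \<times> nat) set" where
  "offs v T \<omega> = {(m, k). X v m k \<omega> \<in> ereal ` {0<..T}}"

definition off_count :: "'d event \<Rightarrow> real \<Rightarrow> 'w \<Rightarrow> 'd \<Rightarrow> nat" where
  "off_count v T \<omega> m = card {k. (m, k) \<in> offs v T \<omega>}"

text \<open>The mixed Poisson law of the numbers of children in \<open>(0, T]\<close>. It depends on the parent only through
its component.\<close>

definition off_law :: "real \<Rightarrow> 'd \<Rightarrow> ('d \<Rightarrow> nat) \<Rightarrow> real" where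
  "off_law T j c = (\<integral>b. (\<Prod>m\<in>UNIV. poisson_weight (b $ m * (LBINT t:{0<..T}. g m j t)) (c m)) \<partial>mark_law j)"

lemma ereal_image_borel: "ereal ` {0<..T} \<in> sets borel"
proof -
  have "ereal ` {0<..T} = {0<..ereal T}"
  proof (intro set_eqI iffI)
    fix x assume "x \<in> {0<..ereal T}"
    then show "x \<in> ereal ` {0<..T}" by (cases x) auto
  qed auto
  then show ?thesis by simp
qed

lemma offs_info:
  assumes "Family v \<in> J"
  shows "{\<omega> \<in> space M. p \<in> offs v T \<omega>} \<in> sets (info J)"
proof -
  note [measurable] = X_measurable_info[OF assms, of "fst p" "snd p"] ereal_image_borel[of T]
  have "{\<omega> \<in> space (info J). X v (fst p) (snd p) \<omega> \<in> ereal ` {0<..T}} \<in> sets (info J)"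
    by measurable
  then show ?thesis by (simp add: offs_def case_prod_beta)
qed

lemma finite_offs_iff: "finite (offs v T \<omega>) \<longleftrightarrow> (\<forall>m. finite {k. (m, k) \<in> offs v T \<omega>})"
proof
  assume *: "finite (offs v T \<omega>)"
  show "\<forall>m. finite {k. (m, k) \<in> offs v T \<omega>}"
  proof
    fix m
    have "{k. (m, k) \<in> offs v T \<omega>} \<subseteq> snd ` offs v T \<omega>"
      by (rule subsetI, rule image_eqI[where x="(m, _)"]) simp_all
    then show "finite {k. (m, k) \<in> offs v T \<omega>}" using * by (meson finite_imageI finite_subset)
  qed
next
  assume *: "\<forall>m. finite {k. (m, k) \<in> offs v T \<omega>}"
  have "finite (Sigma UNIV (\<lambda>m. {k. (m, k) \<in> offs v T \<omega>}))" using * by (intro finite_SigmaI) simp_all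
  moreover have "Sigma UNIV (\<lambda>m. {k. (m, k) \<in> offs v T \<omega>}) = offs v T \<omega>" by (auto simp del: split_paired_All)
  ultimately show "finite (offs v T \<omega>)" by simp
qed

lemma pred_finite_offs:
  assumes "Family v \<in> J"
  shows "Measurable.pred (info J) (\<lambda>\<omega>. finite (offs v T \<omega>))"
proof -
  have [measurable]: "{\<omega> \<in> space (info J). k \<in> {k. (m, k) \<in> offs v T \<omega>}} \<in> sets (info J)" for m k
    using offs_info[OF assms, of "(m, k)"] by simp
  show ?thesis unfolding finite_offs_iff by measurable
qed

lemma off_count_info:
  assumes "Family v \<in> J"
  shows "off_count v T \<in> measurable (info J) (count_space UNIV)"
proof -
  have [measurable]: "{\<omega> \<in> space (info J). k \<in> {k. (m, k) \<in> offs v T \<omega>}} \<in> sets (info J)" for m k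
    using offs_info[OF assms, of "(m, k)"] by simp
  have [measurable]: "(\<lambda>\<omega>. off_count v T \<omega> m) \<in> measurable (info J) (count_space UNIV)" for m
    unfolding off_count_def by measurable
  show ?thesis
    unfolding measurable_count_space_eq2_countable
  proof (intro conjI ballI)
    fix c :: "'d \<Rightarrow> nat"
    have "off_count v T -` {c} \<inter> space (info J) = {\<omega>\<in>space (info J). \<forall>m. off_count v T \<omega> m = c m}"
      by auto
    also have "\<dots> \<in> sets (info J)" by measurable
    finally show "off_count v T -` {c} \<inter> space (info J) \<in> sets (info J)" .
  qed simp
qed

lemma points_in_offs: "points_in (\<lambda>k. X v m k \<omega>) {0<..T} = {k. (m, k) \<in> offs v T \<omega>}"
  by (auto simp: points_in_def offs_def)

lemma claim_prob_space: "prob_space (claim_law j)"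
  using claim_distr[of j 0] claim_measurable[of j 0] by (metis prob_space_distr)

lemma sets_mark_law [measurable_cong, simp]: "sets (mark_law j) = sets borel"
  using mark_distr[of "[(j, 0)]"] by (metis comp_of_def fst_conv list.distinct(1) list.sel(1) sets_distr)

lemma sets_claim_law [measurable_cong, simp]: "sets (claim_law j) = sets borel"
  using claim_distr[of j 0] by (metis sets_distr)

lemma prob_offspring_counts:
  assumes "v \<noteq> []" "\<And>m. A m \<in> sets borel" "\<And>m. bounded (A m)" "\<And>m. A m \<subseteq> {0<..}"
  shows "prob {\<omega> \<in> space M. \<forall>m. finite (points_in (\<lambda>k. X v m k \<omega>) (A m))
            \<and> card (points_in (\<lambda>k. X v m k \<omega>) (A m)) = c m}
       = (\<integral>b. (\<Prod>m\<in>UNIV. poisson_weight (b $ m * (LBINT t:A m. g m (comp_of v) t)) (c m)) \<partial>mark_law (comp_of v))"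
proof -
  let ?h = "\<lambda>b :: real ^ 'd. (\<Prod>m\<in>UNIV. poisson_weight (b $ m * (LBINT t:A m. g m (comp_of v) t)) (c m))"
  have "prob {\<omega> \<in> space M. B v \<omega> \<in> UNIV \<and> (\<forall>m. \<forall>i<1::nat. finite (points_in (\<lambda>k. X v m k \<omega>) (A m))
            \<and> card (points_in (\<lambda>k. X v m k \<omega>) (A m)) = c m)}
       = (\<integral>\<omega>. indicator UNIV (B v \<omega>) *
          (\<Prod>m\<in>UNIV. \<Prod>i<1::nat. poisson_weight (LBINT t:A m. B v \<omega> $ m * g m (comp_of v) t) (c m)) \<partial>M)"
    using offspring[OF assms(1)] unfolding poisson_given_def
    apply (elim conjE)
    apply (erule ballE[of _ _ UNIV])
     apply (erule allE[of _ "1::nat"])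
     apply (erule allE[of _ "\<lambda>m i. A m"])
     apply (erule allE[of _ "\<lambda>m i. c m"])
     apply (use assms(2-4) in \<open>auto simp: disjoint_family_on_def\<close>)
    done
  also have "\<dots> = (\<integral>\<omega>. ?h (B v \<omega>) \<partial>M)" by simp
  also have "\<dots> = (\<integral>b. ?h b \<partial>distr M borel (B v))"
    by (rule integral_distr[symmetric])
      (use mark_measurable[OF assms(1)] in \<open>simp_all add: poisson_weight_def\<close>)
  finally show ?thesis using mark_distr[OF assms(1)] by simp
qed

lemma prob_off_count:
  assumes "v \<noteq> []"
  shows "prob {\<omega> \<in> space M. finite (offs v T \<omega>) \<and> off_count v T \<omega> = c} = off_law T (comp_of v) c"
  unfolding off_law_def
  by (subst prob_offspring_counts[of v "\<lambda>_. {0<..T}", symmetric])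
    (use assms in \<open>auto simp: points_in_offs finite_offs_iff off_count_def fun_eq_iff intro!: arg_cong[where f=prob]\<close>)

text \<open>For the immigrants the environment is trivial and the intensity constant.\<close>

lemma prob_immigrant_counts:
  assumes "0 \<le> T"
  shows "prob {\<omega> \<in> space M. finite (offs [] T \<omega>) \<and> off_count [] T \<omega> = c}
       = (\<Prod>m\<in>UNIV. poisson_weight (base $ m * T) (c m))"
proof -
  have "prob {\<omega> \<in> space M. () \<in> UNIV \<and> (\<forall>m. \<forall>i<1::nat. finite (points_in (\<lambda>k. X [] m k \<omega>) {0<..T})
            \<and> card (points_in (\<lambda>k. X [] m k \<omega>) {0<..T}) = c m)}
       = (\<integral>\<omega>. indicator UNIV () *
          (\<Prod>m\<in>UNIV. \<Prod>i<1::nat. poisson_weight (LBINT t:{0<..T}. base $ m) (c m)) \<partial>M)"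
    using immigrants unfolding poisson_given_def
    apply (elim conjE)
    apply (erule ballE[of _ _ UNIV])
     apply (erule allE[of _ "1::nat"])
     apply (erule allE[of _ "\<lambda>m i. {0<..T}"])
     apply (erule allE[of _ "\<lambda>m i. c m"])
     apply (auto simp: disjoint_family_on_def)
    done
  also have "\<dots> = (\<Prod>m\<in>UNIV. poisson_weight (base $ m * T) (c m))"
    using assms by (simp add: set_integral_const prob_space mult.commute)
  finally show ?thesis
    by (simp add: points_in_offs finite_offs_iff off_count_def fun_eq_iff all_conj_distrib)
qed

text \<open>The weights of the finite count vectors are those of a product of Poisson laws, which has mass \<open>1\<close>.
Hence infinite counts have probability \<open>0\<close>.\<close>

lemma distr_immigrant_counts:
  assumes "0 \<le> T"
  shows "(AE \<omega> in M. finite (offs [] T \<omega>))"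
    "distr M (count_space UNIV) (off_count [] T)
       = measure_pmf (Pi_pmf UNIV 0 (\<lambda>m. poisson_weight_pmf (base $ m * T)))" (is "_ = measure_pmf ?Q")
proof -
  have [measurable]: "off_count [] T \<in> measurable M (count_space UNIV)"
    "Measurable.pred M (\<lambda>\<omega>. finite (offs [] T \<omega>))"
    using off_count_info[of "[]" UNIV] pred_finite_offs[of "[]" UNIV] info_measurable by blast+
  have Q: "pmf ?Q c = prob {\<omega> \<in> space M. finite (offs [] T \<omega>) \<and> off_count [] T \<omega> = c}" for c
    using assms base_nonneg
    by (subst pmf_Pi) (auto simp: prob_immigrant_counts pmf_poisson_weight_pmf)
  have "1 = (\<integral>\<^sup>+c. ennreal (pmf ?Q c) \<partial>count_space UNIV)"
    by (simp add: nn_integral_pmf measure_pmf.emeasure_space_1[simplified])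
  also have "\<dots> = (\<integral>\<^sup>+c. emeasure M {\<omega> \<in> space M. finite (offs [] T \<omega>) \<and> off_count [] T \<omega> = c} \<partial>count_space UNIV)"
    by (simp add: Q emeasure_eq_measure)
  also have "\<dots> = emeasure M (\<Union>c. {\<omega> \<in> space M. finite (offs [] T \<omega>) \<and> off_count [] T \<omega> = c})"
    by (rule emeasure_UN_countable[symmetric]) (auto simp: disjoint_family_on_def)
  also have "(\<Union>c. {\<omega> \<in> space M. finite (offs [] T \<omega>) \<and> off_count [] T \<omega> = c}) = {\<omega> \<in> space M. finite (offs [] T \<omega>)}"
    by auto
  finally have "prob {\<omega> \<in> space M. finite (offs [] T \<omega>)} = 1" by (simp add: measure_def)
  then show AE: "AE \<omega> in M. finite (offs [] T \<omega>)"
    using AE_prob_1 by fastforce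
  show "distr M (count_space UNIV) (off_count [] T) = measure_pmf ?Q"
  proof (rule measure_eqI_countable[of _ UNIV])
    fix c
    have "emeasure (distr M (count_space UNIV) (off_count [] T)) {c}
        = emeasure M {\<omega> \<in> space M. off_count [] T \<omega> = c}"
      by (subst emeasure_distr) (auto intro!: arg_cong[where f="emeasure M"])
    also have "\<dots> = emeasure M {\<omega> \<in> space M. finite (offs [] T \<omega>) \<and> off_count [] T \<omega> = c}"
      using AE by (intro emeasure_eq_AE) auto
    also have "\<dots> = emeasure (measure_pmf ?Q) {c}"
      by (simp add: emeasure_pmf_single Q emeasure_eq_measure)
    finally show "emeasure (distr M (count_space UNIV) (off_count [] T)) {c} = emeasure (measure_pmf ?Q) {c}" .
  qed auto
qed

lemma nn_integral_iprod_immigrants: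
  fixes F :: "'d \<Rightarrow> ennreal"
  assumes T: "0 \<le> T" and F: "\<And>j. 1 \<le> F j"
  shows "(\<integral>\<^sup>+\<omega>. iprod (\<lambda>p. if p \<in> offs [] T \<omega> then F (fst p) else 1) \<partial>M)
       = (\<Prod>j\<in>UNIV. \<Sum>n. ennreal (poisson_weight (base $ j * T) n) * F j ^ n)"
proof -
  have [measurable]: "off_count [] T \<in> measurable M (count_space UNIV)"
    using off_count_info[of "[]" UNIV] info_measurable by blast
  have "(\<integral>\<^sup>+\<omega>. iprod (\<lambda>p. if p \<in> offs [] T \<omega> then F (fst p) else 1) \<partial>M)
      = (\<integral>\<^sup>+\<omega>. (\<Prod>j\<in>UNIV. F j ^ off_count [] T \<omega> j) \<partial>M)"
  proof (rule nn_integral_cong_AE, rule eventually_mono[OF distr_immigrant_counts(1)[OF T]])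
    fix \<omega> assume fin: "finite (offs [] T \<omega>)"
    have "iprod (\<lambda>p. if p \<in> offs [] T \<omega> then F (fst p) else 1) = (\<Prod>p\<in>offs [] T \<omega>. F (fst p))"
      by (rule iprod_finite_support[OF fin F])
    then show "iprod (\<lambda>p. if p \<in> offs [] T \<omega> then F (fst p) else 1) = (\<Prod>j\<in>UNIV. F j ^ off_count [] T \<omega> j)"
      by (simp only: prod_fst_power[OF fin] off_count_def)
  qed
  also have "\<dots> = (\<integral>\<^sup>+c. (\<Prod>j\<in>UNIV. F j ^ c j) \<partial>distr M (count_space UNIV) (off_count [] T))"
    by (subst nn_integral_distr) auto
  also have "\<dots> = (\<Prod>j\<in>UNIV. \<integral>\<^sup>+n. F j ^ n \<partial>measure_pmf (poisson_weight_pmf (base $ j * T)))"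
    unfolding distr_immigrant_counts(2)[OF T] by (rule nn_integral_prod_Pi_pmf) simp
  also have "\<dots> = (\<Prod>j\<in>UNIV. \<Sum>n. ennreal (poisson_weight (base $ j * T) n) * F j ^ n)"
    using T base_nonneg
    by (simp add: nn_integral_measure_pmf nn_integral_count_space_nat pmf_poisson_weight_pmf)
  finally show ?thesis .
qed

text \<open>Components with rate \<open>0\<close> have no immigrants, and their factor may be infinite.\<close>

lemma nn_integral_iprod_immigrants_exp:
  fixes F :: "'d \<Rightarrow> ennreal"
  assumes T: "0 \<le> T" and F: "\<And>j. 1 \<le> F j" and fin: "\<And>j. base $ j > 0 \<Longrightarrow> F j < \<infinity>"
  shows "(\<integral>\<^sup>+\<omega>. iprod (\<lambda>p. if p \<in> offs [] T \<omega> then F (fst p) else 1) \<partial>M)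
       = ennreal (exp (T * (\<Sum>j\<in>UNIV. base $ j * (enn2real (F j) - 1))))"
proof -
  have "(\<Sum>n. ennreal (poisson_weight (base $ j * T) n) * F j ^ n)
      = ennreal (exp (base $ j * T * (enn2real (F j) - 1)))" for j
  proof (cases "base $ j = 0")
    case True
    have "(\<lambda>n. ennreal (poisson_weight 0 n) * F j ^ n) = (\<lambda>n. if n = 0 then 1 else 0)"
      by (auto simp: poisson_weight_def fun_eq_iff)
    then show ?thesis using True sums_single[of 0 "\<lambda>_. 1 :: ennreal"] by (simp add: sums_iff)
  next
    case False
    then have pos: "base $ j > 0" using base_nonneg[of j] by auto
    obtain f where f: "F j = ennreal f" "0 \<le> f" using fin[OF pos] by (cases "F j") auto
    have "ennreal (poisson_weight (base $ j * T) n) * F j ^ n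
        = ennreal (poisson_weight (base $ j * T) n * f ^ n)" for n
      using f pos T by (simp add: ennreal_power ennreal_mult' poisson_weight_nonneg)
    moreover have "(\<Sum>n. ennreal (poisson_weight (base $ j * T) n * f ^ n)) = ennreal (exp (base $ j * T * (f - 1)))"
      using f pos T by (intro suminf_ennreal_eq poisson_weight_pgf_sums) (auto simp: poisson_weight_nonneg)
    ultimately show ?thesis using f by simp
  qed
  then have "(\<integral>\<^sup>+\<omega>. iprod (\<lambda>p. if p \<in> offs [] T \<omega> then F (fst p) else 1) \<partial>M)
      = (\<Prod>j\<in>UNIV. ennreal (exp (base $ j * T * (enn2real (F j) - 1))))"
    by (subst nn_integral_iprod_immigrants[where F = F]) (use T F in simp_all)
  also have "\<dots> = ennreal (\<Prod>j\<in>UNIV. exp (base $ j * T * (enn2real (F j) - 1)))"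
    by (rule prod_ennreal) simp
  also have "(\<Prod>j\<in>UNIV. exp (base $ j * T * (enn2real (F j) - 1)))
      = exp (\<Sum>j\<in>UNIV. base $ j * T * (enn2real (F j) - 1))"
    by (rule exp_sum[symmetric]) simp
  also have "(\<Sum>j\<in>UNIV. base $ j * T * (enn2real (F j) - 1))
      = T * (\<Sum>j\<in>UNIV. base $ j * (enn2real (F j) - 1))"
    by (simp add: sum_distrib_left mult_ac)
  finally show ?thesis .
qed

text \<open>A window of length \<open>T\<close> is used since the intensities of a Poisson process are only integrated over
bounded sets.\<close>

lemma integral_decay_window: "0 \<le> (LBINT t:{0<..T}. g m j t)" "(LBINT t:{0<..T}. g m j t) \<le> decay_mass g m j"
proof -
  have i: "set_integrable lborel {0<..T} (g m j)"
    by (rule set_integrable_subset[OF decay_integrable]) auto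
  show "0 \<le> (LBINT t:{0<..T}. g m j t)"
    unfolding set_lebesgue_integral_def using decay_nonneg
    by (intro integral_nonneg_AE) (auto simp: indicator_def)
  show "(LBINT t:{0<..T}. g m j t) \<le> decay_mass g m j"
    unfolding decay_mass_def set_lebesgue_integral_def
    using i[unfolded set_integrable_def] decay_integrable[unfolded set_integrable_def] decay_nonneg
    by (intro integral_mono) (auto simp: indicator_def)
qed

text \<open>Only one component is observed: the windows of all other components are empty, which the definition of
a conditional Poisson process permits. The law of the single count is then a mixture of Poisson laws
with total mass \<open>1\<close>, and its mean is computed from the weights.\<close>

lemma expected_offspring_window:
  assumes v: "v \<noteq> []" and int: "integrable (mark_law (comp_of v)) (\<lambda>b. b $ m)"
  shows "(AE \<omega> in M. finite {k. (m, k) \<in> offs v T \<omega>})"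
    "(\<integral>\<^sup>+\<omega>. (\<Sum>k. indicator {\<omega> \<in> space M. (m, k) \<in> offs v T \<omega>} \<omega>) \<partial>M)
      \<le> ennreal (branching_matrix g mark_law $ m $ comp_of v)"
proof -
  let ?j = "comp_of v"
  define G where "G = (LBINT t:{0<..T}. g m ?j t)"
  have G: "0 \<le> G" "G \<le> decay_mass g m ?j" unfolding G_def by (rule integral_decay_window)+
  define S where "S \<omega> = {k. (m, k) \<in> offs v T \<omega>}" for \<omega>
  have [measurable]: "{\<omega> \<in> space M. k \<in> S \<omega>} \<in> events" for k
    using offs_info[of v UNIV "(m, k)"] sets_info_subset by (auto simp: S_def)
  define E where "E n = {\<omega> \<in> space M. finite (S \<omega>) \<and> card (S \<omega>) = n}" for n
  have E_meas [measurable]: "E n \<in> events" for n unfolding E_def by measurable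
  interpret D: prob_space "mark_law ?j"
    using mark_distr[OF v] mark_measurable[OF v] by (metis prob_space_distr)
  have pwm [measurable]: "(\<lambda>b :: real ^ 'd. poisson_weight (b $ m * G) n) \<in> borel_measurable borel" for n
    unfolding poisson_weight_def by measurable
  have pos: "AE b in mark_law ?j. 0 \<le> b $ m * G"
    using mark_nonneg[of ?j] by (eventually_elim) (use G in auto)
  have prE: "prob (E n) = (\<integral>b. poisson_weight (b $ m * G) n \<partial>mark_law ?j)" for n
  proof -
    \<comment> \<open>An empty window holds no points, in agreement with \<open>poisson_weight 0 0 = 1\<close>.\<close>
    let ?A = "\<lambda>m'. if m' = m then {0<..T} else {}"
    let ?c = "\<lambda>m'. if m' = m then n else 0"
    have "E n = {\<omega> \<in> space M. \<forall>m'. finite (points_in (\<lambda>k. X v m' k \<omega>) (?A m'))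
            \<and> card (points_in (\<lambda>k. X v m' k \<omega>) (?A m')) = ?c m'}"
      by (auto simp: E_def S_def points_in_offs points_in_def[of _ "{}"])
    also have "prob \<dots> = (\<integral>b. (\<Prod>m'\<in>UNIV. poisson_weight (b $ m' * (LBINT t:?A m'. g m' ?j t)) (?c m')) \<partial>mark_law ?j)"
      by (rule prob_offspring_counts[OF v]) auto
    finally have "prob (E n) = (\<integral>b. (\<Prod>m'\<in>UNIV. poisson_weight (b $ m' * (LBINT t:?A m'. g m' ?j t)) (?c m')) \<partial>mark_law ?j)" .
    moreover have eq: "(\<Prod>m'\<in>UNIV. poisson_weight (b $ m' * (LBINT t:?A m'. g m' ?j t)) (?c m'))
        = poisson_weight (b $ m * G) n" for b :: "real ^ 'd"
    proof -
      have "(\<Prod>m'\<in>UNIV. poisson_weight (b $ m' * (LBINT t:?A m'. g m' ?j t)) (?c m'))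
          = (\<Prod>m'\<in>UNIV. if m' = m then poisson_weight (b $ m * G) n else 1)"
        by (intro prod.cong) (auto simp: G_def poisson_weight_def set_lebesgue_integral_def)
      then show ?thesis by simp
    qed
    ultimately show ?thesis by (simp only: eq)
  qed
  have emE: "emeasure M (E n) = (\<integral>\<^sup>+b. ennreal (poisson_weight (b $ m * G) n) \<partial>mark_law ?j)" for n
  proof -
    have "AE b in mark_law ?j. norm (poisson_weight (b $ m * G) n) \<le> 1"
      using pos by eventually_elim (auto simp: poisson_weight_nonneg poisson_weight_le_1)
    then have "integrable (mark_law ?j) (\<lambda>b. poisson_weight (b $ m * G) n)"
      by (intro D.integrable_const_bound) auto
    then show ?thesis
      unfolding emeasure_eq_measure prE
      by (subst nn_integral_eq_integral) (use pos poisson_weight_nonneg in \<open>auto elim!: eventually_mono\<close>)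
  qed
  have "emeasure M (\<Union>n. E n) = (\<Sum>n. emeasure M (E n))"
    by (rule suminf_emeasure[symmetric]) (auto simp: disjoint_family_on_def E_def)
  also have "\<dots> = (\<integral>\<^sup>+b. (\<Sum>n. ennreal (poisson_weight (b $ m * G) n)) \<partial>mark_law ?j)"
    unfolding emE by (rule nn_integral_suminf[symmetric]) simp
  also have "\<dots> = (\<integral>\<^sup>+b. 1 \<partial>mark_law ?j)"
    by (intro nn_integral_cong_AE eventually_mono[OF pos])
      (use suminf_ennreal_eq[OF poisson_weight_nonneg poisson_weight_sums] in simp)
  also have "\<dots> = 1" by (simp add: D.emeasure_space_1)
  finally have "prob (\<Union>n. E n) = 1" by (simp add: measure_def)
  then have fin: "AE \<omega> in M. finite (S \<omega>)"
    by (rule AE_mp[OF AE_prob_1]) (auto simp: E_def)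
  then show "AE \<omega> in M. finite {k. (m, k) \<in> offs v T \<omega>}" by (simp add: S_def)
  have "(\<integral>\<^sup>+\<omega>. (\<Sum>k. indicator {\<omega> \<in> space M. (m, k) \<in> offs v T \<omega>} \<omega>) \<partial>M)
      = (\<integral>\<^sup>+\<omega>. (\<Sum>n. of_nat n * indicator (E n) \<omega>) \<partial>M)"
  proof (rule nn_integral_cong_AE, rule AE_mp[OF fin], rule AE_I2, rule impI)
    fix \<omega> assume \<omega>: "\<omega> \<in> space M" and f: "finite (S \<omega>)"
    have "(\<Sum>k. indicator {\<omega> \<in> space M. (m, k) \<in> offs v T \<omega>} \<omega> :: ennreal)
        = (\<Sum>k\<in>S \<omega>. indicator {\<omega> \<in> space M. (m, k) \<in> offs v T \<omega>} \<omega>)"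
      by (rule suminf_finite[OF f]) (simp add: S_def)
    also have "\<dots> = (\<Sum>k\<in>S \<omega>. 1)"
      by (rule sum.cong) (use \<omega> in \<open>simp_all add: S_def\<close>)
    also have "\<dots> = (\<Sum>n\<in>{card (S \<omega>)}. of_nat n * indicator (E n) \<omega>)"
      using \<omega> f by (simp add: E_def indicator_def)
    also have "\<dots> = (\<Sum>n. of_nat n * indicator (E n) \<omega>)"
      by (rule suminf_finite[symmetric]) (auto simp: E_def)
    finally show "(\<Sum>k. indicator {\<omega> \<in> space M. (m, k) \<in> offs v T \<omega>} \<omega>)
        = (\<Sum>n. of_nat n * indicator (E n) \<omega> :: ennreal)" .
  qed
  also have "\<dots> = (\<Sum>n. of_nat n * emeasure M (E n))"
    by (subst nn_integral_suminf) (auto simp: nn_integral_cmult)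
  also have "\<dots> = (\<integral>\<^sup>+b. (\<Sum>n. of_nat n * ennreal (poisson_weight (b $ m * G) n)) \<partial>mark_law ?j)"
    unfolding emE by (subst nn_integral_suminf) (auto simp: nn_integral_cmult)
  also have "\<dots> = (\<integral>\<^sup>+b. ennreal (b $ m * G) \<partial>mark_law ?j)"
  proof (intro nn_integral_cong_AE eventually_mono[OF pos])
    fix b :: "real ^ 'd" assume "0 \<le> b $ m * G"
    then have "(\<Sum>n. ennreal (real n * poisson_weight (b $ m * G) n)) = ennreal (b $ m * G)"
      by (intro suminf_ennreal_eq poisson_weight_mean_sums) (auto simp: poisson_weight_nonneg)
    then show "(\<Sum>n. of_nat n * ennreal (poisson_weight (b $ m * G) n)) = ennreal (b $ m * G)"
      by (simp add: ennreal_mult' ennreal_of_nat_eq_real_of_nat)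
  qed
  also have "\<dots> = ennreal ((\<integral>b. b $ m \<partial>mark_law ?j) * G)"
    using int pos by (subst nn_integral_eq_integral) auto
  also have "\<dots> \<le> ennreal (branching_matrix g mark_law $ m $ ?j)"
    unfolding branching_matrix_def using G mark_nonneg[of ?j]
    by (auto intro!: ennreal_leI mult_left_mono integral_nonneg_AE elim: eventually_mono)
  finally show "(\<integral>\<^sup>+\<omega>. (\<Sum>k. indicator {\<omega> \<in> space M. (m, k) \<in> offs v T \<omega>} \<omega>) \<partial>M)
      \<le> ennreal (branching_matrix g mark_law $ m $ comp_of v)" .
qed

section \<open>Truncated family trees\<close>

text \<open>The cluster with root \<open>v\<close>, truncated at generation \<open>d\<close>, at delay \<open>K\<close> along each edge, and at \<open>K\<close> children
per event; an event with more children is treated as childless. Removing all children rather than some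
of them keeps the truncation independent of the labelling.\<close>

fun tree :: "nat \<Rightarrow> nat \<Rightarrow> 'd event \<Rightarrow> 'w \<Rightarrow> 'd event set" where
  "tree K 0 v \<omega> = {v}"
| "tree K (Suc d) v \<omega> = insert v
     (if finite (offs v K \<omega>) \<and> card (offs v K \<omega>) \<le> K then (\<Union>p\<in>offs v K \<omega>. tree K d (p # v) \<omega>) else {})"

definition tree_weight :: "('d \<Rightarrow> ennreal) \<Rightarrow> nat \<Rightarrow> nat \<Rightarrow> 'd event \<Rightarrow> 'w \<Rightarrow> ennreal" where
  "tree_weight z K d v \<omega> = (\<Prod>w\<in>tree K d v \<omega>. z (comp_of w))"

text \<open>The generating function of the truncated cluster, obtained by conditioning on the children of the
root. The last summand is the probability of more than \<open>K\<close> children.\<close>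

fun tree_pgf :: "('d \<Rightarrow> ennreal) \<Rightarrow> nat \<Rightarrow> nat \<Rightarrow> 'd \<Rightarrow> ennreal" where
  "tree_pgf z K 0 j = z j"
| "tree_pgf z K (Suc d) j = z j *
     ((\<Sum>c | sum c UNIV \<le> K. (\<Prod>m\<in>UNIV. tree_pgf z K d m ^ c m) * ennreal (off_law K j c))
      + (1 - (\<Sum>c | sum c UNIV \<le> K. ennreal (off_law K j c))))"

definition descendants :: "'d event \<Rightarrow> 'd source set" where
  "descendants v = {Family (u @ v) | u. True}"

lemma Family_descendants: "Family v \<in> descendants v"
  unfolding descendants_def by (metis (mono_tags, lifting) append_Nil mem_Collect_eq)

lemma descendants_Cons_subset: "descendants (p # v) \<subseteq> descendants v"
proof
  fix s assume "s \<in> descendants (p # v)"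
  then obtain u where "s = Family (u @ p # v)" by (auto simp: descendants_def)
  then have "s = Family ((u @ [p]) @ v)" by simp
  then show "s \<in> descendants v" unfolding descendants_def by blast
qed

lemma append_Cons_same_tail:
  assumes "u @ p # v = u' @ q # v"
  shows "p = q"
proof -
  have "(u @ [p]) @ v = (u' @ [q]) @ v" using assms by simp
  then show ?thesis by (simp only: append_same_eq append1_eq_conv)
qed

lemma append_Cons_neq: "v \<noteq> u @ p # v"
proof
  assume "v = u @ p # v"
  then have "length v = length (u @ p # v)" by (rule arg_cong)
  then show False by simp
qed

text \<open>Subtrees with different roots in the same generation use disjoint sets of sources.\<close>

lemma descendants_disjoint:
  "p \<noteq> q \<Longrightarrow> descendants (p # v) \<inter> descendants (q # v) = {}"
  "{Family v} \<inter> descendants (p # v) = {}"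
proof -
  show "descendants (p # v) \<inter> descendants (q # v) = {}" if "p \<noteq> q"
  proof (rule ccontr)
    assume "descendants (p # v) \<inter> descendants (q # v) \<noteq> {}"
    then obtain u u' where "u @ p # v = u' @ q # v" unfolding descendants_def by auto
    then show False using that by (auto dest: append_Cons_same_tail)
  qed
  have "Family v \<noteq> Family (u @ p # v)" for u using append_Cons_neq by simp
  then show "{Family v} \<inter> descendants (p # v) = {}"
    unfolding descendants_def by blast
qed

lemma finite_tree: "finite (tree K d v \<omega>)"
  by (induction d arbitrary: v) auto

lemma tree_suffix: "w \<in> tree K d v \<omega> \<Longrightarrow> \<exists>u. w = u @ v"
proof (induction d arbitrary: v)
  case (Suc d)
  then consider "w = v" | p where "w \<in> tree K d (p # v) \<omega>" by (auto split: if_splits)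
  then show ?case
  proof cases
    case 2
    from Suc.IH[OF 2] obtain u where "w = u @ p # v" by blast
    then have "w = (u @ [p]) @ v" by simp
    then show ?thesis by blast
  qed simp
qed simp

lemma tree_disjoint:
  "p \<noteq> q \<Longrightarrow> tree K d (p # v) \<omega> \<inter> tree K d (q # v) \<omega> = {}" "v \<notin> tree K d (p # v) \<omega>"
proof -
  show "tree K d (p # v) \<omega> \<inter> tree K d (q # v) \<omega> = {}" if "p \<noteq> q"
  proof (rule ccontr)
    assume "tree K d (p # v) \<omega> \<inter> tree K d (q # v) \<omega> \<noteq> {}"
    then obtain w where "w \<in> tree K d (p # v) \<omega>" "w \<in> tree K d (q # v) \<omega>" by blast
    then obtain u u' where "w = u @ p # v" "w = u' @ q # v" by (meson tree_suffix)
    then show False using that append_Cons_same_tail[of u p v u' q] by simp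
  qed
  show "v \<notin> tree K d (p # v) \<omega>"
  proof
    assume "v \<in> tree K d (p # v) \<omega>"
    then obtain u where "v = u @ p # v" by (meson tree_suffix)
    then show False by (rule notE[OF append_Cons_neq])
  qed
qed

lemma prod_tree_Suc:
  fixes f :: "'d event \<Rightarrow> 'c::comm_monoid_mult"
  shows "(\<Prod>w\<in>tree K (Suc d) v \<omega>. f w) = f v *
    (if finite (offs v K \<omega>) \<and> card (offs v K \<omega>) \<le> K
     then (\<Prod>p\<in>offs v K \<omega>. \<Prod>w\<in>tree K d (p # v) \<omega>. f w) else 1)"
proof (cases "finite (offs v K \<omega>) \<and> card (offs v K \<omega>) \<le> K")
  case True
  have "(\<Prod>w\<in>(\<Union>p\<in>offs v K \<omega>. tree K d (p # v) \<omega>). f w)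
      = (\<Prod>p\<in>offs v K \<omega>. \<Prod>w\<in>tree K d (p # v) \<omega>. f w)"
    by (rule prod.UNION_disjoint) (use True tree_disjoint(1) finite_tree in blast)+
  moreover have "v \<notin> (\<Union>p\<in>offs v K \<omega>. tree K d (p # v) \<omega>)" using tree_disjoint(2) by blast
  ultimately show ?thesis using True by (simp add: finite_tree)
qed auto

lemma tree_weight_ge_1:
  assumes "\<And>j. 1 \<le> z j"
  shows "1 \<le> tree_weight z K d v \<omega>"
  unfolding tree_weight_def using assms by (intro prod_ge_1) auto

lemma tree_weight_Suc:
  assumes "\<And>j. 1 \<le> z j"
  shows "tree_weight z K (Suc d) v \<omega> = z (comp_of v) *
    (if finite (offs v K \<omega>) \<and> card (offs v K \<omega>) \<le> K
     then iprod (\<lambda>p. if p \<in> offs v K \<omega> then tree_weight z K d (p # v) \<omega> else 1) else 1)"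
proof (cases "finite (offs v K \<omega>) \<and> card (offs v K \<omega>) \<le> K")
  case True
  have "iprod (\<lambda>p. if p \<in> offs v K \<omega> then tree_weight z K d (p # v) \<omega> else 1)
      = (\<Prod>p\<in>offs v K \<omega>. tree_weight z K d (p # v) \<omega>)"
    by (rule iprod_finite_support[OF _ tree_weight_ge_1[OF assms]]) (use True in simp)
  then show ?thesis using True unfolding tree_weight_def prod_tree_Suc by simp
next
  case False
  then show ?thesis unfolding tree_weight_def prod_tree_Suc by (simp only: if_False)
qed

lemma card_offs:
  assumes "finite (offs v T \<omega>)"
  shows "card (offs v T \<omega>) = (\<Sum>m\<in>UNIV. off_count v T \<omega> m)"
proof -
  have "offs v T \<omega> = Sigma UNIV (\<lambda>m. {k. (m, k) \<in> offs v T \<omega>})" by auto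
  then have "card (offs v T \<omega>) = card (Sigma UNIV (\<lambda>m. {k. (m, k) \<in> offs v T \<omega>}))" by (rule arg_cong)
  also have "\<dots> = (\<Sum>m\<in>UNIV. card {k. (m, k) \<in> offs v T \<omega>})"
    using assms finite_offs_iff by (intro card_SigmaI) auto
  finally show ?thesis by (simp add: off_count_def)
qed

lemma pred_few_offs:
  assumes "Family v \<in> J"
  shows "Measurable.pred (info J) (\<lambda>\<omega>. finite (offs v T \<omega>) \<and> card (offs v T \<omega>) \<le> K)"
proof -
  have [measurable]: "(\<lambda>\<omega>. off_count v T \<omega> m) \<in> measurable (info J) (count_space UNIV)" for m
    by (rule measurable_compose[OF off_count_info[OF assms]]) simp
  note [measurable] = pred_finite_offs[OF assms, of T]
  have "Measurable.pred (info J) (\<lambda>\<omega>. finite (offs v T \<omega>) \<and> (\<Sum>m\<in>UNIV. off_count v T \<omega> m) \<le> K)"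
    by measurable
  moreover have "finite (offs v T \<omega>) \<and> (\<Sum>m\<in>UNIV. off_count v T \<omega> m) \<le> K
      \<longleftrightarrow> finite (offs v T \<omega>) \<and> card (offs v T \<omega>) \<le> K" for \<omega>
    using card_offs[of v T \<omega>] by auto
  ultimately show ?thesis by simp
qed

lemma pred_offs:
  assumes "Family v \<in> J"
  shows "Measurable.pred (info J) (\<lambda>\<omega>. p \<in> offs v T \<omega>)"
  using offs_info[OF assms, of p T] by (simp add: pred_def)

lemma tree_weight_info:
  assumes "\<And>j. 1 \<le> z j"
  shows "tree_weight z K d v \<in> borel_measurable (info (descendants v))"
proof (induction d arbitrary: v)
  case 0
  then show ?case by (simp add: tree_weight_def)
next
  case (Suc d)
  note [measurable] = pred_few_offs[OF Family_descendants] pred_offs[OF Family_descendants]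
  have [measurable]: "tree_weight z K d (p # v) \<in> borel_measurable (info (descendants v))" for p
    by (rule info_measurable_mono[OF Suc descendants_Cons_subset])
  have [measurable]: "(\<lambda>\<omega>. iprod (\<lambda>p. if p \<in> offs v K \<omega> then tree_weight z K d (p # v) \<omega> else 1))
      \<in> borel_measurable (info (descendants v))"
    by (rule borel_measurable_iprod) measurable
  show ?case unfolding tree_weight_Suc[OF assms] by measurable
qed

lemma finite_bounded_counts: "finite {c :: 'd \<Rightarrow> nat. sum c UNIV \<le> K}"
proof (rule finite_subset)
  show "{c :: 'd \<Rightarrow> nat. sum c UNIV \<le> K} \<subseteq> PiE UNIV (\<lambda>_. {..K})"
    by (auto simp: PiE_def) (metis (no_types) finite le_trans member_le_sum iso_tuple_UNIV_I zero_le)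
qed (auto intro: finite_PiE)

lemma nn_integral_off_count:
  fixes h :: "('d \<Rightarrow> nat) \<Rightarrow> ennreal"
  assumes v: "v \<noteq> []"
  shows "(\<integral>\<^sup>+\<omega>. (if finite (offs v T \<omega>) \<and> card (offs v T \<omega>) \<le> K then h (off_count v T \<omega>) else 0) \<partial>M)
    = (\<Sum>c | sum c UNIV \<le> K. h c * ennreal (off_law T (comp_of v) c))"
proof -
  let ?E = "\<lambda>c. {\<omega> \<in> space M. finite (offs v T \<omega>) \<and> off_count v T \<omega> = c}"
  have [measurable]: "off_count v T \<in> measurable M (count_space UNIV)"
    "Measurable.pred M (\<lambda>\<omega>. finite (offs v T \<omega>))"
    using off_count_info[of v UNIV] pred_finite_offs[of v UNIV] info_measurable by blast+
  have "(\<integral>\<^sup>+\<omega>. (if finite (offs v T \<omega>) \<and> card (offs v T \<omega>) \<le> K then h (off_count v T \<omega>) else 0) \<partial>M)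
    = (\<integral>\<^sup>+\<omega>. (\<Sum>c | sum c UNIV \<le> K. h c * indicator (?E c) \<omega>) \<partial>M)"
  proof (rule nn_integral_cong)
    fix \<omega> assume \<omega>: "\<omega> \<in> space M"
    have "(\<Sum>c | sum c UNIV \<le> K. h c * indicator (?E c) \<omega>)
        = (\<Sum>c | sum c UNIV \<le> K. if c = off_count v T \<omega> then h c * indicator {\<omega>. finite (offs v T \<omega>)} \<omega> else 0)"
      using \<omega> by (intro sum.cong) (auto simp: indicator_def)
    also have "\<dots> = (if finite (offs v T \<omega>) \<and> card (offs v T \<omega>) \<le> K then h (off_count v T \<omega>) else 0)"
      using card_offs[of v T \<omega>] by (cases "finite (offs v T \<omega>)") (simp_all add: sum.delta finite_bounded_counts)
    finally show "(if finite (offs v T \<omega>) \<and> card (offs v T \<omega>) \<le> K then h (off_count v T \<omega>) else 0)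
        = (\<Sum>c | sum c UNIV \<le> K. h c * indicator (?E c) \<omega>)" ..
  qed
  also have "\<dots> = (\<Sum>c | sum c UNIV \<le> K. h c * emeasure M (?E c))"
    by (subst nn_integral_sum) (auto simp: nn_integral_cmult)
  finally show ?thesis
    by (simp add: emeasure_eq_measure prob_off_count[OF v])
qed

text \<open>The expectation depends on the root only through its component. Given the children of the root, the
weights of their subtrees are independent, with expectations that depend on the component only by
induction; so only the numbers of children in the components matter, not their labels.\<close>

lemma nn_integral_tree_weight:
  assumes z: "\<And>j. 1 \<le> z j" and v: "v \<noteq> []"
  shows "(\<integral>\<^sup>+\<omega>. tree_weight z K d v \<omega> \<partial>M) = tree_pgf z K d (comp_of v)"
  using v
proof (induction d arbitrary: v)
  case 0
  then show ?case by (simp add: tree_weight_def emeasure_space_1)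
next
  case (Suc d)
  let ?S = "\<lambda>\<omega>. finite (offs v K \<omega>) \<and> card (offs v K \<omega>) \<le> K"
  define \<psi> :: "'w \<Rightarrow> ennreal" where "\<psi> \<omega> = (if ?S \<omega> then 1 else 0)" for \<omega>
  define \<zeta> :: "'w \<Rightarrow> ennreal" where "\<zeta> \<omega> = (if ?S \<omega> then 0 else 1)" for \<omega>
  let ?I = "\<lambda>\<omega>. iprod (\<lambda>p. if p \<in> offs v K \<omega> then tree_weight z K d (p # v) \<omega> else 1)"
  have [measurable]: "Measurable.pred (info {Family v}) ?S" by (rule pred_few_offs) simp
  have \<psi>i: "\<psi> \<in> borel_measurable (info {Family v})"
    unfolding \<psi>_def by measurable
  have \<zeta>i: "\<zeta> \<in> borel_measurable (info {Family v})"
    unfolding \<zeta>_def by measurable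
  have Im: "?I \<in> borel_measurable M"
  proof (rule borel_measurable_iprod)
    fix p
    have [measurable]: "Measurable.pred M (\<lambda>\<omega>. p \<in> offs v K \<omega>)"
      by (rule info_measurable[OF pred_offs[of v UNIV]]) simp
    have [measurable]: "tree_weight z K d (p # v) \<in> borel_measurable M"
      by (rule info_measurable[OF tree_weight_info[OF z]])
    show "(\<lambda>\<omega>. if p \<in> offs v K \<omega> then tree_weight z K d (p # v) \<omega> else 1) \<in> borel_measurable M"
      by measurable
  qed
  note [measurable] = Im info_measurable[OF \<psi>i] info_measurable[OF \<zeta>i]
  have "(\<integral>\<^sup>+\<omega>. tree_weight z K (Suc d) v \<omega> \<partial>M) = (\<integral>\<^sup>+\<omega>. z (comp_of v) * (\<psi> \<omega> * ?I \<omega> + \<zeta> \<omega>) \<partial>M)"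
    unfolding tree_weight_Suc[OF z] by (intro nn_integral_cong) (simp add: \<psi>_def \<zeta>_def)
  also have "\<dots> = z (comp_of v) * ((\<integral>\<^sup>+\<omega>. \<psi> \<omega> * ?I \<omega> \<partial>M) + (\<integral>\<^sup>+\<omega>. \<zeta> \<omega> \<partial>M))"
    by (simp add: nn_integral_cmult nn_integral_add)
  also have "(\<integral>\<^sup>+\<omega>. \<psi> \<omega> * ?I \<omega> \<partial>M)
      = (\<integral>\<^sup>+\<omega>. \<psi> \<omega> * iprod (\<lambda>p. if p \<in> offs v K \<omega> then (\<integral>\<^sup>+\<omega>'. tree_weight z K d (p # v) \<omega>' \<partial>M) else 1) \<partial>M)"
    by (rule nn_integral_thinned_iprod[OF \<psi>i offs_info tree_weight_info[OF z] descendants_disjoint(2,1)])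
      (use tree_weight_ge_1[OF z] in auto)
  also have "\<dots> = (\<integral>\<^sup>+\<omega>. (if ?S \<omega> then (\<Prod>m\<in>UNIV. tree_pgf z K d m ^ off_count v K \<omega> m) else 0) \<partial>M)"
  proof (rule nn_integral_cong)
    fix \<omega>
    have e: "(\<integral>\<^sup>+\<omega>'. tree_weight z K d (p # v) \<omega>' \<partial>M) = tree_pgf z K d (fst p)" for p
      using Suc.IH[of "p # v"] by (simp add: comp_of_def)
    have ge: "1 \<le> tree_pgf z K d m" for m
    proof -
      have "(\<integral>\<^sup>+\<omega>. 1 \<partial>M) \<le> (\<integral>\<^sup>+\<omega>. tree_weight z K d ((m, 0) # v) \<omega> \<partial>M)"
        by (intro nn_integral_mono tree_weight_ge_1 z)
      then show ?thesis using e[of "(m, 0)"] by (simp add: emeasure_space_1)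
    qed
    show "\<psi> \<omega> * iprod (\<lambda>p. if p \<in> offs v K \<omega> then (\<integral>\<^sup>+\<omega>'. tree_weight z K d (p # v) \<omega>' \<partial>M) else 1)
        = (if ?S \<omega> then (\<Prod>m\<in>UNIV. tree_pgf z K d m ^ off_count v K \<omega> m) else 0)"
    proof (cases "?S \<omega>")
      case True
      have "iprod (\<lambda>p. if p \<in> offs v K \<omega> then tree_pgf z K d (fst p) else 1)
          = (\<Prod>p\<in>offs v K \<omega>. tree_pgf z K d (fst p))"
        using True ge by (intro iprod_finite_support) auto
      also have "\<dots> = (\<Prod>m\<in>UNIV. tree_pgf z K d m ^ off_count v K \<omega> m)"
        unfolding off_count_def by (rule prod_fst_power) (use True in simp)
      finally show ?thesis using True by (simp add: \<psi>_def e cong: if_cong)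
    next
      case False
      then show ?thesis by (auto simp: \<psi>_def)
    qed
  qed
  also have "\<dots> = (\<Sum>c | sum c UNIV \<le> K. (\<Prod>m\<in>UNIV. tree_pgf z K d m ^ c m) * ennreal (off_law K (comp_of v) c))"
    by (rule nn_integral_off_count[OF Suc.prems])
  also have "(\<integral>\<^sup>+\<omega>. \<zeta> \<omega> \<partial>M) = (\<integral>\<^sup>+\<omega>. 1 - \<psi> \<omega> \<partial>M)"
    by (intro nn_integral_cong) (auto simp: \<psi>_def \<zeta>_def)
  also have "\<dots> = 1 - (\<integral>\<^sup>+\<omega>. \<psi> \<omega> \<partial>M)"
  proof -
    have le1: "\<psi> \<omega> \<le> 1" for \<omega> by (simp add: \<psi>_def)
    have le: "(\<integral>\<^sup>+\<omega>. \<psi> \<omega> \<partial>M) \<le> (\<integral>\<^sup>+\<omega>. 1 \<partial>M)"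
      by (intro nn_integral_mono) (auto simp: \<psi>_def)
    then have "(\<integral>\<^sup>+\<omega>. \<psi> \<omega> \<partial>M) \<noteq> \<infinity>" by (auto simp: emeasure_space_1 top_unique)
    then have "(\<integral>\<^sup>+\<omega>. 1 - \<psi> \<omega> \<partial>M) = (\<integral>\<^sup>+\<omega>. 1 \<partial>M) - (\<integral>\<^sup>+\<omega>. \<psi> \<omega> \<partial>M)"
      using le1 by (intro nn_integral_diff) simp_all
    then show ?thesis by (simp add: emeasure_space_1)
  qed
  also have "(\<integral>\<^sup>+\<omega>. \<psi> \<omega> \<partial>M) = (\<Sum>c | sum c UNIV \<le> K. ennreal (off_law K (comp_of v) c))"
    unfolding \<psi>_def using nn_integral_off_count[OF Suc.prems, of K K "\<lambda>_. 1"] by simp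
  finally show ?case by simp
qed

section \<open>Finiteness and law of the clusters\<close>

text \<open>The untruncated cluster with root \<open>v\<close>. The event \<open>v\<close> itself belongs to it whether or not it arrives.\<close>

definition cluster :: "'d event \<Rightarrow> 'w \<Rightarrow> 'd event set" where
  "cluster v \<omega> = {u @ v | u. delay X \<omega> v u < \<infinity>}"

text \<open>Excludes a null set on which delays of points may be negative.\<close>

definition proper :: "'w \<Rightarrow> bool" where
  "proper \<omega> \<longleftrightarrow> (\<forall>v m k. 0 < X v m k \<omega>)"

lemma AE_proper: "AE \<omega> in M. proper \<omega>"
proof -
  have "AE \<omega> in M. 0 < X v m k \<omega>" for v m k
  proof (cases "v = []")
    case True
    then show ?thesis using immigrants by (simp add: poisson_given_def)
  next
    case False
    then show ?thesis using offspring[OF False] by (simp add: poisson_given_def)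
  qed
  then show ?thesis unfolding proper_def by (simp add: AE_all_countable)
qed

lemma proper_delay_nonneg: "proper \<omega> \<Longrightarrow> 0 \<le> delay X \<omega> v u"
proof (induction u)
  case (Cons p u)
  obtain m k where p: "p = (m, k)" by fastforce
  have "0 \<le> X (u @ v) m k \<omega>" using Cons.prems by (simp add: proper_def less_imp_le)
  then show ?case using Cons by (simp add: p)
qed simp

lemma proper_delay_Cons_finite:
  assumes "proper \<omega>"
  shows "delay X \<omega> v (p # u) < \<infinity> \<longleftrightarrow> delay X \<omega> v u < \<infinity> \<and> X (u @ v) (fst p) (snd p) \<omega> < \<infinity>"
proof (cases p)
  case (Pair m k)
  have "0 < X (u @ v) m k \<omega>" using assms by (simp add: proper_def)
  then show ?thesis using Pair proper_delay_nonneg[OF assms, of v u]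
    by (cases "delay X \<omega> v u"; cases "X (u @ v) m k \<omega>") auto
qed

lemma proper_offs:
  assumes "proper \<omega>"
  shows "p \<in> offs v T \<omega> \<longleftrightarrow> X v (fst p) (snd p) \<omega> \<le> ereal T"
proof -
  have "0 < X v (fst p) (snd p) \<omega>" using assms by (simp add: proper_def)
  then show ?thesis unfolding offs_def case_prod_beta
    by (cases "X v (fst p) (snd p) \<omega>") auto
qed

lemma tree_delay:
  assumes "u @ v \<in> tree K d v \<omega>"
  shows "delay X \<omega> v u \<le> ereal (real d * real K)"
  using assms
proof (induction d arbitrary: v u)
  case (Suc d)
  show ?case
  proof (cases "u = []")
    case False
    with Suc.prems obtain p where p: "p \<in> offs v K \<omega>" "u @ v \<in> tree K d (p # v) \<omega>"
      by (auto split: if_splits)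
    then obtain u' where u': "u @ v = u' @ p # v" using tree_suffix by blast
    then have u: "u = u' @ [p]" by (metis append_Cons append_Nil append_assoc append_same_eq)
    obtain x where x: "X v (fst p) (snd p) \<omega> = ereal x" "x \<le> K" using p(1) by (auto simp: offs_def)
    have "delay X \<omega> (p # v) u' \<le> ereal (real d * real K)"
      using Suc.IH[of u' "p # v"] p(2) u' by simp
    then have "ereal x + delay X \<omega> (p # v) u' \<le> ereal (real K) + ereal (real d * real K)"
      using x by (intro add_mono) auto
    moreover have "delay X \<omega> v u = ereal x + delay X \<omega> (p # v) u'"
      unfolding u delay_append using x by (cases p) simp
    ultimately show ?thesis by (simp add: algebra_simps)
  qed simp
qed simp

lemma tree_subset_cluster: "tree K d v \<omega> \<subseteq> cluster v \<omega>"
proof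
  fix w assume w: "w \<in> tree K d v \<omega>"
  then obtain u where u: "w = u @ v" using tree_suffix by blast
  then have "delay X \<omega> v u \<le> ereal (real d * real K)" using w tree_delay by blast
  then have "delay X \<omega> v u < \<infinity>" by (auto simp: less_eq_ereal_def)
  then show "w \<in> cluster v \<omega>" unfolding cluster_def u by blast
qed

text \<open>A finite cluster has bounded depth, bounded delays and bounded numbers of children, so a fine
truncation does not change it.\<close>

lemma tree_eventually_cluster:
  assumes proper: "proper \<omega>" and fin: "finite (cluster v \<omega>)"
  shows "\<forall>\<^sub>F n in sequentially. tree n n v \<omega> = cluster v \<omega>"
proof -
  \<comment> \<open>The edges of the cluster; the index \<open>N\<close> bounds its size, depth and delays.\<close>
  define R where "R = {(w, p). w \<in> cluster v \<omega> \<and> X w (fst p) (snd p) \<omega> < \<infinity>}"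
  have RC: "p # w \<in> cluster v \<omega>" if "(w, p) \<in> R" for w p
  proof -
    have "w \<in> cluster v \<omega>" using that by (simp add: R_def)
    then obtain u where "w = u @ v" "delay X \<omega> v u < \<infinity>" unfolding cluster_def by blast
    then have "p # w = (p # u) @ v \<and> delay X \<omega> v (p # u) < \<infinity>"
      using that proper_delay_Cons_finite[OF proper, of v p u] by (auto simp: R_def)
    then show ?thesis unfolding cluster_def by blast
  qed
  have finR: "finite R"
  proof (rule inj_on_finite[OF _ _ fin])
    show "inj_on (\<lambda>(w, p). p # w) R" by (auto simp: inj_on_def)
    show "(\<lambda>(w, p). p # w) ` R \<subseteq> cluster v \<omega>" using RC by auto
  qed
  define N where "N = Max (insert (card (cluster v \<omega>)) (length ` cluster v \<omega>
      \<union> (\<lambda>(w, p). nat \<lceil>real_of_ereal (X w (fst p) (snd p) \<omega>)\<rceil>) ` R))"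
  have N1: "card (cluster v \<omega>) \<le> N" unfolding N_def using fin finR by (intro Max_ge) auto
  have N2: "length w \<le> N" if "w \<in> cluster v \<omega>" for w
    unfolding N_def using fin finR that by (intro Max_ge) auto
  have N3: "nat \<lceil>real_of_ereal (X w (fst p) (snd p) \<omega>)\<rceil> \<le> N" if "(w, p) \<in> R" for w p
    unfolding N_def using fin finR that by (intro Max_ge) force+
  have "tree n n v \<omega> = cluster v \<omega>" if n: "N \<le> n" for n
  proof
    have offR: "p \<in> offs w n \<omega> \<longleftrightarrow> (w, p) \<in> R" if w: "w \<in> cluster v \<omega>" for w p
    proof
      assume "p \<in> offs w n \<omega>"
      then have "X w (fst p) (snd p) \<omega> \<le> ereal n" by (simp add: proper_offs[OF proper])
      then show "(w, p) \<in> R" using w by (auto simp: R_def less_eq_ereal_def)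
    next
      assume R: "(w, p) \<in> R"
      have "0 < X w (fst p) (snd p) \<omega>" using proper by (simp add: proper_def)
      then obtain x where x: "X w (fst p) (snd p) \<omega> = ereal x"
        using R by (cases "X w (fst p) (snd p) \<omega>") (auto simp: R_def)
      have "x \<le> real n" using N3[OF R] n x by (simp add: nat_le_iff) linarith
      then show "p \<in> offs w n \<omega>" using x by (simp add: proper_offs[OF proper])
    qed
    have small: "finite (offs w n \<omega>) \<and> card (offs w n \<omega>) \<le> n" if w: "w \<in> cluster v \<omega>" for w
    proof -
      have inj: "inj_on (\<lambda>p. p # w) (offs w n \<omega>)" by (auto simp: inj_on_def)
      have sub: "(\<lambda>p. p # w) ` offs w n \<omega> \<subseteq> cluster v \<omega>" using offR[OF w] RC by auto
      show ?thesis using inj_on_finite[OF inj sub fin] card_inj_on_le[OF inj sub fin] N1 n by simp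
    qed
    have *: "u @ w \<in> tree n d w \<omega>" if "length u \<le> d" "w \<in> cluster v \<omega>" "delay X \<omega> w u < \<infinity>" for u w d
      using that
    proof (induction d arbitrary: u w)
      case (Suc d)
      show ?case
      proof (cases u rule: rev_cases)
        case (snoc u' p)
        have del: "delay X \<omega> w u = X w (fst p) (snd p) \<omega> + delay X \<omega> (p # w) u'"
          unfolding snoc delay_append by (cases p) simp
        have "0 < X w (fst p) (snd p) \<omega>" using proper by (simp add: proper_def)
        then have f: "X w (fst p) (snd p) \<omega> < \<infinity>" "delay X \<omega> (p # w) u' < \<infinity>"
          using Suc.prems(3) proper_delay_nonneg[OF proper, of "p # w" u'] unfolding del
          by (cases "X w (fst p) (snd p) \<omega>"; cases "delay X \<omega> (p # w) u'"; auto)+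
        have R: "(w, p) \<in> R" using f Suc.prems by (simp add: R_def)
        have "u' @ p # w \<in> tree n d (p # w) \<omega>"
          by (rule Suc.IH) (use Suc.prems snoc f RC[OF R] in auto)
        then have "u @ w \<in> (\<Union>p\<in>offs w n \<omega>. tree n d (p # w) \<omega>)"
          by (intro UN_I[of p]) (simp_all add: offR[OF Suc.prems(2)] R snoc)
        then show ?thesis using small[OF Suc.prems(2)] by simp
      qed simp
    qed simp
    show "cluster v \<omega> \<subseteq> tree n n v \<omega>"
    proof
      fix w assume w: "w \<in> cluster v \<omega>"
      then obtain u where u: "w = u @ v" "delay X \<omega> v u < \<infinity>" by (auto simp: cluster_def)
      have "v \<in> cluster v \<omega>" unfolding cluster_def by (auto intro!: exI[of _ "[]"])
      moreover have "length u \<le> n" using N2[OF w] n u by simp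
      ultimately show "w \<in> tree n n v \<omega>" using * u by blast
    qed
  qed (rule tree_subset_cluster)
  then show ?thesis unfolding eventually_sequentially by blast
qed

text \<open>An upper bound for the number of descendants of \<open>v\<close> up to generation \<open>n\<close>, in a form in which the
expectation can be taken term by term.\<close>

fun gen_bound :: "nat \<Rightarrow> 'd event \<Rightarrow> 'w \<Rightarrow> ennreal" where
  "gen_bound 0 v \<omega> = 1"
| "gen_bound (Suc n) v \<omega> = 1 + (\<Sum>m\<in>UNIV. \<Sum>k. (if X v m k \<omega> < \<infinity> then 1 else 0) * gen_bound n ((m, k) # v) \<omega>)"

lemma gen_bound_info: "gen_bound n v \<in> borel_measurable (info (descendants v))"
proof (induction n arbitrary: v)
  case 0
  then show ?case by simp
next
  case (Suc n)
  note [measurable] = X_measurable_info[OF Family_descendants[of v]]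
  have [measurable]: "gen_bound n (p # v) \<in> borel_measurable (info (descendants v))" for p
    by (rule info_measurable_mono[OF Suc descendants_Cons_subset])
  show ?case by simp
qed

lemma incseq_gen_bound: "gen_bound n v \<omega> \<le> gen_bound (Suc n) v \<omega>"
proof (induction n arbitrary: v)
  case (Suc n)
  have "gen_bound (Suc n) v \<omega>
      \<le> 1 + (\<Sum>m\<in>UNIV. \<Sum>k. (if X v m k \<omega> < \<infinity> then 1 else 0) * gen_bound (Suc n) ((m, k) # v) \<omega>)"
    unfolding gen_bound.simps(2)[of n v]
    by (intro add_left_mono sum_mono suminf_le mult_left_mono Suc) auto
  also have "\<dots> = gen_bound (Suc (Suc n)) v \<omega>" by (rule gen_bound.simps(2)[symmetric])
  finally show ?case .
qed simp

text \<open>The windows \<open>(0, n]\<close> exhaust the positive half-line.\<close>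

lemma expected_offspring:
  assumes v: "v \<noteq> []" and int: "\<And>j m. integrable (mark_law j) (\<lambda>b. b $ m)"
  shows "(\<Sum>k. \<integral>\<^sup>+\<omega>. (if X v m k \<omega> < \<infinity> then 1 else 0) \<partial>M) \<le> ennreal (branching_matrix g mark_law $ m $ comp_of v)"
proof -
  let ?f = "\<lambda>n k \<omega>. indicator {\<omega> \<in> space M. (m, k) \<in> offs v (real n) \<omega>} \<omega> :: ennreal"
  have [measurable]: "{\<omega> \<in> space M. p \<in> offs v T \<omega>} \<in> events" for p T
    using offs_info[of v UNIV p T] sets_info_subset by auto
  have inc: "incseq (\<lambda>n. ?f n k \<omega>)" for k \<omega>
    by (intro incseq_SucI) (auto simp: indicator_def offs_def)
  have "(\<Sum>k. \<integral>\<^sup>+\<omega>. (if X v m k \<omega> < \<infinity> then 1 else 0) \<partial>M) = (\<integral>\<^sup>+\<omega>. (\<Sum>k. if X v m k \<omega> < \<infinity> then 1 else 0) \<partial>M)"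
    by (rule nn_integral_suminf[symmetric]) measurable
  also have "\<dots> = (\<integral>\<^sup>+\<omega>. (\<Sum>k. SUP n. ?f n k \<omega>) \<partial>M)"
  proof (rule nn_integral_cong_AE, rule AE_mp[OF AE_proper], rule AE_I2, rule impI)
    fix \<omega> assume "proper \<omega>" and \<omega>: "\<omega> \<in> space M"
    have "(if X v m k \<omega> < \<infinity> then 1 else 0) = (SUP n. ?f n k \<omega>)" for k
    proof (cases "X v m k \<omega> < \<infinity>")
      case True
      moreover have "0 < X v m k \<omega>" using \<open>proper \<omega>\<close> by (simp add: proper_def)
      ultimately obtain x where x: "X v m k \<omega> = ereal x" by (cases "X v m k \<omega>") auto
      obtain n where "x \<le> real n" using real_arch_simple by blast
      then have "?f n k \<omega> = 1" using \<omega> x by (simp add: proper_offs[OF \<open>proper \<omega>\<close>])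
      then have "1 \<le> (SUP n. ?f n k \<omega>)" by (intro SUP_upper2[of n]) auto
      moreover have "(SUP n. ?f n k \<omega>) \<le> 1" by (intro SUP_least) (auto simp: indicator_def)
      ultimately have "(SUP n. ?f n k \<omega>) = 1" by (rule antisym[rotated])
      then show ?thesis using True by simp
    next
      case False
      then have "?f n k \<omega> = 0" for n using \<open>proper \<omega>\<close> by (auto simp: proper_offs)
      then show ?thesis using False by simp
    qed
    then show "(\<Sum>k. if X v m k \<omega> < \<infinity> then 1 else 0) = (\<Sum>k. SUP n. ?f n k \<omega>)" by simp
  qed
  also have "\<dots> = (\<integral>\<^sup>+\<omega>. (SUP n. \<Sum>k. ?f n k \<omega>) \<partial>M)"
    by (subst ennreal_suminf_SUP_eq[OF inc]) simp
  also have "\<dots> = (SUP n. \<integral>\<^sup>+\<omega>. (\<Sum>k. ?f n k \<omega>) \<partial>M)"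
  proof (rule nn_integral_monotone_convergence_SUP)
    show "incseq (\<lambda>n \<omega>. \<Sum>k. ?f n k \<omega>)"
      by (intro incseq_SucI le_funI suminf_le) (rule incseq_SucD[OF inc], simp_all)
  qed measurable
  also have "\<dots> \<le> ennreal (branching_matrix g mark_law $ m $ comp_of v)"
    by (intro SUP_least expected_offspring_window(2) v int)
  finally show ?thesis .
qed

text \<open>The weights \<open>w\<close> form a supersolution of the recursion for the expected sizes of the first
generations.\<close>

lemma nn_integral_gen_bound:
  assumes v: "v \<noteq> []" and int: "\<And>j m. integrable (mark_law j) (\<lambda>b. b $ m)"
    and w: "\<And>j. 0 \<le> w j" "\<And>j. 1 + (\<Sum>m\<in>UNIV. branching_matrix g mark_law $ m $ j * w m) \<le> w j"
    and H: "\<And>m j. 0 \<le> branching_matrix g mark_law $ m $ j"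
  shows "(\<integral>\<^sup>+\<omega>. gen_bound n v \<omega> \<partial>M) \<le> ennreal (w (comp_of v))"
  using v
proof (induction n arbitrary: v)
  case 0
  have "0 \<le> (\<Sum>m\<in>UNIV. branching_matrix g mark_law $ m $ comp_of v * w m)"
    using w(1) H by (intro sum_nonneg) auto
  then have "1 \<le> w (comp_of v)" using w(2)[of "comp_of v"] by linarith
  then show ?case by (simp add: emeasure_space_1)
next
  case (Suc n)
  let ?H = "branching_matrix g mark_law"
  let ?a = "\<lambda>m k \<omega>. (if X v m k \<omega> < \<infinity> then 1 else 0 :: ennreal)"
  have [measurable]: "gen_bound n u \<in> borel_measurable M" for u by (rule info_measurable[OF gen_bound_info])
  have a: "?a m k \<in> borel_measurable (info {Family v})" for m k
  proof -
    note [measurable] = X_measurable_info[of v "{Family v}" m k, simplified]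
    show ?thesis by measurable
  qed
  have "(\<integral>\<^sup>+\<omega>. gen_bound (Suc n) v \<omega> \<partial>M)
      = 1 + (\<Sum>m\<in>UNIV. \<Sum>k. \<integral>\<^sup>+\<omega>. ?a m k \<omega> * gen_bound n ((m, k) # v) \<omega> \<partial>M)"
    by (simp add: nn_integral_add nn_integral_sum nn_integral_suminf emeasure_space_1)
  also have "\<dots> = 1 + (\<Sum>m\<in>UNIV. \<Sum>k. (\<integral>\<^sup>+\<omega>. ?a m k \<omega> \<partial>M) * (\<integral>\<^sup>+\<omega>. gen_bound n ((m, k) # v) \<omega> \<partial>M))"
    by (simp only: indep_info[OF a gen_bound_info descendants_disjoint(2)])
  also have "\<dots> \<le> 1 + (\<Sum>m\<in>UNIV. \<Sum>k. (\<integral>\<^sup>+\<omega>. ?a m k \<omega> \<partial>M) * ennreal (w m))"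
  proof (intro add_left_mono sum_mono suminf_le mult_left_mono)
    fix m k
    show "(\<integral>\<^sup>+\<omega>. gen_bound n ((m, k) # v) \<omega> \<partial>M) \<le> ennreal (w m)"
      using Suc.IH[of "(m, k) # v"] by (simp add: comp_of_def)
  qed auto
  also have "\<dots> = 1 + (\<Sum>m\<in>UNIV. (\<Sum>k. \<integral>\<^sup>+\<omega>. ?a m k \<omega> \<partial>M) * ennreal (w m))"
    by simp
  also have "\<dots> \<le> 1 + (\<Sum>m\<in>UNIV. ennreal (?H $ m $ comp_of v) * ennreal (w m))"
    by (intro add_left_mono sum_mono mult_right_mono expected_offspring Suc.prems int) auto
  also have "\<dots> = ennreal (1 + (\<Sum>m\<in>UNIV. ?H $ m $ comp_of v * w m))"
    using w(1) H by (simp add: ennreal_mult'[symmetric] sum_nonneg flip: ennreal_1)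
  also have "\<dots> \<le> ennreal (w (comp_of v))" by (intro ennreal_leI w)
  finally show ?case .
qed

lemma count_gen_le_gen_bound:
  assumes "proper \<omega>"
  shows "emeasure (count_space UNIV) {u. length u \<le> n \<and> delay X \<omega> v u < \<infinity>} \<le> gen_bound n v \<omega>"
proof (induction n arbitrary: v)
  case 0
  have "{u. length u \<le> 0 \<and> delay X \<omega> v u < \<infinity>} \<subseteq> {[]}" by auto
  from emeasure_mono[OF this, of "count_space UNIV"] show ?case by simp
next
  case (Suc n)
  let ?A = "\<lambda>n v. {u. length u \<le> n \<and> delay X \<omega> v u < \<infinity>}"
  let ?c = "emeasure (count_space UNIV) :: 'd event set \<Rightarrow> ennreal"
  define S where "S m k = (if X v m k \<omega> < \<infinity> then (\<lambda>u. u @ [(m, k)]) ` ?A n ((m, k) # v) else {})" for m k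
  have "?A (Suc n) v \<subseteq> {[]} \<union> (\<Union>m. \<Union>k. S m k)"
  proof
    fix u assume u: "u \<in> ?A (Suc n) v"
    show "u \<in> {[]} \<union> (\<Union>m. \<Union>k. S m k)"
    proof (cases u rule: rev_cases)
      case (snoc u' p)
      obtain m k where p: "p = (m, k)" by fastforce
      have "0 < X v m k \<omega>" using assms by (simp add: proper_def)
      moreover have "X v m k \<omega> + delay X \<omega> (p # v) u' < \<infinity>"
        using u by (simp add: snoc delay_append p)
      ultimately have fin: "X v m k \<omega> < \<infinity>" "delay X \<omega> (p # v) u' < \<infinity>"
        using proper_delay_nonneg[OF assms, of "p # v" u']
        by (cases "X v m k \<omega>"; cases "delay X \<omega> (p # v) u'"; simp)+
      have "length u' \<le> n" using u by (simp add: snoc)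
      then have "u \<in> S m k" unfolding S_def snoc using fin by (simp add: p)
      then show ?thesis by blast
    qed simp
  qed
  then have "?c (?A (Suc n) v) \<le> ?c ({[]} \<union> (\<Union>m. \<Union>k. S m k))"
    by (intro emeasure_mono) auto
  also have "\<dots> \<le> ?c {[]} + ?c (\<Union>m. \<Union>k. S m k)"
    by (intro emeasure_subadditive) auto
  also have "?c (\<Union>m. \<Union>k. S m k) \<le> (\<Sum>m\<in>UNIV. ?c (\<Union>k. S m k))"
    by (intro emeasure_subadditive_finite) auto
  also have "\<dots> \<le> (\<Sum>m\<in>UNIV. \<Sum>k. ?c (S m k))"
    by (intro sum_mono emeasure_subadditive_countably) auto
  also have "\<dots> \<le> (\<Sum>m\<in>UNIV. \<Sum>k. (if X v m k \<omega> < \<infinity> then 1 else 0) * gen_bound n ((m, k) # v) \<omega>)"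
  proof (intro sum_mono suminf_le)
    fix m k
    have "?c ((\<lambda>u. u @ [(m, k)]) ` ?A n ((m, k) # v)) = ?c (?A n ((m, k) # v))"
      by (subst (1 2) emeasure_count_space) (auto simp: card_image inj_on_def finite_image_iff)
    then show "?c (S m k) \<le> (if X v m k \<omega> < \<infinity> then 1 else 0) * gen_bound n ((m, k) # v) \<omega>"
      using Suc[of "(m, k) # v"] by (simp add: S_def)
  qed auto
  finally show ?case by (simp add: add_left_mono)
qed

text \<open>The bounds for the generations increase to a limit with finite expectation.\<close>

lemma AE_finite_cluster:
  assumes int: "\<And>j m. integrable (mark_law j) (\<lambda>b. b $ m)"
    and w: "\<And>j. 0 \<le> w j" "\<And>j. 1 + (\<Sum>m\<in>UNIV. branching_matrix g mark_law $ m $ j * w m) \<le> w j"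
    and H: "\<And>m j. 0 \<le> branching_matrix g mark_law $ m $ j"
  shows "AE \<omega> in M. \<forall>v. v \<noteq> [] \<longrightarrow> finite (cluster v \<omega>)"
proof -
  have "AE \<omega> in M. finite (cluster v \<omega>)" if v: "v \<noteq> []" for v
  proof -
    have [measurable]: "gen_bound n u \<in> borel_measurable M" for n u by (rule info_measurable[OF gen_bound_info])
    have "(\<integral>\<^sup>+\<omega>. (SUP n. gen_bound n v \<omega>) \<partial>M) = (SUP n. \<integral>\<^sup>+\<omega>. gen_bound n v \<omega> \<partial>M)"
      by (intro nn_integral_monotone_convergence_SUP)
        (auto intro!: incseq_SucI le_funI incseq_gen_bound simp del: gen_bound.simps)
    also have "\<dots> \<le> ennreal (w (comp_of v))"
      by (intro SUP_least nn_integral_gen_bound v int w H)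
    finally have "(\<integral>\<^sup>+\<omega>. (SUP n. gen_bound n v \<omega>) \<partial>M) \<noteq> \<infinity>" by (auto simp: top_unique)
    then have "AE \<omega> in M. (SUP n. gen_bound n v \<omega>) \<noteq> \<infinity>"
      by (intro nn_integral_PInf_AE) auto
    then show ?thesis
      using AE_proper
    proof eventually_elim
      fix \<omega> assume f: "(SUP n. gen_bound n v \<omega>) \<noteq> \<infinity>" and p: "proper \<omega>"
      let ?A = "\<lambda>n. {u. length u \<le> n \<and> delay X \<omega> v u < \<infinity>}"
      have "emeasure (count_space UNIV) (\<Union>n. ?A n) = (SUP n. emeasure (count_space UNIV) (?A n))"
        by (intro SUP_emeasure_incseq[symmetric]) (auto simp: incseq_def)
      also have "\<dots> \<le> (SUP n. gen_bound n v \<omega>)"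
        by (intro SUP_mono' count_gen_le_gen_bound p)
      finally have "finite (\<Union>n. ?A n)"
        using f by (cases "finite (\<Union>n. ?A n)") (auto simp: top_unique)
      moreover have "cluster v \<omega> = (\<lambda>u. u @ v) ` (\<Union>n. ?A n)" by (auto simp: cluster_def)
      ultimately show "finite (cluster v \<omega>)" by simp
    qed
  qed
  then show ?thesis by (subst AE_all_countable) simp
qed

text \<open>The product of \<open>z (comp_of w)\<close> over the events \<open>w\<close> of a finite cluster. Written as a limit of truncated
weights it is measurable with respect to the sources of the cluster.\<close>

definition cluster_weight :: "('d \<Rightarrow> ennreal) \<Rightarrow> 'd event \<Rightarrow> 'w \<Rightarrow> ennreal" where
  "cluster_weight z v \<omega> = liminf (\<lambda>n. tree_weight z n n v \<omega>)"

lemma cluster_weight_info: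
  assumes "\<And>j. 1 \<le> z j"
  shows "cluster_weight z v \<in> borel_measurable (info (descendants v))"
proof -
  note [measurable] = tree_weight_info[OF assms]
  show ?thesis unfolding cluster_weight_def by measurable
qed

lemma cluster_weight_ge_1:
  assumes "\<And>j. 1 \<le> z j"
  shows "1 \<le> cluster_weight z v \<omega>"
  unfolding cluster_weight_def by (intro Liminf_bounded always_eventually allI tree_weight_ge_1 assms)

lemma cluster_weight_eq_prod:
  assumes "proper \<omega>" "finite (cluster v \<omega>)"
  shows "cluster_weight z v \<omega> = (\<Prod>w\<in>cluster v \<omega>. z (comp_of w))"
proof -
  have "\<forall>\<^sub>F n in sequentially. tree_weight z n n v \<omega> = (\<Prod>w\<in>cluster v \<omega>. z (comp_of w))"
    using tree_eventually_cluster[OF assms] by eventually_elim (simp add: tree_weight_def)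
  then have "(\<lambda>n. tree_weight z n n v \<omega>) \<longlonglongrightarrow> (\<Prod>w\<in>cluster v \<omega>. z (comp_of w))"
    by (rule tendsto_eventually)
  then show ?thesis unfolding cluster_weight_def by (intro lim_imp_Liminf) simp_all
qed

text \<open>The truncated weights have the same expectation for both roots. By Fatou's lemma their lower limit
bounds the expectation of the full weight from above, and they are below the full weight.\<close>

lemma nn_integral_cluster_weight_cong:
  assumes z: "\<And>j. 1 \<le> z j" and fin: "AE \<omega> in M. \<forall>v. v \<noteq> [] \<longrightarrow> finite (cluster v \<omega>)"
    and v: "v \<noteq> []" "v' \<noteq> []" "comp_of v = comp_of v'"
  shows "(\<integral>\<^sup>+\<omega>. cluster_weight z v \<omega> \<partial>M) = (\<integral>\<^sup>+\<omega>. cluster_weight z v' \<omega> \<partial>M)"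
proof -
  have le: "(\<integral>\<^sup>+\<omega>. cluster_weight z v \<omega> \<partial>M) \<le> (\<integral>\<^sup>+\<omega>. cluster_weight z v' \<omega> \<partial>M)"
    if v: "v \<noteq> []" "v' \<noteq> []" "comp_of v = comp_of v'" for v v'
  proof -
    have [measurable]: "tree_weight z n n u \<in> borel_measurable M" for n u
      by (rule info_measurable[OF tree_weight_info[OF z]])
    have "(\<integral>\<^sup>+\<omega>. cluster_weight z v \<omega> \<partial>M) \<le> liminf (\<lambda>n. \<integral>\<^sup>+\<omega>. tree_weight z n n v \<omega> \<partial>M)"
      unfolding cluster_weight_def by (rule nn_integral_liminf) simp
    also have "\<dots> = liminf (\<lambda>n. \<integral>\<^sup>+\<omega>. tree_weight z n n v' \<omega> \<partial>M)"
      using v by (simp add: nn_integral_tree_weight[OF z])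
    also have "\<dots> \<le> liminf (\<lambda>n. \<integral>\<^sup>+\<omega>. cluster_weight z v' \<omega> \<partial>M)"
    proof (rule Liminf_mono, rule always_eventually, rule allI, rule nn_integral_mono_AE)
      fix n
      show "AE \<omega> in M. tree_weight z n n v' \<omega> \<le> cluster_weight z v' \<omega>"
        using AE_proper fin
      proof eventually_elim
        case (elim \<omega>)
        then have f: "finite (cluster v' \<omega>)" using v by blast
        show ?case
          unfolding cluster_weight_eq_prod[OF elim(1) f] tree_weight_def
          using z tree_subset_cluster f by (intro prod_mono2_ge_1) auto
      qed
    qed
    finally show ?thesis by (simp only: Liminf_const[OF sequentially_bot])
  qed
  show ?thesis by (rule antisym[OF le[OF v] le[OF v(2,1) v(3)[symmetric]]])
qed

lemma prod_cluster_count: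
  assumes "finite (cluster [(j, 0)] \<omega>)"
  shows "(\<Prod>l\<in>UNIV. z l ^ cluster_count X l j \<omega>) = (\<Prod>w\<in>cluster [(j, 0)] \<omega>. z (comp_of w) :: 'c :: comm_monoid_mult)"
proof -
  let ?C = "cluster [(j, 0)] \<omega>"
  have "(\<Prod>w\<in>?C. z (comp_of w)) = (\<Prod>l\<in>UNIV. \<Prod>w\<in>{w \<in> ?C. comp_of w = l}. z (comp_of w))"
    using assms by (intro prod.group[symmetric]) auto
  also have "\<dots> = (\<Prod>l\<in>UNIV. z l ^ card {w \<in> ?C. comp_of w = l})"
    by (intro prod.cong) auto
  moreover have "card {w \<in> ?C. comp_of w = l} = cluster_count X l j \<omega>" for l
  proof -
    have "{w \<in> ?C. comp_of w = l} = (\<lambda>u. u @ [(j, 0)]) ` {u. comp_of (u @ [(j, 0)]) = l \<and> delay X \<omega> [(j, 0)] u < \<infinity>}"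
      by (auto simp: cluster_def)
    then show ?thesis unfolding cluster_count_def by (simp add: card_image inj_on_def)
  qed
  ultimately show ?thesis by simp
qed

text \<open>A nonnegative entry is bounded by a multiple of the exponential moment.\<close>

lemma integrable_mark:
  assumes "marks_light_tailed mark_law"
  shows "integrable (mark_law j) (\<lambda>b. b $ m)"
proof -
  obtain \<theta> :: "real ^ 'd" where \<theta>: "\<And>m. 0 < \<theta> $ m"
      "\<And>j. integrable (mark_law j) (\<lambda>b. exp (\<Sum>m\<in>UNIV. b $ m * \<theta> $ m))"
    using assms unfolding marks_light_tailed_def by blast
  have [measurable]: "(\<lambda>b :: real ^ 'd. b $ m) \<in> borel_measurable borel"
    by (rule borel_measurable_continuous_onI) (intro continuous_intros)
  show ?thesis
  proof (rule Bochner_Integration.integrable_bound)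
    show "integrable (mark_law j) (\<lambda>b. exp (\<Sum>m\<in>UNIV. b $ m * \<theta> $ m) / \<theta> $ m)" using \<theta>(2) by simp
    show "(\<lambda>b. b $ m) \<in> borel_measurable (mark_law j)" by measurable
    show "AE b in mark_law j. norm (b $ m) \<le> norm (exp (\<Sum>m\<in>UNIV. b $ m * \<theta> $ m) / \<theta> $ m)"
      using mark_nonneg[of j]
    proof eventually_elim
      case (elim b)
      have nn: "0 \<le> b $ k * \<theta> $ k" for k using elim \<theta>(1)[of k] by simp
      have "b $ m * \<theta> $ m \<le> (\<Sum>m\<in>UNIV. b $ m * \<theta> $ m)" by (rule member_le_sum) (use nn in auto)
      also have "\<dots> \<le> exp (\<Sum>m\<in>UNIV. b $ m * \<theta> $ m)"
        using exp_ge_add_one_self[of "\<Sum>m\<in>UNIV. b $ m * \<theta> $ m"] by linarith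
      finally have "b $ m \<le> exp (\<Sum>m\<in>UNIV. b $ m * \<theta> $ m) / \<theta> $ m"
        using \<theta>(1)[of m] by (simp add: pos_le_divide_eq)
      then show ?case using elim \<theta>(1)[of m] by simp
    qed
  qed
qed

text \<open>The decay mass bounds the integral over any window, which is nonnegative.\<close>

lemma branching_matrix_nonneg: "0 \<le> branching_matrix g mark_law $ m $ j"
proof -
  have "0 \<le> (\<integral>b. b $ m \<partial>mark_law j)"
    by (rule integral_nonneg_AE, rule eventually_mono[OF mark_nonneg]) blast
  moreover have "0 \<le> decay_mass g m j"
    by (rule order_trans[OF integral_decay_window])
  ultimately show ?thesis by (simp add: branching_matrix_def)
qed

lemma AE_finite_cluster_subcritical:
  assumes "marks_light_tailed mark_law" "spectral_radius (branching_matrix g mark_law) < 1"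
  shows "AE \<omega> in M. \<forall>v. v \<noteq> [] \<longrightarrow> finite (cluster v \<omega>)"
proof -
  obtain w where "\<And>j. 0 \<le> w j" "\<And>j. 1 + (\<Sum>m\<in>UNIV. branching_matrix g mark_law $ m $ j * w m) \<le> w j"
    using subcritical_weights[OF branching_matrix_nonneg assms(2)] by blast
  then show ?thesis by (rule AE_finite_cluster[OF integrable_mark[OF assms(1)] _ _ branching_matrix_nonneg])
qed

section \<open>Moment generating functions of total claims\<close>

lemma delay_info: "(\<lambda>\<omega>. delay X \<omega> v u) \<in> borel_measurable (info (range Family))"
proof (induction u)
  case (Cons p u)
  obtain m k where p: "p = (m, k)" by fastforce
  note [measurable] = Cons X_measurable_info[of "u @ v" "range Family" m k, simplified]
  show ?case unfolding p delay.simps by measurable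
qed simp

lemma pred_tree:
  assumes "v \<noteq> []"
  shows "Measurable.pred (info (range Family)) (\<lambda>\<omega>. w \<in> tree K d v \<omega>)"
  using assms
proof (induction d arbitrary: v)
  case (Suc d)
  have [measurable]: "Measurable.pred (info (range Family)) (\<lambda>\<omega>. finite (offs v T \<omega>) \<and> card (offs v T \<omega>) \<le> K)" for T
    by (rule pred_few_offs) simp
  have [measurable]: "Measurable.pred (info (range Family)) (\<lambda>\<omega>. p \<in> offs v T \<omega>)" for p T
    by (rule pred_offs) simp
  have [measurable]: "Measurable.pred (info (range Family)) (\<lambda>\<omega>. w \<in> tree K d (p # v) \<omega>)" for p
    by (rule Suc.IH) simp
  have eq: "w \<in> tree K (Suc d) v \<omega> \<longleftrightarrow> w = v \<or> (finite (offs v K \<omega>) \<and> card (offs v K \<omega>) \<le> K)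
      \<and> (\<exists>p. p \<in> offs v K \<omega> \<and> w \<in> tree K d (p # v) \<omega>)" for \<omega>
    by (simp add: Bex_def) blast
  show ?case unfolding eq by measurable
qed simp

text \<open>Events are countable, so a random set of events can be handled as a random set of natural numbers.\<close>

lemma events_card_info:
  fixes S :: "'w \<Rightarrow> 'd event set"
  assumes "\<And>v. Measurable.pred N (\<lambda>\<omega>. v \<in> S \<omega>)"
  shows "Measurable.pred N (\<lambda>\<omega>. finite (S \<omega>))" "(\<lambda>\<omega>. card (S \<omega>)) \<in> measurable N (count_space UNIV)"
proof -
  note [measurable] = assms
  have *: "{\<omega> \<in> space N. n \<in> to_nat ` S \<omega>} \<in> sets N" for n
  proof -
    have "{\<omega> \<in> space N. n \<in> to_nat ` S \<omega>} = {\<omega> \<in> space N. \<exists>v. v \<in> S \<omega> \<and> n = to_nat v}" by blast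
    also have "\<dots> \<in> sets N" by measurable
    finally show ?thesis .
  qed
  show "Measurable.pred N (\<lambda>\<omega>. finite (S \<omega>))"
    using measurable_finite[OF *] by (simp add: finite_image_iff)
  show "(\<lambda>\<omega>. card (S \<omega>)) \<in> measurable N (count_space UNIV)"
    using measurable_card[OF *] by (simp add: card_image)
qed

definition claim_total :: "(real ^ 'e \<Rightarrow> real) \<Rightarrow> ('d \<Rightarrow> nat) \<Rightarrow> 'w \<Rightarrow> real" where
  "claim_total h n \<omega> = (\<Sum>j\<in>UNIV. \<Sum>r<n j. h (U j r \<omega>))"

definition event_counts :: "'d event set \<Rightarrow> 'd \<Rightarrow> nat" where
  "event_counts S j = card {v \<in> S. comp_of v = j}"

definition size_mgf :: "(real ^ 'e \<Rightarrow> real) \<Rightarrow> real \<Rightarrow> 'd \<Rightarrow> ennreal" where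
  "size_mgf h s l = (\<integral>\<^sup>+u. ennreal (exp (s * h u)) \<partial>claim_law l)"

lemma size_mgf_ge_1:
  assumes "\<And>u. 0 \<le> h u" "0 \<le> s"
  shows "1 \<le> size_mgf h s l"
proof -
  interpret D: prob_space "claim_law l" by (rule claim_prob_space)
  have "(\<integral>\<^sup>+u. 1 \<partial>claim_law l) \<le> size_mgf h s l"
    unfolding size_mgf_def using assms by (intro nn_integral_mono) simp
  then show ?thesis by (simp add: D.emeasure_space_1)
qed

lemma claim_total_measurable:
  assumes S: "\<And>v. Measurable.pred (info (range Family)) (\<lambda>\<omega>. v \<in> S \<omega>)"
    and [measurable]: "h \<in> borel_measurable borel"
  shows "(\<lambda>\<omega>. claim_total h (event_counts (S \<omega>)) \<omega>) \<in> borel_measurable M"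
proof -
  have [measurable]: "U j r \<in> borel_measurable M" for j r by (rule claim_measurable)
  have [measurable]: "(\<lambda>\<omega>. event_counts (S \<omega>) j) \<in> measurable M (count_space UNIV)" for j
    unfolding event_counts_def
    by (rule events_card_info(2)) (use info_measurable[OF S] in simp)
  have "(\<lambda>\<omega>. \<Sum>r<event_counts (S \<omega>) j. h (U j r \<omega>)) \<in> borel_measurable M" for j
    by (rule measurable_compose_countable[where g="\<lambda>\<omega>. event_counts (S \<omega>) j"
        and f="\<lambda>n \<omega>. \<Sum>r<n. h (U j r \<omega>)"]) measurable
  then show ?thesis unfolding claim_total_def by (intro borel_measurable_sum)
qed

text \<open>Claims belong to event numbers, not to labels of events. For a fixed time this makes no difference:
the claims are independent of the events, so that given the events each of them contributes a factor
with the law of its component.\<close>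

lemma nn_integral_exp_claim_total:
  assumes S: "\<And>v. Measurable.pred (info (range Family)) (\<lambda>\<omega>. v \<in> S \<omega>)"
    and fin: "AE \<omega> in M. finite (S \<omega>)"
    and h: "\<And>u. 0 \<le> h u" "h \<in> borel_measurable borel" and s: "0 \<le> s"
  shows "(\<integral>\<^sup>+\<omega>. ennreal (exp (s * claim_total h (event_counts (S \<omega>)) \<omega>)) \<partial>M)
       = (\<integral>\<^sup>+\<omega>. (\<Prod>v\<in>S \<omega>. size_mgf h s (comp_of v)) \<partial>M)"
proof -
  note [measurable] = h(2)
  define A where "A \<omega> = {(j, r). r < event_counts (S \<omega>) j}" for \<omega>
  define W :: "'d \<times> nat \<Rightarrow> 'w \<Rightarrow> ennreal" where "W p \<omega> = ennreal (exp (s * h (U (fst p) (snd p) \<omega>)))" for p \<omega>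
  have finA: "finite (A \<omega>)" for \<omega>
  proof -
    have "A \<omega> = Sigma UNIV (\<lambda>j. {..<event_counts (S \<omega>) j})" by (auto simp: A_def)
    then show ?thesis by simp
  qed
  have W1: "1 \<le> W p \<omega>" for p \<omega> using h s by (simp add: W_def)
  have EW: "(\<integral>\<^sup>+\<omega>. W p \<omega> \<partial>M) = size_mgf h s (fst p)" for p
    unfolding W_def size_mgf_def claim_distr[of "fst p" "snd p", symmetric]
    by (subst nn_integral_distr) (use claim_measurable in measurable)
  have "(\<integral>\<^sup>+\<omega>. ennreal (exp (s * claim_total h (event_counts (S \<omega>)) \<omega>)) \<partial>M)
      = (\<integral>\<^sup>+\<omega>. 1 * iprod (\<lambda>p. if p \<in> A \<omega> then W p \<omega> else 1) \<partial>M)"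
  proof (rule nn_integral_cong)
    fix \<omega>
    have "iprod (\<lambda>p. if p \<in> A \<omega> then W p \<omega> else 1) = (\<Prod>p\<in>A \<omega>. W p \<omega>)"
      by (rule iprod_finite_support[OF finA W1])
    also have "\<dots> = ennreal (\<Prod>p\<in>A \<omega>. exp (s * h (U (fst p) (snd p) \<omega>)))"
      unfolding W_def by (rule prod_ennreal) simp
    also have "(\<Prod>p\<in>A \<omega>. exp (s * h (U (fst p) (snd p) \<omega>))) = exp (\<Sum>p\<in>A \<omega>. s * h (U (fst p) (snd p) \<omega>))"
      by (rule exp_sum[symmetric, OF finA])
    also have "(\<Sum>p\<in>A \<omega>. s * h (U (fst p) (snd p) \<omega>))
        = (\<Sum>p\<in>Sigma UNIV (\<lambda>j. {..<event_counts (S \<omega>) j}). s * h (U (fst p) (snd p) \<omega>))"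
      by (rule sum.cong) (auto simp: A_def)
    also have "\<dots> = s * claim_total h (event_counts (S \<omega>)) \<omega>"
      by (subst sum.Sigma[symmetric, where g="\<lambda>j r. s * h (U j r \<omega>)", unfolded case_prod_beta])
        (auto simp: claim_total_def sum_distrib_left)
    finally show "ennreal (exp (s * claim_total h (event_counts (S \<omega>)) \<omega>))
        = 1 * iprod (\<lambda>p. if p \<in> A \<omega> then W p \<omega> else 1)" by simp
  qed
  also have "\<dots> = (\<integral>\<^sup>+\<omega>. 1 * iprod (\<lambda>p. if p \<in> A \<omega> then (\<integral>\<^sup>+\<omega>'. W p \<omega>' \<partial>M) else 1) \<partial>M)"
  proof (rule nn_integral_thinned_iprod[where J = "\<lambda>p. {Claim (fst p) (snd p)}"])
    show "{\<omega> \<in> space M. p \<in> A \<omega>} \<in> sets (info (range Family))" for p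
    proof -
      have [measurable]: "(\<lambda>\<omega>. event_counts (S \<omega>) (fst p)) \<in> measurable (info (range Family)) (count_space UNIV)"
        unfolding event_counts_def by (rule events_card_info(2)) (use S in simp)
      have "{\<omega> \<in> space (info (range Family)). snd p < event_counts (S \<omega>) (fst p)} \<in> sets (info (range Family))"
        by measurable
      then show ?thesis by (simp add: A_def case_prod_beta)
    qed
    show "W p \<in> borel_measurable (info {Claim (fst p) (snd p)})" for p
    proof -
      have [measurable]: "U (fst p) (snd p) \<in> borel_measurable (info {Claim (fst p) (snd p)})"
        by (rule U_measurable_info) simp
      show ?thesis unfolding W_def by measurable
    qed
  qed (use W1 in \<open>auto simp: prod_eq_iff\<close>)
  also have "\<dots> = (\<integral>\<^sup>+\<omega>. (\<Prod>v\<in>S \<omega>. size_mgf h s (comp_of v)) \<partial>M)"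
  proof (rule nn_integral_cong_AE, rule eventually_mono[OF fin])
    fix \<omega> assume f: "finite (S \<omega>)"
    have "iprod (\<lambda>p. if p \<in> A \<omega> then (\<integral>\<^sup>+\<omega>'. W p \<omega>' \<partial>M) else 1) = (\<Prod>p\<in>A \<omega>. size_mgf h s (fst p))"
      unfolding EW using size_mgf_ge_1[OF h(1) s] finA by (intro iprod_finite_support) auto
    also have "\<dots> = (\<Prod>m\<in>UNIV. size_mgf h s m ^ card {k. (m, k) \<in> A \<omega>})"
      by (rule prod_fst_power[OF finA])
    also have "\<dots> = (\<Prod>m\<in>UNIV. \<Prod>v\<in>{v \<in> S \<omega>. comp_of v = m}. size_mgf h s (comp_of v))"
      by (intro prod.cong) (auto simp: A_def event_counts_def)
    also have "\<dots> = (\<Prod>v\<in>S \<omega>. size_mgf h s (comp_of v))"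
      using f by (intro prod.group) auto
    finally show "1 * iprod (\<lambda>p. if p \<in> A \<omega> then (\<integral>\<^sup>+\<omega>'. W p \<omega>' \<partial>M) else 1)
        = (\<Prod>v\<in>S \<omega>. size_mgf h s (comp_of v))" by simp
  qed
  finally show ?thesis .
qed

definition events_upto :: "real \<Rightarrow> 'w \<Rightarrow> 'd event set" where
  "events_upto t \<omega> = {v. v \<noteq> [] \<and> 0 < delay X \<omega> [] v \<and> delay X \<omega> [] v \<le> ereal t}"

text \<open>Only the immigrants are restricted to \<open>(0, T]\<close>; their descendants may be later.\<close>

definition truncated_events :: "nat \<Rightarrow> nat \<Rightarrow> real \<Rightarrow> 'w \<Rightarrow> 'd event set" where
  "truncated_events K d T \<omega> = (\<Union>p\<in>offs [] T \<omega>. tree K d [p] \<omega>)"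

lemma pred_events_upto: "Measurable.pred (info (range Family)) (\<lambda>\<omega>. v \<in> events_upto t \<omega>)"
proof -
  note [measurable] = delay_info
  show ?thesis unfolding events_upto_def by simp
qed

lemma pred_truncated_events: "Measurable.pred (info (range Family)) (\<lambda>\<omega>. v \<in> truncated_events K d T \<omega>)"
proof -
  have [measurable]: "Measurable.pred (info (range Family)) (\<lambda>\<omega>. p \<in> offs [] T \<omega>)" for p
    by (rule pred_offs) simp
  have [measurable]: "Measurable.pred (info (range Family)) (\<lambda>\<omega>. v \<in> tree K d [p] \<omega>)" for p
    by (rule pred_tree) simp
  show ?thesis unfolding truncated_events_def UN_iff Bex_def by measurable
qed

lemma hawkes_count_eq: "hawkes_count X j t \<omega> = emeasure (count_space UNIV) {v \<in> events_upto t \<omega>. comp_of v = j}"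
proof -
  have "{v. v \<noteq> [] \<and> comp_of v = j \<and> 0 < delay X \<omega> [] v \<and> delay X \<omega> [] v \<le> ereal t}
      = {v \<in> events_upto t \<omega>. comp_of v = j}"
    unfolding events_upto_def by blast
  then show ?thesis unfolding hawkes_count_def by simp
qed

lemma hawkes_count_measurable: "hawkes_count X j t \<in> borel_measurable M"
proof -
  have *: "Measurable.pred M (\<lambda>\<omega>. v \<in> {v \<in> events_upto t \<omega>. comp_of v = j})" for v
    using info_measurable[OF pred_events_upto, of v t] by simp
  note [measurable] = events_card_info[OF *]
  have "hawkes_count X j t \<omega> = (if finite {v \<in> events_upto t \<omega>. comp_of v = j}
      then of_nat (card {v \<in> events_upto t \<omega>. comp_of v = j}) else \<infinity>)" for \<omega>
    unfolding hawkes_count_eq by (simp add: emeasure_count_space)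
  then have "hawkes_count X j t = (\<lambda>\<omega>. if finite {v \<in> events_upto t \<omega>. comp_of v = j}
      then of_nat (card {v \<in> events_upto t \<omega>. comp_of v = j}) else \<infinity>)" by blast
  then show ?thesis by simp
qed

lemma delay_append_root:
  "delay X \<omega> [] (u @ [p]) = X [] (fst p) (snd p) \<omega> + delay X \<omega> [p] u"
  by (cases p) (simp add: delay_append)

lemma tree_root_in_events:
  assumes "proper \<omega>" "p \<in> offs [] T \<omega>" "v \<in> tree K d [p] \<omega>"
  shows "v \<in> events_upto (T + real d * real K) \<omega>"
proof -
  obtain u where u: "v = u @ [p]" using assms(3) tree_suffix by blast
  have 1: "X [] (fst p) (snd p) \<omega> \<le> ereal T" using assms proper_offs by blast
  have 2: "delay X \<omega> [p] u \<le> ereal (real d * real K)" using assms(3) tree_delay u by blast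
  have 3: "0 < X [] (fst p) (snd p) \<omega>" using assms by (simp add: proper_def)
  have 4: "0 \<le> delay X \<omega> [p] u" using assms proper_delay_nonneg by blast
  have "X [] (fst p) (snd p) \<omega> + delay X \<omega> [p] u \<le> ereal T + ereal (real d * real K)"
    using 1 2 by (rule add_mono)
  moreover have "0 < X [] (fst p) (snd p) \<omega> + delay X \<omega> [p] u"
    using 3 4 by (rule add_pos_nonneg)
  ultimately show ?thesis unfolding events_upto_def u by (simp add: delay_append_root)
qed

text \<open>An event up to time \<open>t\<close> belongs to the cluster of an immigrant that arrived even earlier.\<close>

lemma events_upto_subset_clusters:
  assumes "proper \<omega>"
  shows "events_upto t \<omega> \<subseteq> (\<Union>p\<in>offs [] t \<omega>. cluster [p] \<omega>)"
proof
  fix v assume v: "v \<in> events_upto t \<omega>"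
  then obtain u p where u: "v = u @ [p]" unfolding events_upto_def by (cases v rule: rev_cases) auto
  have le: "X [] (fst p) (snd p) \<omega> + delay X \<omega> [p] u \<le> ereal t"
    using v unfolding u by (simp add: events_upto_def delay_append_root)
  have pos: "0 < X [] (fst p) (snd p) \<omega>" using assms by (simp add: proper_def)
  have nn: "0 \<le> delay X \<omega> [p] u" using assms by (rule proper_delay_nonneg)
  have "X [] (fst p) (snd p) \<omega> \<le> ereal t"
    using add_left_mono[OF nn, of "X [] (fst p) (snd p) \<omega>"] le by simp
  then have "p \<in> offs [] t \<omega>" by (simp add: proper_offs[OF assms])
  moreover have "delay X \<omega> [p] u < \<infinity>"
    using le pos nn by (cases "delay X \<omega> [p] u"; cases "X [] (fst p) (snd p) \<omega>") simp_all
  then have "v \<in> cluster [p] \<omega>" unfolding cluster_def u by blast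
  ultimately show "v \<in> (\<Union>p\<in>offs [] t \<omega>. cluster [p] \<omega>)" by blast
qed

lemma cluster_disjoint: "p \<noteq> q \<Longrightarrow> cluster (p # v) \<omega> \<inter> cluster (q # v) \<omega> = {}"
proof (rule ccontr)
  assume "p \<noteq> q" "cluster (p # v) \<omega> \<inter> cluster (q # v) \<omega> \<noteq> {}"
  then obtain w where "w \<in> cluster (p # v) \<omega>" "w \<in> cluster (q # v) \<omega>" by blast
  then obtain u u' where "w = u @ p # v" "w = u' @ q # v" unfolding cluster_def by blast
  then show False using \<open>p \<noteq> q\<close> append_Cons_same_tail[of u p v u' q] by simp
qed

lemma AE_finite_events_upto:
  assumes fin: "AE \<omega> in M. \<forall>v. v \<noteq> [] \<longrightarrow> finite (cluster v \<omega>)" and t: "0 \<le> t"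
  shows "AE \<omega> in M. finite (events_upto t \<omega>)"
  using fin AE_proper distr_immigrant_counts(1)[OF t]
proof eventually_elim
  case (elim \<omega>)
  then have "finite (\<Union>p\<in>offs [] t \<omega>. cluster [p] \<omega>)" by simp
  then show ?case using events_upto_subset_clusters[OF elim(2)] finite_subset by blast
qed

text \<open>Each event up to time \<open>t\<close> is replaced by the whole cluster that contains it. Given the immigrants, the
clusters are independent with expected weight \<open>F j\<close>, and the immigrants form Poisson processes.\<close>

lemma nn_integral_exp_claims_le:
  assumes fin: "AE \<omega> in M. \<forall>v. v \<noteq> [] \<longrightarrow> finite (cluster v \<omega>)"
    and h: "\<And>u. 0 \<le> h u" "h \<in> borel_measurable borel" and s: "0 \<le> s" and t: "0 \<le> t"
    and F: "\<And>j. (\<integral>\<^sup>+\<omega>. cluster_weight (size_mgf h s) [(j, 0)] \<omega> \<partial>M) = F j"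
    and Ffin: "\<And>j. 0 < base $ j \<Longrightarrow> F j < \<infinity>"
  shows "(\<integral>\<^sup>+\<omega>. ennreal (exp (s * claim_total h (event_counts (events_upto t \<omega>)) \<omega>)) \<partial>M)
       \<le> ennreal (exp (t * (\<Sum>j\<in>UNIV. base $ j * (enn2real (F j) - 1))))"
proof -
  let ?z = "size_mgf h s"
  have z: "1 \<le> ?z j" for j by (rule size_mgf_ge_1[OF h(1) s])
  have F1: "1 \<le> F j" for j
  proof -
    have "(\<integral>\<^sup>+\<omega>. 1 \<partial>M) \<le> F j"
      unfolding F[symmetric] by (intro nn_integral_mono cluster_weight_ge_1 z)
    then show ?thesis by (simp add: emeasure_space_1)
  qed
  have Fp: "(\<integral>\<^sup>+\<omega>. cluster_weight ?z [p] \<omega> \<partial>M) = F (fst p)" for p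
    unfolding F[symmetric] by (rule nn_integral_cluster_weight_cong[OF z fin]) (auto simp: comp_of_def)
  have "(\<integral>\<^sup>+\<omega>. ennreal (exp (s * claim_total h (event_counts (events_upto t \<omega>)) \<omega>)) \<partial>M)
      = (\<integral>\<^sup>+\<omega>. (\<Prod>v\<in>events_upto t \<omega>. ?z (comp_of v)) \<partial>M)"
    by (rule nn_integral_exp_claim_total[OF pred_events_upto AE_finite_events_upto[OF fin t] h s])
  also have "\<dots> \<le> (\<integral>\<^sup>+\<omega>. 1 * iprod (\<lambda>p. if p \<in> offs [] t \<omega> then cluster_weight ?z [p] \<omega> else 1) \<partial>M)"
  proof (rule nn_integral_mono_AE)
    show "AE \<omega> in M. (\<Prod>v\<in>events_upto t \<omega>. ?z (comp_of v))
        \<le> 1 * iprod (\<lambda>p. if p \<in> offs [] t \<omega> then cluster_weight ?z [p] \<omega> else 1)"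
      using fin AE_proper distr_immigrant_counts(1)[OF t]
    proof eventually_elim
      case (elim \<omega>)
      have f: "finite (cluster [p] \<omega>)" for p using elim(1) by simp
      have "(\<Prod>v\<in>events_upto t \<omega>. ?z (comp_of v)) \<le> (\<Prod>v\<in>(\<Union>p\<in>offs [] t \<omega>. cluster [p] \<omega>). ?z (comp_of v))"
        by (rule prod_mono2_ge_1[OF _ events_upto_subset_clusters[OF elim(2)] z]) (use elim f in simp)
      also have "\<dots> = (\<Prod>p\<in>offs [] t \<omega>. \<Prod>v\<in>cluster [p] \<omega>. ?z (comp_of v))"
        using elim(3) f cluster_disjoint by (intro prod.UNION_disjoint) simp_all
      also have "\<dots> = (\<Prod>p\<in>offs [] t \<omega>. cluster_weight ?z [p] \<omega>)"
        by (rule prod.cong[OF refl]) (rule cluster_weight_eq_prod[OF elim(2) f, symmetric])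
      also have "\<dots> = iprod (\<lambda>p. if p \<in> offs [] t \<omega> then cluster_weight ?z [p] \<omega> else 1)"
        by (rule iprod_finite_support[symmetric, OF elim(3) cluster_weight_ge_1[OF z]])
      finally show ?case by simp
    qed
  qed
  also have "\<dots> = (\<integral>\<^sup>+\<omega>. 1 * iprod (\<lambda>p. if p \<in> offs [] t \<omega> then (\<integral>\<^sup>+\<omega>'. cluster_weight ?z [p] \<omega>' \<partial>M) else 1) \<partial>M)"
    by (rule nn_integral_thinned_iprod[OF _ offs_info cluster_weight_info[OF z] descendants_disjoint(2,1)
        cluster_weight_ge_1[OF z]]) simp_all
  also have "\<dots> = ennreal (exp (t * (\<Sum>j\<in>UNIV. base $ j * (enn2real (F j) - 1))))"
    unfolding Fp mult_1 by (rule nn_integral_iprod_immigrants_exp[OF t F1 Ffin])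
  finally show ?thesis .
qed

text \<open>The same computation as for whole clusters, but with equality since all events of the truncated
clusters are counted.\<close>

lemma nn_integral_exp_truncated_claims:
  assumes h: "\<And>u. 0 \<le> h u" "h \<in> borel_measurable borel" and s: "0 \<le> s" and T: "0 \<le> T"
    and Ffin: "\<And>j. 0 < base $ j \<Longrightarrow> tree_pgf (size_mgf h s) K d j < \<infinity>"
  shows "(\<integral>\<^sup>+\<omega>. ennreal (exp (s * claim_total h (event_counts (truncated_events K d T \<omega>)) \<omega>)) \<partial>M)
       = ennreal (exp (T * (\<Sum>j\<in>UNIV. base $ j * (enn2real (tree_pgf (size_mgf h s) K d j) - 1))))"
proof -
  let ?z = "size_mgf h s"
  have z: "1 \<le> ?z j" for j by (rule size_mgf_ge_1[OF h(1) s])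
  have Fp: "(\<integral>\<^sup>+\<omega>. tree_weight ?z K d [p] \<omega> \<partial>M) = tree_pgf ?z K d (fst p)" for p
    by (subst nn_integral_tree_weight[OF z]) (auto simp: comp_of_def)
  have F1: "1 \<le> tree_pgf ?z K d j" for j
  proof -
    have "(\<integral>\<^sup>+\<omega>. 1 \<partial>M) \<le> tree_pgf ?z K d j"
      using Fp[of "(j, 0)", symmetric] by (simp only: fst_conv) (intro nn_integral_mono tree_weight_ge_1 z)
    then show ?thesis by (simp add: emeasure_space_1)
  qed
  have fin: "AE \<omega> in M. finite (truncated_events K d T \<omega>)"
    using distr_immigrant_counts(1)[OF T]
    by eventually_elim (simp add: truncated_events_def finite_tree)
  have "(\<integral>\<^sup>+\<omega>. ennreal (exp (s * claim_total h (event_counts (truncated_events K d T \<omega>)) \<omega>)) \<partial>M)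
      = (\<integral>\<^sup>+\<omega>. (\<Prod>v\<in>truncated_events K d T \<omega>. ?z (comp_of v)) \<partial>M)"
    by (rule nn_integral_exp_claim_total[OF pred_truncated_events fin h s])
  also have "\<dots> = (\<integral>\<^sup>+\<omega>. 1 * iprod (\<lambda>p. if p \<in> offs [] T \<omega> then tree_weight ?z K d [p] \<omega> else 1) \<partial>M)"
  proof (rule nn_integral_cong_AE, rule eventually_mono[OF distr_immigrant_counts(1)[OF T]])
    fix \<omega> assume f: "finite (offs [] T \<omega>)"
    have "(\<Prod>v\<in>truncated_events K d T \<omega>. ?z (comp_of v)) = (\<Prod>p\<in>offs [] T \<omega>. tree_weight ?z K d [p] \<omega>)"
      unfolding truncated_events_def tree_weight_def using f tree_disjoint(1) finite_tree
      by (intro prod.UNION_disjoint) simp_all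
    also have "\<dots> = iprod (\<lambda>p. if p \<in> offs [] T \<omega> then tree_weight ?z K d [p] \<omega> else 1)"
      by (rule iprod_finite_support[symmetric, OF f tree_weight_ge_1[OF z]])
    finally show "(\<Prod>v\<in>truncated_events K d T \<omega>. ?z (comp_of v))
        = 1 * iprod (\<lambda>p. if p \<in> offs [] T \<omega> then tree_weight ?z K d [p] \<omega> else 1)" by simp
  qed
  also have "\<dots> = (\<integral>\<^sup>+\<omega>. 1 * iprod (\<lambda>p. if p \<in> offs [] T \<omega> then (\<integral>\<^sup>+\<omega>'. tree_weight ?z K d [p] \<omega>' \<partial>M) else 1) \<partial>M)"
    by (rule nn_integral_thinned_iprod[OF _ offs_info tree_weight_info[OF z] descendants_disjoint(2,1)
        tree_weight_ge_1[OF z]]) simp_all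
  also have "\<dots> = ennreal (exp (T * (\<Sum>j\<in>UNIV. base $ j * (enn2real (tree_pgf ?z K d j) - 1))))"
    unfolding Fp mult_1 by (rule nn_integral_iprod_immigrants_exp[OF T F1 Ffin])
  finally show ?thesis .
qed

lemma off_law_nonneg: "0 \<le> off_law T j c"
proof -
  have "off_law T j c = prob {\<omega> \<in> space M. finite (offs [(j, 0)] T \<omega>) \<and> off_count [(j, 0)] T \<omega> = c}"
    by (subst prob_off_count) (simp_all add: comp_of_def)
  then show ?thesis by simp
qed

lemma sum_off_law_le_1: "(\<Sum>c | sum c UNIV \<le> K. off_law T j c) \<le> 1"
proof -
  have "(\<Sum>c | sum c UNIV \<le> K. ennreal (off_law T j c))
      = (\<integral>\<^sup>+\<omega>. (if finite (offs [(j, 0)] T \<omega>) \<and> card (offs [(j, 0)] T \<omega>) \<le> K then 1 else 0) \<partial>M)"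
    using nn_integral_off_count[of "[(j, 0)]" T K "\<lambda>_. 1"] by (simp add: comp_of_def)
  also have "\<dots> \<le> (\<integral>\<^sup>+\<omega>. 1 \<partial>M)" by (intro nn_integral_mono) simp
  finally show ?thesis
    by (simp add: emeasure_space_1 off_law_nonneg sum_ennreal)
qed

text \<open>The recursion for the generating function is polynomial.\<close>

lemma tree_pgf_smooth:
  assumes m: "\<And>s j. z s j = ennreal (m j s)" "\<And>j s. 0 \<le> m j s" "\<And>j s. m j differentiable (at s)"
  shows "\<exists>\<phi>. \<forall>s. tree_pgf (z s) K d j = ennreal (\<phi> s) \<and> 0 \<le> \<phi> s \<and> (\<phi> :: real \<Rightarrow> real) differentiable (at s)"
proof (induction d arbitrary: j)
  case 0
  show ?case using m by (intro exI[of _ "m j"]) simp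
next
  case (Suc d)
  then obtain \<phi> where \<phi>: "\<And>j s. tree_pgf (z s) K d j = ennreal (\<phi> j s)" "\<And>j s. 0 \<le> \<phi> j s"
      "\<And>j s. \<phi> j differentiable (at s)" by metis
  let ?C = "{c :: 'd \<Rightarrow> nat. sum c UNIV \<le> K}"
  define \<psi> where "\<psi> s = m j s * ((\<Sum>c\<in>?C. (\<Prod>l\<in>UNIV. \<phi> l s ^ c l) * off_law K j c) + (1 - (\<Sum>c\<in>?C. off_law K j c)))" for s
  have diff_prod: "(\<lambda>s. \<Prod>l\<in>A. \<phi> l s ^ c l) differentiable (at s)" if "finite A" for A c s
    using that by (induction A) (auto intro!: differentiable_mult differentiable_power \<phi>(3))
  have nn: "0 \<le> (\<Sum>c\<in>?C. (\<Prod>l\<in>UNIV. \<phi> l s ^ c l) * off_law K j c)" for s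
    by (intro sum_nonneg mult_nonneg_nonneg prod_nonneg off_law_nonneg) (simp add: \<phi>(2))
  have le1: "0 \<le> 1 - (\<Sum>c\<in>?C. off_law K j c)" using sum_off_law_le_1 by simp
  have "tree_pgf (z s) K (Suc d) j = ennreal (\<psi> s)" for s
  proof -
    have e1: "(\<Sum>c\<in>?C. (\<Prod>l\<in>UNIV. tree_pgf (z s) K d l ^ c l) * ennreal (off_law K j c))
        = ennreal (\<Sum>c\<in>?C. (\<Prod>l\<in>UNIV. \<phi> l s ^ c l) * off_law K j c)"
    proof -
      have "(\<Prod>l\<in>UNIV. tree_pgf (z s) K d l ^ c l) * ennreal (off_law K j c)
          = ennreal ((\<Prod>l\<in>UNIV. \<phi> l s ^ c l) * off_law K j c)" for c
        by (simp add: \<phi>(1,2) ennreal_power prod_ennreal ennreal_mult prod_nonneg off_law_nonneg)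
      then show ?thesis
        by (simp add: sum_ennreal mult_nonneg_nonneg prod_nonneg off_law_nonneg \<phi>(2))
    qed
    have e2: "1 - (\<Sum>c\<in>?C. ennreal (off_law K j c)) = ennreal (1 - (\<Sum>c\<in>?C. off_law K j c))"
      by (simp add: sum_ennreal off_law_nonneg ennreal_minus sum_nonneg flip: ennreal_1)
    show ?thesis
      unfolding tree_pgf.simps e1 e2 \<psi>_def m(1) using nn le1 m(2)
      by (simp add: ennreal_mult flip: ennreal_plus)
  qed
  moreover have "0 \<le> \<psi> s" for s
    unfolding \<psi>_def using nn le1 m(2) by (intro mult_nonneg_nonneg add_nonneg_nonneg)
  moreover have "\<psi> differentiable (at s)" for s
    unfolding \<psi>_def
    by (intro differentiable_mult differentiable_add differentiable_sum differentiable_const m(3) diff_prod ballI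
        finite_bounded_counts finite)
  ultimately show ?case by blast
qed

section \<open>Strict convexity of the limiting cumulant\<close>

text \<open>The positive part of a claim in the fixed component \<open>i\<close>; claims are nonnegative only almost surely.\<close>

definition claim_size :: "'e \<Rightarrow> real ^ 'e \<Rightarrow> real" where
  "claim_size i u = max 0 (u $ i)"

lemma claim_size: "0 \<le> claim_size i u" "claim_size i \<in> borel_measurable borel"
proof -
  show "0 \<le> claim_size i u" by (simp add: claim_size_def)
  have [measurable]: "(\<lambda>u :: real ^ 'e. u $ i) \<in> borel_measurable borel"
    by (rule borel_measurable_continuous_onI) (intro continuous_intros)
  show "claim_size i \<in> borel_measurable borel" unfolding claim_size_def by measurable
qed

lemma size_mgf_claim_size: "size_mgf (claim_size i) \<theta> = (\<lambda>l. claim_mgf claim_law i l \<theta>)"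
proof
  fix l
  show "size_mgf (claim_size i) \<theta> l = claim_mgf claim_law i l \<theta>"
    unfolding size_mgf_def claim_mgf_def claim_size_def
  proof (rule nn_integral_cong_AE, rule eventually_mono[OF claim_nonneg[of l]])
    fix u :: "real ^ 'e" assume "\<forall>i. 0 \<le> u $ i"
    then have "0 \<le> u $ i" by blast
    then show "ennreal (exp (\<theta> * max 0 (u $ i))) = ennreal (exp (\<theta> * u $ i))" by simp
  qed
qed

definition cluster_mgf :: "'e \<Rightarrow> real \<Rightarrow> 'd \<Rightarrow> ennreal" where
  "cluster_mgf i \<theta> j = (\<integral>\<^sup>+\<omega>. cluster_weight (size_mgf (claim_size i) \<theta>) [(j, 0)] \<omega> \<partial>M)"

text \<open>The real-valued limiting cumulant. An infinite generating function enters with the default value \<open>0\<close> of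
\<open>enn2real\<close>, so the value is meaningful only together with \<open>cumulant_finite\<close>.\<close>

definition cumulant :: "'e \<Rightarrow> real \<Rightarrow> real" where
  "cumulant i \<theta> = (\<Sum>j\<in>UNIV. base $ j * (enn2real (cluster_mgf i \<theta> j) - 1))"

definition cumulant_finite :: "'e \<Rightarrow> real \<Rightarrow> bool" where
  "cumulant_finite i \<theta> \<longleftrightarrow> (\<forall>j. 0 < base $ j \<longrightarrow> cluster_mgf i \<theta> j < \<infinity>)"

lemma cluster_mgf_ge_1:
  assumes "0 \<le> \<theta>"
  shows "1 \<le> cluster_mgf i \<theta> j"
proof -
  have "(\<integral>\<^sup>+\<omega>. 1 \<partial>M) \<le> cluster_mgf i \<theta> j"
    unfolding cluster_mgf_def
    by (intro nn_integral_mono cluster_weight_ge_1 size_mgf_ge_1 claim_size assms)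
  then show ?thesis by (simp add: emeasure_space_1)
qed

lemma nn_integral_cluster_count:
  assumes fin: "AE \<omega> in M. \<forall>v. v \<noteq> [] \<longrightarrow> finite (cluster v \<omega>)"
  shows "(\<integral>\<^sup>+\<omega>. (\<Prod>l\<in>UNIV. claim_mgf claim_law i l \<theta> ^ cluster_count X l j \<omega>) \<partial>M) = cluster_mgf i \<theta> j"
  unfolding cluster_mgf_def size_mgf_claim_size
proof (rule nn_integral_cong_AE)
  show "AE \<omega> in M. (\<Prod>l\<in>UNIV. claim_mgf claim_law i l \<theta> ^ cluster_count X l j \<omega>)
      = cluster_weight (\<lambda>l. claim_mgf claim_law i l \<theta>) [(j, 0)] \<omega>"
    using fin AE_proper
  proof eventually_elim
    case (elim \<omega>)
    have f: "finite (cluster [(j, 0)] \<omega>)" using elim(1) by simp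
    show ?case
      by (simp only: cluster_weight_eq_prod[OF elim(2) f] prod_cluster_count[OF f, where z = "\<lambda>l. claim_mgf claim_law i l \<theta>"])
  qed
qed

text \<open>A component with positive rate and infinite generating function would make the cumulant infinite, as
all summands are nonnegative.\<close>

lemma limit_cumulant_net_eq_0:
  assumes fin: "AE \<omega> in M. \<forall>v. v \<noteq> [] \<longrightarrow> finite (cluster v \<omega>)" and \<theta>: "0 \<le> \<theta>"
    and zero: "limit_cumulant_net M base claim_law X r i \<theta> = 0"
  shows "cumulant_finite i \<theta>" "cumulant i \<theta> = r * \<theta>"
proof -
  let ?F = "cluster_mgf i \<theta>"
  let ?t = "\<lambda>j. ereal (base $ j) * (enn2ereal (?F j) - 1)"
  have sum0: "(\<Sum>j\<in>UNIV. ?t j) - ereal (r * \<theta>) = 0"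
    using zero unfolding limit_cumulant_net_def limit_cumulant_def nn_integral_cluster_count[OF fin] .
  have ninf: "(\<Sum>j\<in>UNIV. ?t j) \<noteq> \<infinity>" using sum0 by auto
  show cf: "cumulant_finite i \<theta>"
    unfolding cumulant_finite_def
  proof (intro allI impI)
    fix j assume "0 < base $ j"
    show "?F j < \<infinity>"
    proof (rule ccontr)
      assume "\<not> ?F j < \<infinity>"
      then have "?F j = \<top>" by (simp add: not_less top_unique)
      then have "?t j = \<infinity>" using \<open>0 < base $ j\<close> by simp
      moreover have "(\<Sum>j\<in>UNIV. ?t j) = ?t j + (\<Sum>j\<in>UNIV - {j}. ?t j)" by (rule sum.remove) auto
      ultimately show False using ninf by simp
    qed
  qed
  have "?t j = ereal (base $ j * (enn2real (?F j) - 1))" for j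
  proof (cases "base $ j = 0")
    case False
    then have "?F j < \<infinity>" using cf base_nonneg[of j] by (auto simp: cumulant_finite_def)
    then obtain f where "?F j = ennreal f" "0 \<le> f" by (cases "?F j") auto
    then show ?thesis by (simp add: one_ereal_def enn2ereal_ennreal)
  qed (simp add: zero_ereal_def[symmetric])
  then have "ereal (cumulant i \<theta>) - ereal (r * \<theta>) = 0"
    using sum0 by (simp add: cumulant_def)
  then show "cumulant i \<theta> = r * \<theta>" by simp
qed

text \<open>Jensen's inequality for the power \<open>s\<close>. It follows by integrating the inequality
\<open>x powr s \<le> 1 + s * (x - 1)\<close> at \<open>x = exp (\<theta> * h u) / m\<close>, a variable with mean \<open>1\<close>.\<close>

lemma size_mgf_scale:
  assumes h: "\<And>u. 0 \<le> h u" "h \<in> borel_measurable borel" and s: "0 < s" "s < 1"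
    and fin: "size_mgf h \<theta> l < \<infinity>" and \<theta>: "0 \<le> \<theta>"
  shows "size_mgf h (s * \<theta>) l \<le> ennreal (enn2real (size_mgf h \<theta> l) powr s)"
proof -
  note [measurable] = h(2)
  interpret D: prob_space "claim_law l" by (rule claim_prob_space)
  obtain m where m: "size_mgf h \<theta> l = ennreal m" "0 \<le> m" using fin by (cases "size_mgf h \<theta> l") auto
  have m1: "1 \<le> m" using size_mgf_ge_1[of h \<theta> l, OF h(1) \<theta>] m by simp
  have "exp (s * \<theta> * h u) \<le> m powr s * (1 - s) + (m powr s * s / m) * exp (\<theta> * h u)" for u
  proof -
    have "(exp (\<theta> * h u) / m) powr s \<le> 1 + s * (exp (\<theta> * h u) / m - 1)"
      using m1 s by (intro powr_le_linear) auto
    then have "m powr s * ((exp (\<theta> * h u) / m) powr s) \<le> m powr s * (1 + s * (exp (\<theta> * h u) / m - 1))"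
      by (intro mult_left_mono) auto
    moreover have "m powr s * ((exp (\<theta> * h u) / m) powr s) = exp (s * \<theta> * h u)"
      using m1 by (simp add: powr_divide exp_powr_real mult_ac)
    ultimately show ?thesis by (simp add: algebra_simps)
  qed
  then have "size_mgf h (s * \<theta>) l
      \<le> (\<integral>\<^sup>+u. ennreal (m powr s * (1 - s)) + ennreal (m powr s * s / m) * ennreal (exp (\<theta> * h u)) \<partial>claim_law l)"
    unfolding size_mgf_def using s m1
    by (intro nn_integral_mono) (simp add: ennreal_mult'[symmetric] flip: ennreal_plus)
  also have "\<dots> = ennreal (m powr s * (1 - s)) + ennreal (m powr s * s / m) * size_mgf h \<theta> l"
    by (simp add: nn_integral_add nn_integral_cmult D.emeasure_space_1 size_mgf_def)
  also have "\<dots> = ennreal (m powr s * (1 - s) + m powr s * s / m * m)"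
    using s m1 by (simp add: m(1) ennreal_mult'[symmetric] flip: ennreal_plus)
  also have "m powr s * (1 - s) + m powr s * s / m * m = m powr s" using m1 by (simp add: algebra_simps)
  finally show ?thesis using m by simp
qed

text \<open>A finite product has finite factors, as no factor vanishes. Components that do not occur in the product
may thus have infinite \<open>z\<close>.\<close>

lemma prod_scale:
  fixes z z' :: "'d \<Rightarrow> ennreal"
  assumes "finite C" "\<And>j. 1 \<le> z j" "\<And>j. z j < \<infinity> \<Longrightarrow> z' j \<le> ennreal (enn2real (z j) powr s)"
    and top: "(\<Prod>w\<in>C. z (f w)) < \<infinity>"
  shows "(\<Prod>w\<in>C. z' (f w)) \<le> ennreal (enn2real (\<Prod>w\<in>C. z (f w)) powr s)"
proof -
  have f: "z (f w) < \<infinity>" if "w \<in> C" for w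
  proof (rule ccontr)
    assume "\<not> z (f w) < \<infinity>"
    then have "z (f w) = top" by (simp add: not_less top_unique)
    moreover have "z j \<noteq> 0" for j using assms(2)[of j] by auto
    ultimately have "(\<Prod>w\<in>C. z (f w)) = top" using that assms(1) by (auto simp: ennreal_prod_eq_top)
    then show False using top by simp
  qed
  have zr: "z (f w) = ennreal (enn2real (z (f w)))" if "w \<in> C" for w
    using f[OF that] by simp
  have "(\<Prod>w\<in>C. z (f w)) = (\<Prod>w\<in>C. ennreal (enn2real (z (f w))))" using zr by (intro prod.cong) auto
  also have "\<dots> = ennreal (\<Prod>w\<in>C. enn2real (z (f w)))" by (rule prod_ennreal) simp
  finally have e: "enn2real (\<Prod>w\<in>C. z (f w)) = (\<Prod>w\<in>C. enn2real (z (f w)))" by (simp add: prod_nonneg)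
  have "(\<Prod>w\<in>C. z' (f w)) \<le> (\<Prod>w\<in>C. ennreal (enn2real (z (f w)) powr s))"
    using f assms(3) by (intro prod_mono_ennreal) auto
  also have "\<dots> = ennreal (\<Prod>w\<in>C. enn2real (z (f w)) powr s)" by (rule prod_ennreal) simp
  also have "(\<Prod>w\<in>C. enn2real (z (f w)) powr s) = (\<Prod>w\<in>C. enn2real (z (f w))) powr s"
    using assms(1) by (induction C) (auto simp: powr_mult prod_nonneg)
  finally show ?thesis unfolding e .
qed

text \<open>Let \<open>Y\<close> be the weight of the cluster at \<open>\<theta>\<close>. The weight at \<open>s * \<theta>\<close> is at most \<open>Y powr s\<close>, and this is
at most \<open>1 + s * (Y - 1)\<close>, with equality only for \<open>Y = 1\<close>.\<close>

lemma cluster_mgf_scale: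
  assumes fin: "AE \<omega> in M. \<forall>v. v \<noteq> [] \<longrightarrow> finite (cluster v \<omega>)"
    and s: "0 < s" "s < 1" and \<theta>: "0 \<le> \<theta>" and F: "cluster_mgf i \<theta> j = ennreal f" "0 \<le> f"
  obtains f' where "cluster_mgf i (s * \<theta>) j = ennreal f'" "0 \<le> f'" "f' \<le> 1 + s * (f - 1)"
    "1 < f \<Longrightarrow> f' < 1 + s * (f - 1)"
proof -
  let ?z = "size_mgf (claim_size i) \<theta>" and ?z' = "size_mgf (claim_size i) (s * \<theta>)"
  have z: "1 \<le> ?z j" for j by (rule size_mgf_ge_1[OF claim_size(1) \<theta>])
  define x where "x = cluster_weight ?z [(j, 0)]"
  have [measurable]: "x \<in> borel_measurable M"
    unfolding x_def by (rule info_measurable[OF cluster_weight_info[OF z]])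
  have x1: "1 \<le> x \<omega>" for \<omega> unfolding x_def by (rule cluster_weight_ge_1[OF z])
  have xF: "(\<integral>\<^sup>+\<omega>. x \<omega> \<partial>M) = ennreal f" using F by (simp add: cluster_mgf_def x_def)
  have "AE \<omega> in M. x \<omega> \<noteq> \<infinity>" by (rule nn_integral_PInf_AE) (use xF in auto)
  then have xfin: "AE \<omega> in M. x \<omega> < \<infinity>" by eventually_elim (simp add: less_top)
  define Y where "Y \<omega> = enn2real (x \<omega>)" for \<omega>
  have [measurable]: "Y \<in> borel_measurable M" unfolding Y_def by measurable
  have xY: "AE \<omega> in M. x \<omega> = ennreal (Y \<omega>)" using xfin by eventually_elim (simp add: Y_def)
  have Y1: "AE \<omega> in M. 1 \<le> Y \<omega>" using xY
  proof eventually_elim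
    case (elim \<omega>)
    have "1 \<le> ennreal (Y \<omega>)" using x1[of \<omega>] elim by simp
    then show ?case by (simp add: ennreal_ge_1)
  qed
  have Y0: "0 \<le> Y \<omega>" for \<omega> by (simp add: Y_def)
  have EY: "(\<integral>\<^sup>+\<omega>. ennreal (Y \<omega>) \<partial>M) = ennreal f"
    using nn_integral_cong_AE[OF xY] xF by simp
  have Yint: "integrable M Y" by (rule integrableI_nn_integral_finite[OF _ _ EY]) (use Y0 in auto)
  have YE: "expectation Y = f" by (rule integral_eq_nn_integral[THEN trans]) (use Y0 EY F in auto)
  have le: "AE \<omega> in M. Y \<omega> powr s \<le> 1 + s * (Y \<omega> - 1)"
    using Y1 by eventually_elim (use s in \<open>auto intro: powr_le_linear\<close>)
  have Pint: "integrable M (\<lambda>\<omega>. Y \<omega> powr s)"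
  proof (rule Bochner_Integration.integrable_bound)
    show "integrable M (\<lambda>\<omega>. 1 + s * (Y \<omega> - 1))" using Yint by auto
    show "AE \<omega> in M. norm (Y \<omega> powr s) \<le> norm (1 + s * (Y \<omega> - 1))"
      using le by eventually_elim auto
  qed measurable
  have Eright: "expectation (\<lambda>\<omega>. 1 + s * (Y \<omega> - 1)) = 1 + s * (f - 1)"
    using Yint by (simp add: YE prob_space)
  have fin': "AE \<omega> in M. cluster_weight ?z' [(j, 0)] \<omega> \<le> ennreal (Y \<omega> powr s)"
    using fin AE_proper xfin
  proof eventually_elim
    case (elim \<omega>)
    have f: "finite (cluster [(j, 0)] \<omega>)" using elim(1) by simp
    have top: "(\<Prod>w\<in>cluster [(j, 0)] \<omega>. ?z (comp_of w)) < \<infinity>"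
      using elim(3) by (simp add: x_def cluster_weight_eq_prod[OF elim(2) f])
    show ?case
      unfolding Y_def x_def cluster_weight_eq_prod[OF elim(2) f]
      by (rule prod_scale[OF f z size_mgf_scale[OF claim_size s _ \<theta>] top])
  qed
  then have "cluster_mgf i (s * \<theta>) j \<le> (\<integral>\<^sup>+\<omega>. ennreal (Y \<omega> powr s) \<partial>M)"
    unfolding cluster_mgf_def by (rule nn_integral_mono_AE)
  also have "\<dots> = ennreal (expectation (\<lambda>\<omega>. Y \<omega> powr s))"
    by (rule nn_integral_eq_integral[OF Pint]) simp
  finally have b: "cluster_mgf i (s * \<theta>) j \<le> ennreal (expectation (\<lambda>\<omega>. Y \<omega> powr s))" .
  have le': "expectation (\<lambda>\<omega>. Y \<omega> powr s) \<le> 1 + s * (f - 1)"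
    unfolding Eright[symmetric] using Yint by (intro integral_mono_AE Pint le) auto
  have strict: "expectation (\<lambda>\<omega>. Y \<omega> powr s) < 1 + s * (f - 1)" if "1 < f"
  proof (rule ccontr)
    assume "\<not> expectation (\<lambda>\<omega>. Y \<omega> powr s) < 1 + s * (f - 1)"
    then have "expectation (\<lambda>\<omega>. (1 + s * (Y \<omega> - 1)) - Y \<omega> powr s) = 0"
      using le' Eright Yint Pint by (subst Bochner_Integration.integral_diff) auto
    moreover have "integrable M (\<lambda>\<omega>. (1 + s * (Y \<omega> - 1)) - Y \<omega> powr s)" using Yint Pint by auto
    moreover have "AE \<omega> in M. 0 \<le> (1 + s * (Y \<omega> - 1)) - Y \<omega> powr s" using le by eventually_elim simp
    ultimately have "AE \<omega> in M. (1 + s * (Y \<omega> - 1)) - Y \<omega> powr s = 0"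
      by (simp only: integral_nonneg_eq_0_iff_AE)
    then have "AE \<omega> in M. Y \<omega> = 1" using Y1
    proof eventually_elim
      case (elim \<omega>)
      then show ?case using powr_less_linear[of "Y \<omega>" s] s by (cases "Y \<omega> = 1") auto
    qed
    then have "expectation Y = expectation (\<lambda>_. 1)" by (intro integral_cong_AE) auto
    then show False using YE that by (simp add: prob_space)
  qed
  have bfin: "cluster_mgf i (s * \<theta>) j < \<infinity>"
    using b by (rule le_less_trans) simp
  define f' where "f' = enn2real (cluster_mgf i (s * \<theta>) j)"
  have f': "cluster_mgf i (s * \<theta>) j = ennreal f'" "0 \<le> f'" using bfin by (simp_all add: f'_def)
  have "0 \<le> expectation (\<lambda>\<omega>. Y \<omega> powr s)" by (rule integral_nonneg_AE) simp
  then have "f' \<le> expectation (\<lambda>\<omega>. Y \<omega> powr s)" using b f' by simp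
  then show ?thesis using that[OF f'] le' strict by linarith
qed

text \<open>Convexity on the segment from \<open>0\<close>, where the cumulant vanishes, to \<open>\<theta>\<close>. It is strict as soon as a
component with positive rate has a cluster weight other than \<open>1\<close>.\<close>

lemma cumulant_scale:
  assumes fin: "AE \<omega> in M. \<forall>v. v \<noteq> [] \<longrightarrow> finite (cluster v \<omega>)"
    and s: "0 < s" "s < 1" and \<theta>: "0 \<le> \<theta>" and cf: "cumulant_finite i \<theta>"
  shows "cumulant_finite i (s * \<theta>)" "cumulant i (s * \<theta>) \<le> s * cumulant i \<theta>"
    "0 < cumulant i \<theta> \<Longrightarrow> cumulant i (s * \<theta>) < s * cumulant i \<theta>"
proof -
  let ?f = "\<lambda>j. enn2real (cluster_mgf i \<theta> j)" and ?f' = "\<lambda>j. enn2real (cluster_mgf i (s * \<theta>) j)"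
  have *: "cluster_mgf i (s * \<theta>) j < \<infinity> \<and> ?f' j \<le> 1 + s * (?f j - 1) \<and> (1 < ?f j \<longrightarrow> ?f' j < 1 + s * (?f j - 1))"
    if "0 < base $ j" for j
  proof -
    have "cluster_mgf i \<theta> j = ennreal (?f j)" using cf that by (simp add: cumulant_finite_def)
    then obtain f' where "cluster_mgf i (s * \<theta>) j = ennreal f'" "0 \<le> f'" "f' \<le> 1 + s * (?f j - 1)"
        "1 < ?f j \<Longrightarrow> f' < 1 + s * (?f j - 1)"
      by (rule cluster_mgf_scale[OF fin s \<theta>, of i j "?f j"]) auto
    then show ?thesis by simp
  qed
  then show "cumulant_finite i (s * \<theta>)" by (simp add: cumulant_finite_def)
  have summand: "base $ j * (?f' j - 1) \<le> s * (base $ j * (?f j - 1))" for j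
  proof (cases "base $ j = 0")
    case False
    then have "0 < base $ j" using base_nonneg[of j] by auto
    then have "base $ j * (?f' j - 1) \<le> base $ j * (s * (?f j - 1))" using *[of j] by (intro mult_left_mono) auto
    then show ?thesis by (simp add: mult.left_commute)
  qed simp
  show "cumulant i (s * \<theta>) \<le> s * cumulant i \<theta>"
    unfolding cumulant_def sum_distrib_left by (intro sum_mono summand)
  show "cumulant i (s * \<theta>) < s * cumulant i \<theta>" if pos: "0 < cumulant i \<theta>"
  proof -
    obtain j where j: "0 < base $ j * (?f j - 1)"
      using pos unfolding cumulant_def by (meson not_less sum_nonpos)
    then have bj: "0 < base $ j" "1 < ?f j"
      using base_nonneg[of j] by (auto simp: zero_less_mult_iff)
    then have "base $ j * (?f' j - 1) < base $ j * (s * (?f j - 1))"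
      using *[of j] by (intro mult_strict_left_mono) auto
    then have "base $ j * (?f' j - 1) < s * (base $ j * (?f j - 1))" by (simp add: mult.left_commute)
    then show ?thesis
      unfolding cumulant_def sum_distrib_left using summand by (intro sum_strict_mono_ex1) auto
  qed
qed

section \<open>Upper bound for the ruin probability\<close>

lemma aggregate_claims_mono:
  assumes "s \<le> t"
  shows "aggregate_claims X U i s \<omega> \<le> aggregate_claims X U i t \<omega>"
proof -
  have "hawkes_count X j s \<omega> \<le> hawkes_count X j t \<omega>" for j
    unfolding hawkes_count_eq
  proof (rule emeasure_mono)
    have "events_upto s \<omega> \<subseteq> events_upto t \<omega>"
      unfolding events_upto_def using assms by (auto intro: order_trans)
    then show "{v \<in> events_upto s \<omega>. comp_of v = j} \<subseteq> {v \<in> events_upto t \<omega>. comp_of v = j}" by blast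
  qed simp
  then show ?thesis
    unfolding aggregate_claims_def
    by (intro sum_mono suminf_le) (auto intro: less_le_trans)
qed

lemma net_claims_measurable: "(\<lambda>\<omega>. net_claims X U r i t \<omega>) \<in> borel_measurable M"
proof -
  note [measurable] = hawkes_count_measurable claim_measurable
  have [measurable]: "(\<lambda>u :: real ^ 'e. u $ i) \<in> borel_measurable borel"
    by (rule borel_measurable_continuous_onI) (intro continuous_intros)
  show ?thesis unfolding net_claims_def aggregate_claims_def by measurable
qed

lemma ruin_time_less_iff: "ruin_time X U r i u \<omega> < \<infinity> \<longleftrightarrow> (\<exists>t>0. ereal u < net_claims X U r i t \<omega>)"
  unfolding ruin_time_def Inf_less_iff by auto

text \<open>Claims accumulate in time, and the premium up to a slightly later time differs by little.\<close>

lemma ruin_at_rational_time: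
  assumes r: "0 < r" and t: "0 < t" "ereal u < net_claims X U r i t \<omega>"
  shows "\<exists>q::rat. 0 < real_of_rat q \<and> ereal u < net_claims X U r i (real_of_rat q) \<omega>"
proof -
  let ?A = "\<lambda>t. enn2ereal (aggregate_claims X U i t \<omega>)"
  \<comment> \<open>By the time \<open>\<delta>\<close> later the additional premium has used up the excess over \<open>u\<close>.\<close>
  define \<delta> where "\<delta> = (if ?A t = \<infinity> then 1 else (real_of_ereal (?A t) - u - r * t) / r)"
  have fin: "?A t \<noteq> \<infinity> \<Longrightarrow> \<exists>a. ?A t = ereal a"
    using enn2ereal_nonneg[of "aggregate_claims X U i t \<omega>"] by (cases "?A t") auto
  have "0 < \<delta>"
  proof (cases "?A t = \<infinity>")
    case False
    then obtain a where "?A t = ereal a" using fin by blast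
    then show ?thesis using t r by (auto simp: \<delta>_def net_claims_def)
  qed (simp add: \<delta>_def)
  then obtain q where q: "t < real_of_rat q" "real_of_rat q < t + \<delta>"
    using of_rat_dense[of t "t + \<delta>"] by auto
  have mono: "?A t \<le> ?A (real_of_rat q)"
    using aggregate_claims_mono[of t "real_of_rat q"] q by (simp add: less_eq_ennreal.rep_eq)
  have "ereal u < net_claims X U r i (real_of_rat q) \<omega>"
  proof (cases "?A t = \<infinity>")
    case True
    then have "?A (real_of_rat q) = \<infinity>" using mono by simp
    then show ?thesis by (simp add: net_claims_def)
  next
    case False
    then obtain a where a: "?A t = ereal a" using fin by blast
    have lt: "r * real_of_rat q < r * (t + \<delta>)" using q r by simp
    have "r * \<delta> = a - u - r * t" using r a by (simp add: \<delta>_def)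
    then have "r * (t + \<delta>) = a - u" by (simp add: distrib_left)
    then have "u < a - r * real_of_rat q" using lt by simp
    then have "ereal u < ereal a - ereal (r * real_of_rat q)" by simp
    also have "\<dots> \<le> ?A (real_of_rat q) - ereal (r * real_of_rat q)"
      using mono a by (intro ereal_minus_mono) auto
    finally show ?thesis by (simp add: net_claims_def)
  qed
  moreover have "0 < real_of_rat q" by (rule less_trans[OF t(1) q(1)])
  ultimately show ?thesis by blast
qed

text \<open>Ruin is a countable union of events, over rational times.\<close>

lemma ruin_event_measurable:
  assumes "0 < r"
  shows "{\<omega> \<in> space M. ruin_time X U r i u \<omega> < \<infinity>} \<in> events"
proof -
  have eq: "{\<omega> \<in> space M. ruin_time X U r i u \<omega> < \<infinity>}
      = {\<omega> \<in> space M. \<exists>q::rat. 0 < real_of_rat q \<and> ereal u < net_claims X U r i (real_of_rat q) \<omega>}"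
    unfolding ruin_time_less_iff using ruin_at_rational_time[OF assms] by blast
  note [measurable] = net_claims_measurable
  show ?thesis unfolding eq by measurable
qed

lemma aggregate_claims_eq:
  assumes "finite (events_upto t \<omega>)"
  shows "aggregate_claims X U i t \<omega> = ennreal (claim_total (claim_size i) (event_counts (events_upto t \<omega>)) \<omega>)"
proof -
  have "(\<Sum>r. if of_nat r < hawkes_count X j t \<omega> then ennreal (U j r \<omega> $ i) else 0)
      = ennreal (\<Sum>r<event_counts (events_upto t \<omega>) j. claim_size i (U j r \<omega>))" for j
  proof -
    have "hawkes_count X j t \<omega> = of_nat (event_counts (events_upto t \<omega>) j)"
      unfolding hawkes_count_eq event_counts_def using assms by (subst emeasure_count_space_finite) auto
    then have "(\<Sum>r. if of_nat r < hawkes_count X j t \<omega> then ennreal (U j r \<omega> $ i) else 0)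
        = (\<Sum>r. if r < event_counts (events_upto t \<omega>) j then ennreal (U j r \<omega> $ i) else 0)" by simp
    also have "\<dots> = (\<Sum>r<event_counts (events_upto t \<omega>) j. if r < event_counts (events_upto t \<omega>) j then ennreal (U j r \<omega> $ i) else 0)"
      by (rule suminf_finite) auto
    also have "\<dots> = (\<Sum>r<event_counts (events_upto t \<omega>) j. ennreal (claim_size i (U j r \<omega>)))"
      by (rule sum.cong) (auto simp: claim_size_def ennreal_neg max_def)
    finally show ?thesis by (simp add: sum_ennreal claim_size)
  qed
  then show ?thesis
    unfolding aggregate_claims_def claim_total_def by (simp add: sum_ennreal sum_nonneg claim_size)
qed

lemma claim_total_mono:
  assumes "\<And>j. n j \<le> n' j" "\<And>u. 0 \<le> h' u" "\<And>u. h u \<le> h' u"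
  shows "claim_total h n \<omega> \<le> claim_total h' n' \<omega>"
  unfolding claim_total_def
proof (rule sum_mono)
  fix j
  have "(\<Sum>r<n j. h (U j r \<omega>)) \<le> (\<Sum>r<n j. h' (U j r \<omega>))" by (intro sum_mono assms)
  also have "\<dots> \<le> (\<Sum>r<n' j. h' (U j r \<omega>))" using assms by (intro sum_mono2) auto
  finally show "(\<Sum>r<n j. h (U j r \<omega>)) \<le> (\<Sum>r<n' j. h' (U j r \<omega>))" .
qed

lemma event_counts_mono: "finite S' \<Longrightarrow> S \<subseteq> S' \<Longrightarrow> event_counts S j \<le> event_counts S' j"
  unfolding event_counts_def by (intro card_mono) auto

lemma AE_finite_all_events_upto:
  assumes fin: "AE \<omega> in M. \<forall>v. v \<noteq> [] \<longrightarrow> finite (cluster v \<omega>)"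
  shows "AE \<omega> in M. \<forall>t. finite (events_upto t \<omega>)"
proof -
  have "AE \<omega> in M. \<forall>n::nat. finite (events_upto (real n) \<omega>)"
    unfolding AE_all_countable using AE_finite_events_upto[OF fin] by simp
  then show ?thesis
  proof eventually_elim
    case (elim \<omega>)
    show ?case
    proof
      fix t
      obtain n where n: "t \<le> real n" using real_arch_simple by blast
      have "events_upto t \<omega> \<subseteq> events_upto (real n) \<omega>"
        unfolding events_upto_def using n by (auto intro: order_trans)
      then show "finite (events_upto t \<omega>)" using elim finite_subset by blast
    qed
  qed
qed

text \<open>Ruin between the times \<open>n\<close> and \<open>n + 1\<close> implies that the total claims at \<open>n + 1\<close> exceed \<open>u + r * n\<close>. By the
Markov inequality this has probability at most \<open>exp (- \<theta> * u) * exp lam * q ^ n\<close>, where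
\<open>q = exp (lam - r * \<theta>) < 1\<close>.\<close>

lemma ruin_prob_le:
  assumes fin: "AE \<omega> in M. \<forall>v. v \<noteq> [] \<longrightarrow> finite (cluster v \<omega>)"
    and r: "0 < r" and \<theta>: "0 < \<theta>" and cf: "cumulant_finite i \<theta>" and less: "cumulant i \<theta> < r * \<theta>"
  obtains C where "0 < C" "\<And>u. 0 < u \<Longrightarrow> ruin_prob M X U r i u \<le> C * exp (- \<theta> * u)"
proof -
  define lam where "lam = cumulant i \<theta>"
  define q where "q = exp (lam - r * \<theta>)"
  have q: "0 < q" "q < 1" using less by (auto simp: q_def lam_def)
  define C where "C = exp lam / (1 - q)"
  let ?Z = "\<lambda>t \<omega>. claim_total (claim_size i) (event_counts (events_upto t \<omega>)) \<omega>"
  have Zm: "?Z t \<in> borel_measurable M" for t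
    by (rule claim_total_measurable[OF pred_events_upto claim_size(2)])
  note [measurable] = Zm
  have Zmgf: "(\<integral>\<^sup>+\<omega>. ennreal (exp (\<theta> * ?Z t \<omega>)) \<partial>M) \<le> ennreal (exp (t * lam))" if "0 \<le> t" for t
    unfolding lam_def cumulant_def
    using nn_integral_exp_claims_le[OF fin claim_size _ that cluster_mgf_def[symmetric], of \<theta> i] cf \<theta>
    by (auto simp: cumulant_finite_def)
  have bound: "ruin_prob M X U r i u \<le> C * exp (- \<theta> * u)" if u: "0 < u" for u
  proof -
    define E where "E n = {\<omega> \<in> space M. u + r * real n \<le> ?Z (real (Suc n)) \<omega>}" for n
    have [measurable]: "E n \<in> events" for n unfolding E_def by measurable
    have EE: "emeasure M (E n) \<le> ennreal (exp (- \<theta> * u) * exp lam * q ^ n)" for n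
    proof -
      have "emeasure M (E n) = (\<integral>\<^sup>+\<omega>. indicator (E n) \<omega> \<partial>M)" by simp
      also have "\<dots> \<le> (\<integral>\<^sup>+\<omega>. ennreal (exp (- \<theta> * (u + r * real n))) * ennreal (exp (\<theta> * ?Z (real (Suc n)) \<omega>)) \<partial>M)"
      proof (rule nn_integral_mono)
        fix \<omega>
        show "indicator (E n) \<omega> \<le> ennreal (exp (- \<theta> * (u + r * real n))) * ennreal (exp (\<theta> * ?Z (real (Suc n)) \<omega>))"
        proof (cases "\<omega> \<in> E n")
          case True
          then have "\<theta> * (u + r * real n) \<le> \<theta> * ?Z (real (Suc n)) \<omega>"
            using \<theta> by (intro mult_left_mono) (auto simp: E_def)
          then have "1 \<le> exp (- \<theta> * (u + r * real n)) * exp (\<theta> * ?Z (real (Suc n)) \<omega>)"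
            by (simp add: exp_add[symmetric])
          then show ?thesis using True by (simp add: ennreal_mult'[symmetric] ennreal_ge_1 del: mult_minus_left)
        qed simp
      qed
      also have "\<dots> = ennreal (exp (- \<theta> * (u + r * real n))) * (\<integral>\<^sup>+\<omega>. ennreal (exp (\<theta> * ?Z (real (Suc n)) \<omega>)) \<partial>M)"
        by (rule nn_integral_cmult) measurable
      also have "\<dots> \<le> ennreal (exp (- \<theta> * (u + r * real n))) * ennreal (exp (real (Suc n) * lam))"
        by (intro mult_left_mono Zmgf) auto
      also have "\<dots> = ennreal (exp (- \<theta> * u) * exp lam * q ^ n)"
        by (simp add: ennreal_mult'[symmetric] q_def exp_add[symmetric] exp_of_nat_mult[symmetric] algebra_simps
            del: mult_minus_left)
      finally show ?thesis .
    qed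
    have "emeasure M {\<omega> \<in> space M. ruin_time X U r i u \<omega> < \<infinity>} \<le> emeasure M (\<Union>n. E n)"
    proof (rule emeasure_mono_AE)
      show "AE \<omega> in M. \<omega> \<in> {\<omega> \<in> space M. ruin_time X U r i u \<omega> < \<infinity>} \<longrightarrow> \<omega> \<in> (\<Union>n. E n)"
        using AE_finite_all_events_upto[OF fin]
      proof eventually_elim
        case (elim \<omega>)
        show ?case
        proof
          assume *: "\<omega> \<in> {\<omega> \<in> space M. ruin_time X U r i u \<omega> < \<infinity>}"
          then have \<omega>: "\<omega> \<in> space M" by blast
          have "ruin_time X U r i u \<omega> < \<infinity>" using * by blast
          then obtain t where t: "0 < t" "ereal u < net_claims X U r i t \<omega>"
            unfolding ruin_time_less_iff by blast
          have Z0: "0 \<le> ?Z t \<omega>" unfolding claim_total_def by (intro sum_nonneg claim_size)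
          have u: "u < ?Z t \<omega> - r * t"
            using t(2) Z0 elim by (simp add: net_claims_def aggregate_claims_eq enn2ereal_ennreal)
          define n where "n = nat \<lfloor>t\<rfloor>"
          have n: "real n \<le> t" "t \<le> real (Suc n)" using t(1) by (auto simp: n_def) linarith
          have "events_upto t \<omega> \<subseteq> events_upto (real (Suc n)) \<omega>"
            unfolding events_upto_def using n by (auto intro: order_trans)
          then have "?Z t \<omega> \<le> ?Z (real (Suc n)) \<omega>"
            using elim by (intro claim_total_mono event_counts_mono claim_size order_refl) auto
          moreover have "r * real n \<le> r * t" using n r by simp
          ultimately have "\<omega> \<in> E n" using u \<omega> by (simp add: E_def)
          then show "\<omega> \<in> (\<Union>n. E n)" by blast
        qed
      qed
    qed measurable
    also have "\<dots> \<le> (\<Sum>n. emeasure M (E n))"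
      by (rule emeasure_subadditive_countably) auto
    also have "\<dots> \<le> (\<Sum>n. ennreal (exp (- \<theta> * u) * exp lam * q ^ n))"
      by (intro suminf_le EE) auto
    also have "\<dots> = ennreal (exp (- \<theta> * u) * exp lam * (1 / (1 - q)))"
      using q by (intro suminf_ennreal_eq sums_mult geometric_sums) auto
    also have "\<dots> = ennreal (C * exp (- \<theta> * u))" by (simp add: C_def mult.commute)
    finally show ?thesis
      unfolding ruin_prob_def emeasure_eq_measure
      by (subst (asm) ennreal_le_iff) (use q in \<open>auto simp: C_def\<close>)
  qed
  show ?thesis using q by (intro that[of C] bound) (auto simp: C_def)
qed

section \<open>Lower bound for the ruin probability\<close>

text \<open>Claim sizes are approximated from below by simple functions, whose moment generating functions are
finite sums of exponentials.\<close>

lemma claim_size_approx: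
  obtains h :: "nat \<Rightarrow> real ^ 'e \<Rightarrow> real" where
    "\<And>n u. 0 \<le> h n u" "\<And>n u. h n u \<le> claim_size i u" "\<And>n. h n \<in> borel_measurable borel"
    "\<And>n. finite (range (h n))" "\<And>l \<theta>. 0 \<le> \<theta> \<Longrightarrow> (\<lambda>n. size_mgf (h n) \<theta> l) \<longlonglongrightarrow> size_mgf (claim_size i) \<theta> l"
proof -
  have "(\<lambda>u. ennreal (claim_size i u)) \<in> borel_measurable borel"
    by (rule measurable_compose[OF claim_size(2) measurable_ennreal])
  then obtain f where f: "\<And>n. simple_function borel (f n)" "incseq f" "\<And>n x. f n x < top"
      "\<And>x. (SUP n. f n x) = ennreal (claim_size i x)"
    by (rule borel_measurable_implies_simple_function_sequence') auto
  define h where "h n u = enn2real (f n u)" for n u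
  have f_eq: "f n u = ennreal (h n u)" for n u using f(3)[of n u] by (simp add: h_def)
  have h_nonneg: "0 \<le> h n u" for n u by (simp add: h_def)
  have h_le: "h n u \<le> claim_size i u" for n u
  proof -
    have "f n u \<le> (SUP n. f n u)" by (rule SUP_upper) simp
    then have "f n u \<le> ennreal (claim_size i u)" by (simp only: f(4))
    then show ?thesis by (simp add: f_eq claim_size)
  qed
  have h_meas: "h n \<in> borel_measurable borel" for n
    unfolding h_def using borel_measurable_simple_function[OF f(1)] by measurable
  have h_mono: "h m u \<le> h n u" if "m \<le> n" for m n u
  proof -
    have "f m u \<le> f n u" using f(2) that by (simp add: incseq_def le_fun_def)
    then show ?thesis by (simp add: f_eq h_nonneg)
  qed
  have "(\<lambda>n. f n u) \<longlonglongrightarrow> ennreal (claim_size i u)" for u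
    unfolding f(4)[symmetric] using f(2) by (intro LIMSEQ_SUP) (simp add: incseq_def le_fun_def)
  then have h_lim: "(\<lambda>n. h n u) \<longlonglongrightarrow> claim_size i u" for u
    unfolding f_eq by (subst (asm) tendsto_ennreal_iff) (auto simp: h_nonneg claim_size)
  have lim: "(\<lambda>n. size_mgf (h n) \<theta> l) \<longlonglongrightarrow> size_mgf (claim_size i) \<theta> l" if \<theta>: "0 \<le> \<theta>" for l \<theta>
    unfolding size_mgf_def
  proof (rule nn_integral_LIMSEQ)
    show "incseq (\<lambda>n u. ennreal (exp (\<theta> * h n u)))"
      using \<theta> h_mono by (auto simp: incseq_def le_fun_def intro!: ennreal_leI mult_left_mono)
    show "(\<lambda>u. ennreal (exp (\<theta> * h n u))) \<in> borel_measurable (claim_law l)" for n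
      using h_meas[of n] by measurable
    show "(\<lambda>n. ennreal (exp (\<theta> * h n u))) \<longlonglongrightarrow> ennreal (exp (\<theta> * claim_size i u))" for u
      by (intro tendsto_intros h_lim)
  qed
  have "finite (range (h n))" for n
  proof -
    have "finite (range (f n))" using f(1)[of n] by (simp add: simple_function_def)
    moreover have "range (h n) = enn2real ` range (f n)" by (auto simp: h_def image_image)
    ultimately show ?thesis by simp
  qed
  then show ?thesis by (intro that[OF h_nonneg h_le h_meas _ lim])
qed

lemma size_mgf_finite_range:
  assumes "finite (range h)" "h \<in> borel_measurable borel"
  obtains m :: "'d \<Rightarrow> real \<Rightarrow> real" where "\<And>s j. size_mgf h s j = ennreal (m j s)" "\<And>j s. 0 \<le> m j s"
    "\<And>j s. m j differentiable (at s)"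
proof -
  note [measurable] = assms(2)
  define c where "c j y = measure (claim_law j) (h -` {y})" for j y
  define m where "m j s = (\<Sum>y\<in>range h. exp (s * y) * c j y)" for j s
  have "size_mgf h s j = ennreal (m j s)" for s j
  proof -
    interpret D: prob_space "claim_law j" by (rule claim_prob_space)
    have space: "space (claim_law j) = UNIV" using sets_eq_imp_space_eq[OF sets_claim_law] by simp
    have [measurable, simp]: "h -` {y} \<in> sets borel" for y
      using measurable_sets[OF assms(2), of "{y}"] by simp
    have "size_mgf h s j = (\<integral>\<^sup>+u. (\<Sum>y\<in>range h. ennreal (exp (s * y)) * indicator (h -` {y}) u) \<partial>claim_law j)"
      unfolding size_mgf_def
    proof (rule nn_integral_cong)
      fix u
      have "(\<Sum>y\<in>range h. ennreal (exp (s * y)) * indicator (h -` {y}) u)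
          = (\<Sum>y\<in>range h. if y = h u then ennreal (exp (s * y)) else 0)"
        by (intro sum.cong) (auto simp: indicator_def)
      also have "\<dots> = ennreal (exp (s * h u))" using assms(1) by (subst sum.delta) auto
      finally show "ennreal (exp (s * h u)) = (\<Sum>y\<in>range h. ennreal (exp (s * y)) * indicator (h -` {y}) u)" ..
    qed
    also have "\<dots> = (\<Sum>y\<in>range h. ennreal (exp (s * y)) * emeasure (claim_law j) (h -` {y}))"
      by (subst nn_integral_sum) (auto simp: nn_integral_cmult)
    also have "\<dots> = (\<Sum>y\<in>range h. ennreal (exp (s * y) * c j y))"
      by (simp add: D.emeasure_eq_measure c_def ennreal_mult)
    also have "\<dots> = ennreal (m j s)" unfolding m_def by (rule sum_ennreal) (simp add: c_def)
    finally show ?thesis .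
  qed
  moreover have "0 \<le> m j s" for j s unfolding m_def c_def by (intro sum_nonneg) simp
  moreover have "m j differentiable (at s)" for j s
  proof -
    have "(\<lambda>s. exp (s * y) * c j y) differentiable (at s)" for y
      unfolding real_differentiable_def by (rule exI, (rule derivative_eq_intros refl)+)
    then show ?thesis unfolding m_def by (intro differentiable_sum assms(1) ballI)
  qed
  ultimately show ?thesis by (rule that)
qed

text \<open>Fatou's lemma along the diagonal, where the truncation of the clusters and the approximation of the
claim sizes are refined simultaneously: on a finite cluster the truncated weights converge to the full
weight. The constant \<open>c\<close> may be exceeded by an infinite sum.\<close>

lemma truncated_cumulant_exceeds:
  assumes fin: "AE \<omega> in M. \<forall>v. v \<noteq> [] \<longrightarrow> finite (cluster v \<omega>)"
    and \<theta>: "0 \<le> \<theta>" and c: "ennreal c < (\<Sum>j\<in>UNIV. ennreal (base $ j) * cluster_mgf i \<theta> j)"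
  obtains h :: "real ^ 'e \<Rightarrow> real" and n :: nat where "\<And>u. 0 \<le> h u" "\<And>u. h u \<le> claim_size i u" "h \<in> borel_measurable borel"
    "finite (range h)" "ennreal c < (\<Sum>j\<in>UNIV. ennreal (base $ j) * tree_pgf (size_mgf h \<theta>) n n j)"
proof -
  obtain h :: "nat \<Rightarrow> real ^ 'e \<Rightarrow> real" where h: "\<And>n u. 0 \<le> h n u" "\<And>n u. h n u \<le> claim_size i u"
      "\<And>n. h n \<in> borel_measurable borel" "\<And>n. finite (range (h n))"
      "\<And>l. (\<lambda>n. size_mgf (h n) \<theta> l) \<longlonglongrightarrow> size_mgf (claim_size i) \<theta> l"
    by (rule claim_size_approx[of i]) (use \<theta> in blast)
  let ?z = "\<lambda>n. size_mgf (h n) \<theta>" and ?zz = "size_mgf (claim_size i) \<theta>"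
  have z: "1 \<le> ?z n j" for n j by (rule size_mgf_ge_1[OF h(1) \<theta>])
  have zz: "1 \<le> ?zz j" for j by (rule size_mgf_ge_1[OF claim_size(1) \<theta>])
  have [measurable]: "tree_weight (?z n) n n v \<in> borel_measurable M" for n v
    by (rule info_measurable[OF tree_weight_info[OF z]])
  have [measurable]: "cluster_weight ?zz v \<in> borel_measurable M" for v
    by (rule info_measurable[OF cluster_weight_info[OF zz]])
  let ?T = "\<lambda>n \<omega>. \<Sum>j\<in>UNIV. ennreal (base $ j) * tree_weight (?z n) n n [(j, 0)] \<omega>"
  have "(\<Sum>j\<in>UNIV. ennreal (base $ j) * cluster_mgf i \<theta> j)
      = (\<integral>\<^sup>+\<omega>. (\<Sum>j\<in>UNIV. ennreal (base $ j) * cluster_weight ?zz [(j, 0)] \<omega>) \<partial>M)"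
    unfolding cluster_mgf_def by (simp add: nn_integral_sum nn_integral_cmult)
  also have "\<dots> = (\<integral>\<^sup>+\<omega>. liminf (\<lambda>n. ?T n \<omega>) \<partial>M)"
  proof (rule nn_integral_cong_AE)
    show "AE \<omega> in M. (\<Sum>j\<in>UNIV. ennreal (base $ j) * cluster_weight ?zz [(j, 0)] \<omega>) = liminf (\<lambda>n. ?T n \<omega>)"
      using fin AE_proper
    proof eventually_elim
      case (elim \<omega>)
      have "(\<lambda>n. tree_weight (?z n) n n [(j, 0)] \<omega>) \<longlonglongrightarrow> cluster_weight ?zz [(j, 0)] \<omega>" for j
      proof -
        have f: "finite (cluster [(j, 0)] \<omega>)" using elim(1) by simp
        have "(\<lambda>n. \<Prod>w\<in>cluster [(j, 0)] \<omega>. ?z n (comp_of w)) \<longlonglongrightarrow> (\<Prod>w\<in>cluster [(j, 0)] \<omega>. ?zz (comp_of w))"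
          by (rule tendsto_prod_ennreal_ge_1[OF f h(5) zz])
        moreover have "\<forall>\<^sub>F n in sequentially. tree_weight (?z n) n n [(j, 0)] \<omega> = (\<Prod>w\<in>cluster [(j, 0)] \<omega>. ?z n (comp_of w))"
          using tree_eventually_cluster[OF elim(2) f] by eventually_elim (simp add: tree_weight_def)
        ultimately show ?thesis
          unfolding cluster_weight_eq_prod[OF elim(2) f] by (subst tendsto_cong)
      qed
      then have "(\<lambda>n. ?T n \<omega>) \<longlonglongrightarrow> (\<Sum>j\<in>UNIV. ennreal (base $ j) * cluster_weight ?zz [(j, 0)] \<omega>)"
        by (intro tendsto_sum ennreal_tendsto_cmult) simp_all
      then show ?case by (intro lim_imp_Liminf[symmetric]) simp_all
    qed
  qed
  also have "\<dots> \<le> liminf (\<lambda>n. \<integral>\<^sup>+\<omega>. ?T n \<omega> \<partial>M)"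
    by (rule nn_integral_liminf) measurable
  also have "(\<lambda>n. \<integral>\<^sup>+\<omega>. ?T n \<omega> \<partial>M) = (\<lambda>n. \<Sum>j\<in>UNIV. ennreal (base $ j) * tree_pgf (?z n) n n j)"
    by (rule ext) (simp add: nn_integral_sum nn_integral_cmult nn_integral_tree_weight[OF z] comp_of_def)
  finally have "ennreal c < liminf (\<lambda>n. \<Sum>j\<in>UNIV. ennreal (base $ j) * tree_pgf (?z n) n n j)"
    using c by (rule less_le_trans[rotated])
  then have "\<forall>\<^sub>F n in sequentially. ennreal c < (\<Sum>j\<in>UNIV. ennreal (base $ j) * tree_pgf (?z n) n n j)"
    by (rule less_LiminfD)
  then obtain n where "ennreal c < (\<Sum>j\<in>UNIV. ennreal (base $ j) * tree_pgf (?z n) n n j)"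
    unfolding eventually_sequentially by blast
  then show ?thesis by (intro that[of "h n" n] h)
qed

text \<open>At the time \<open>T\<close> the truncated total exceeds \<open>(a - \<epsilon>) * T\<close> with probability about
\<open>exp (T * (L s - s * (a + \<epsilon>)))\<close>, where \<open>L s \<ge> r * s\<close>. The time \<open>T\<close> is chosen such that
\<open>(a - \<epsilon>) * T\<close> covers \<open>u\<close>, the premium up to \<open>T\<close>, and the premium during the additional time \<open>n * n\<close>
that the truncated clusters need to unfold.\<close>

lemma ruin_prob_ge:
  assumes fin: "AE \<omega> in M. \<forall>v. v \<noteq> [] \<longrightarrow> finite (cluster v \<omega>)"
    and r: "0 < r" and \<theta>: "0 < \<theta>" and \<eta>: "0 < \<eta>"
    and above: "ennreal (r * \<theta> + (\<Sum>j\<in>UNIV. base $ j)) < (\<Sum>j\<in>UNIV. ennreal (base $ j) * cluster_mgf i \<theta> j)"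
  shows "\<forall>\<^sub>F u in at_top. exp (- (\<theta> + \<eta>) * u) \<le> ruin_prob M X U r i u"
proof -
  obtain h :: "real ^ 'e \<Rightarrow> real" and n :: nat where h: "\<And>u. 0 \<le> h u" "\<And>u. h u \<le> claim_size i u" "h \<in> borel_measurable borel"
    "finite (range h)" and big: "ennreal (r * \<theta> + (\<Sum>j\<in>UNIV. base $ j))
      < (\<Sum>j\<in>UNIV. ennreal (base $ j) * tree_pgf (size_mgf h \<theta>) n n j)"
    by (rule truncated_cumulant_exceeds[OF fin less_imp_le[OF \<theta>] above]) blast
  obtain m :: "'d \<Rightarrow> real \<Rightarrow> real" where m: "\<And>s j. size_mgf h s j = ennreal (m j s)" "\<And>j s. 0 \<le> m j s"
    "\<And>j s. m j differentiable (at s)" by (rule size_mgf_finite_range[OF h(4,3)]) blast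
  obtain \<phi> :: "'d \<Rightarrow> real \<Rightarrow> real" where \<phi>: "\<And>j s. tree_pgf (size_mgf h s) n n j = ennreal (\<phi> j s)"
      "\<And>j s. 0 \<le> \<phi> j s" "\<And>j s. \<phi> j differentiable (at s)"
  proof -
    have "\<forall>j. \<exists>\<phi>. \<forall>s. tree_pgf (size_mgf h s) n n j = ennreal (\<phi> s) \<and> 0 \<le> \<phi> s \<and> \<phi> differentiable (at s)"
      using tree_pgf_smooth[of "size_mgf h" m n n, OF m] by blast
    from choice[OF this] show thesis using that by blast
  qed
  define L where "L s = (\<Sum>j\<in>UNIV. base $ j * (\<phi> j s - 1))" for s
  define L' where "L' s = deriv L s" for s
  have "L differentiable (at s)" for s
    unfolding L_def by (intro differentiable_sum differentiable_mult differentiable_diff differentiable_const \<phi>(3) finite ballI)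
  then have dL: "(L has_real_derivative L' s) (at s)" for s
    unfolding L'_def by (simp add: DERIV_deriv_iff_real_differentiable)
  have L0: "L 0 = 0"
  proof -
    have one: "size_mgf h 0 j = 1" for j
    proof -
      interpret D: prob_space "claim_law j" by (rule claim_prob_space)
      show ?thesis by (simp add: size_mgf_def D.emeasure_space_1)
    qed
    have "tree_pgf (size_mgf h 0) n n j = 1" for j
    proof -
      have "tree_pgf (size_mgf h 0) n n j = (\<integral>\<^sup>+\<omega>. tree_weight (size_mgf h 0) n n [(j, 0)] \<omega> \<partial>M)"
        by (subst nn_integral_tree_weight) (auto simp: one comp_of_def)
      then show ?thesis by (simp add: tree_weight_def one emeasure_space_1)
    qed
    then have "\<phi> j 0 = 1" for j using \<phi>(1)[of 0 j] by simp
    then show ?thesis by (simp add: L_def)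
  qed
  have "(\<Sum>j\<in>UNIV. ennreal (base $ j) * tree_pgf (size_mgf h \<theta>) n n j) = ennreal (\<Sum>j\<in>UNIV. base $ j * \<phi> j \<theta>)"
    by (simp add: \<phi> ennreal_mult[symmetric] base_nonneg sum_ennreal)
  with big have "ennreal (r * \<theta> + (\<Sum>j\<in>UNIV. base $ j)) < ennreal (\<Sum>j\<in>UNIV. base $ j * \<phi> j \<theta>)"
    by (simp only:)
  then have "r * \<theta> + (\<Sum>j\<in>UNIV. base $ j) < (\<Sum>j\<in>UNIV. base $ j * \<phi> j \<theta>)"
    by (rule iffD1[OF ennreal_less_iff, rotated]) (use r \<theta> base_nonneg in \<open>simp add: sum_nonneg\<close>)
  then have "r * \<theta> < L \<theta>" by (simp add: L_def right_diff_distrib sum_subtractf)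
  then obtain s where s: "0 < s" "s \<le> \<theta>" "r * s \<le> L s" "r < L' s"
    by (rule exists_excess_slope[OF dL L0 \<theta>]) blast
  define a where "a = L' s"
  obtain \<epsilon> where \<epsilon>0: "0 < \<epsilon>" and \<epsilon>1: "0 < a - \<epsilon> - r"
      and \<epsilon>2: "s * (a + \<epsilon> - r) / (a - \<epsilon> - r) < s + \<eta>"
    by (rule tilting_accuracy[of r a s \<eta>]) (use s \<eta> in \<open>simp_all add: a_def\<close>)
  define \<kappa> where "\<kappa> = s * (a + \<epsilon> - r) / (a - \<epsilon> - r)"
  have \<kappa>: "\<kappa> < \<theta> + \<eta>" using \<epsilon>2 s by (simp add: \<kappa>_def)
  let ?Z = "\<lambda>T \<omega>. claim_total h (event_counts (truncated_events n n T \<omega>)) \<omega>"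
  have tilted: "\<forall>\<^sub>F T in at_top. exp (T * (L s - s * (a + \<epsilon>))) / 2 \<le> prob {\<omega> \<in> space M. (a - \<epsilon>) * T \<le> ?Z T \<omega>}"
  proof (rule tilted_lower_bound)
    show "(\<lambda>\<omega>. ?Z T \<omega>) \<in> borel_measurable M" for T
      by (rule claim_total_measurable[OF pred_truncated_events h(3)])
    show "(\<integral>\<^sup>+\<omega>. ennreal (exp (s * ?Z T \<omega>)) \<partial>M) = ennreal (exp (T * L s))" if "0 \<le> T" "0 \<le> s" for T s
      unfolding L_def using nn_integral_exp_truncated_claims[OF h(1,3) that(2,1), of n n] by (simp add: \<phi>)
  qed (use dL s \<epsilon>0 in \<open>auto simp: a_def\<close>)
  define c where "c = r * (real n * real n) + 1"
  define T where "T u = (u + c) / (a - \<epsilon> - r)" for u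
  have T_top: "filterlim T at_top at_top"
    unfolding filterlim_at_top
  proof
    fix Z
    show "\<forall>\<^sub>F u in at_top. Z \<le> T u"
      using eventually_ge_at_top[of "Z * (a - \<epsilon> - r) - c"]
      by eventually_elim (use \<epsilon>1 in \<open>simp add: T_def pos_le_divide_eq\<close>)
  qed
  have ev1: "\<forall>\<^sub>F u in at_top. exp (T u * (L s - s * (a + \<epsilon>))) / 2 \<le> prob {\<omega> \<in> space M. (a - \<epsilon>) * T u \<le> ?Z (T u) \<omega>}"
    by (rule eventually_compose_filterlim[OF tilted T_top])
  have ev2: "\<forall>\<^sub>F u in at_top. exp (- (\<theta> + \<eta>) * u) \<le> exp (- \<kappa> * (u + c)) / 2"
  proof -
    have "\<forall>\<^sub>F u in at_top. (ln 2 + \<kappa> * c) / (\<theta> + \<eta> - \<kappa>) \<le> u" by (rule eventually_ge_at_top)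
    then show ?thesis
    proof eventually_elim
      case (elim u)
      then have "ln 2 + \<kappa> * c \<le> u * (\<theta> + \<eta> - \<kappa>)" using \<kappa> by (simp add: pos_divide_le_eq)
      then have "ln 2 + (- (\<theta> + \<eta>) * u) \<le> - \<kappa> * (u + c)" by (simp add: algebra_simps)
      then have "exp (ln 2 + (- (\<theta> + \<eta>) * u)) \<le> exp (- \<kappa> * (u + c))" by simp
      then show ?case by (simp add: exp_add)
    qed
  qed
  show ?thesis using ev1 ev2 eventually_gt_at_top[of 0]
  proof eventually_elim
    case (elim u)
    let ?T = "T u"
    have T0: "0 < ?T" using elim(3) r \<epsilon>1 by (auto simp: T_def c_def intro!: divide_pos_pos add_pos_nonneg)
    have T1: "(a - \<epsilon>) * ?T = u + c + r * ?T"
      using \<epsilon>1 by (simp add: T_def field_simps)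
    have "- \<kappa> * (u + c) = ?T * (r * s - s * (a + \<epsilon>))"
      using \<epsilon>1 by (simp add: \<kappa>_def T_def field_simps)
    also have "\<dots> \<le> ?T * (L s - s * (a + \<epsilon>))" using T0 s by (intro mult_left_mono) auto
    finally have "exp (- \<kappa> * (u + c)) / 2 \<le> exp (?T * (L s - s * (a + \<epsilon>))) / 2" by simp
    then have "exp (- (\<theta> + \<eta>) * u) \<le> prob {\<omega> \<in> space M. (a - \<epsilon>) * ?T \<le> ?Z ?T \<omega>}"
      using elim by linarith
    also have "\<dots> \<le> prob {\<omega> \<in> space M. ruin_time X U r i u \<omega> < \<infinity>}"
    proof (rule finite_measure_mono_AE)
      show "{\<omega> \<in> space M. ruin_time X U r i u \<omega> < \<infinity>} \<in> events" by (rule ruin_event_measurable[OF r])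
      show "AE \<omega> in M. \<omega> \<in> {\<omega> \<in> space M. (a - \<epsilon>) * ?T \<le> ?Z ?T \<omega>}
          \<longrightarrow> \<omega> \<in> {\<omega> \<in> space M. ruin_time X U r i u \<omega> < \<infinity>}"
        using AE_finite_all_events_upto[OF fin] AE_proper
      proof eventually_elim
        case (elim \<omega>)
        show ?case
        proof
          assume *: "\<omega> \<in> {\<omega> \<in> space M. (a - \<epsilon>) * ?T \<le> ?Z ?T \<omega>}"
          define t where "t = ?T + real n * real n"
          have t0: "0 < t" using T0 by (simp add: t_def add_pos_nonneg)
          have f: "finite (events_upto t \<omega>)" using elim by blast
          have "truncated_events n n ?T \<omega> \<subseteq> events_upto t \<omega>"
            unfolding truncated_events_def t_def using tree_root_in_events[OF elim(2)] by blast
          then have "?Z ?T \<omega> \<le> claim_total (claim_size i) (event_counts (events_upto t \<omega>)) \<omega>"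
            by (intro claim_total_mono event_counts_mono f claim_size h)
          then have "u + r * t < claim_total (claim_size i) (event_counts (events_upto t \<omega>)) \<omega>"
            using * T1 by (simp add: t_def c_def algebra_simps)
          moreover have "0 \<le> claim_total (claim_size i) (event_counts (events_upto t \<omega>)) \<omega>"
            unfolding claim_total_def by (intro sum_nonneg claim_size)
          ultimately have "ereal u < net_claims X U r i t \<omega>"
            by (simp add: net_claims_def aggregate_claims_eq[OF f] enn2ereal_ennreal)
          then show "\<omega> \<in> {\<omega> \<in> space M. ruin_time X U r i u \<omega> < \<infinity>}"
            using t0 * unfolding ruin_time_less_iff by blast
        qed
      qed
    qed
    finally show ?case by (simp add: ruin_prob_def)
  qed
qed

section \<open>Logarithmic asymptotics\<close>

lemma cumulant_sum_finite:
  assumes \<theta>: "0 \<le> \<theta>" and c: "0 \<le> c" and le: "(\<Sum>j\<in>UNIV. ennreal (base $ j) * cluster_mgf i \<theta> j) \<le> ennreal (c + (\<Sum>j\<in>UNIV. base $ j))"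
  shows "cumulant_finite i \<theta>" "cumulant i \<theta> \<le> c"
proof -
  let ?F = "cluster_mgf i \<theta>"
  have lt: "(\<Sum>j\<in>UNIV. ennreal (base $ j) * ?F j) < \<infinity>" by (rule le_less_trans[OF le]) simp
  show cf: "cumulant_finite i \<theta>"
    unfolding cumulant_finite_def
  proof (intro allI impI)
    fix j assume "0 < base $ j"
    have "ennreal (base $ j) * ?F j \<le> (\<Sum>j\<in>UNIV. ennreal (base $ j) * ?F j)"
      by (rule member_le_sum) auto
    then have "ennreal (base $ j) * ?F j < \<infinity>" using lt by (rule le_less_trans)
    then show "?F j < \<infinity>" using \<open>0 < base $ j\<close> by (auto simp: ennreal_mult_less_top)
  qed
  have "ennreal (base $ j) * ?F j = ennreal (base $ j * enn2real (?F j))" for j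
  proof (cases "base $ j = 0")
    case False
    then have "?F j < \<infinity>" using cf base_nonneg[of j] by (auto simp: cumulant_finite_def)
    then show ?thesis using base_nonneg[of j] by (simp add: ennreal_mult)
  qed simp
  then have "(\<Sum>j\<in>UNIV. ennreal (base $ j) * ?F j) = ennreal (\<Sum>j\<in>UNIV. base $ j * enn2real (?F j))"
    using base_nonneg by (simp add: sum_ennreal)
  with le have "ennreal (\<Sum>j\<in>UNIV. base $ j * enn2real (?F j)) \<le> ennreal (c + (\<Sum>j\<in>UNIV. base $ j))"
    by (simp only:)
  then have "(\<Sum>j\<in>UNIV. base $ j * enn2real (?F j)) \<le> c + (\<Sum>j\<in>UNIV. base $ j)"
    by (rule iffD1[OF ennreal_le_iff, rotated]) (use c base_nonneg in \<open>simp add: sum_nonneg\<close>)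
  then show "cumulant i \<theta> \<le> c" by (simp add: cumulant_def right_diff_distrib sum_subtractf)
qed

text \<open>To the left of the root strict convexity gives \<open>\<Lambda>(\<theta>) < r * \<theta>\<close>. To the right of the root
\<open>\<Lambda>(\<theta>) \<le> r * \<theta>\<close> would force \<open>\<Lambda>(\<theta>s) < r * \<theta>s\<close> by the same convexity.\<close>

lemma ruin_asymptotics:
  assumes fin: "AE \<omega> in M. \<forall>v. v \<noteq> [] \<longrightarrow> finite (cluster v \<omega>)"
    and r: "0 < r" and \<theta>: "0 < \<theta>s" and cf: "cumulant_finite i \<theta>s" and root: "cumulant i \<theta>s = r * \<theta>s"
  shows "((\<lambda>u. ln (ruin_prob M X U r i u) / u) \<longlongrightarrow> - \<theta>s) at_top"
proof -
  let ?p = "ruin_prob M X U r i"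
  have upper: "\<exists>C>0. \<forall>u>0. ?p u \<le> C * exp (- \<theta> * u)" if t: "0 < \<theta>" "\<theta> < \<theta>s" for \<theta>
  proof -
    have e: "\<theta> = (\<theta> / \<theta>s) * \<theta>s" using t by simp
    have s: "0 < \<theta> / \<theta>s" "\<theta> / \<theta>s < 1" using t by simp_all
    have "0 < cumulant i \<theta>s" using root r \<theta> by simp
    then have "cumulant_finite i \<theta>" "cumulant i \<theta> < \<theta> / \<theta>s * cumulant i \<theta>s"
      using cumulant_scale[OF fin s less_imp_le[OF \<theta>] cf] e by simp_all
    moreover have "\<theta> / \<theta>s * cumulant i \<theta>s = r * \<theta>" using root \<theta> by simp
    ultimately show ?thesis using ruin_prob_le[OF fin r t(1)] by metis
  qed
  have lower: "\<forall>\<^sub>F u in at_top. exp (- (\<theta>s + \<eta>) * u) \<le> ?p u" if \<eta>: "0 < \<eta>" for \<eta>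
  proof -
    \<comment> \<open>Half of \<open>\<eta>\<close> is spent on moving beyond the root, the other half on the accuracy of the lower bound.\<close>
    define \<theta> where "\<theta> = \<theta>s + \<eta> / 2"
    have t: "0 < \<theta>" "\<theta>s < \<theta>" using \<theta> \<eta> by (auto simp: \<theta>_def)
    have "ennreal (r * \<theta> + (\<Sum>j\<in>UNIV. base $ j)) < (\<Sum>j\<in>UNIV. ennreal (base $ j) * cluster_mgf i \<theta> j)"
    proof (rule ccontr)
      assume "\<not> ?thesis"
      then have c: "cumulant_finite i \<theta>" "cumulant i \<theta> \<le> r * \<theta>"
        using cumulant_sum_finite[of \<theta> "r * \<theta>" i] r t by (simp_all add: not_less)
      have s: "0 < \<theta>s / \<theta>" "\<theta>s / \<theta> < 1" and e: "\<theta>s / \<theta> * \<theta> = \<theta>s" using t \<theta> by simp_all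
      note sc = cumulant_scale[OF fin s less_imp_le[OF t(1)] c(1), unfolded e]
      have "0 < cumulant i \<theta>s" using root r \<theta> by simp
      then have "0 < \<theta>s / \<theta> * cumulant i \<theta>" using sc(2) by linarith
      then have pos: "0 < cumulant i \<theta>" using s(1) zero_less_mult_pos by blast
      have "\<theta>s / \<theta> * cumulant i \<theta> \<le> \<theta>s / \<theta> * (r * \<theta>)" using c s by (intro mult_left_mono) auto
      also have "\<dots> = r * \<theta>s" using t by simp
      finally show False using sc(3)[OF pos] root by simp
    qed
    then have "\<forall>\<^sub>F u in at_top. exp (- (\<theta> + \<eta> / 2) * u) \<le> ?p u"
      by (rule ruin_prob_ge[OF fin r t(1) half_gt_zero[OF \<eta>]])
    moreover have "\<theta> + \<eta> / 2 = \<theta>s + \<eta>" by (simp add: \<theta>_def)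
    ultimately show ?thesis by (simp only:)
  qed
  show ?thesis
  proof (rule tendstoI)
    fix e :: real assume e: "0 < e"
    define \<theta> where "\<theta> = max (\<theta>s / 2) (\<theta>s - e / 2)"
    have t: "0 < \<theta>" "\<theta> < \<theta>s" "\<theta>s - e / 2 \<le> \<theta>" using \<theta> e by (auto simp: \<theta>_def)
    obtain C where C: "0 < C" "\<And>u. 0 < u \<Longrightarrow> ?p u \<le> C * exp (- \<theta> * u)" using upper[OF t(1,2)] by blast
    show "\<forall>\<^sub>F u in at_top. dist (ln (?p u) / u) (- \<theta>s) < e"
      using lower[OF half_gt_zero[OF e]] eventually_gt_at_top[of "max 0 (2 * ln C / e)"]
    proof eventually_elim
      case (elim u)
      have u: "0 < u" "2 * ln C / e < u" using elim(2) by auto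
      have p: "0 < ?p u" using less_le_trans[OF exp_gt_zero elim(1)] .
      have "ln (exp (- (\<theta>s + e / 2) * u)) \<le> ln (?p u)" using elim(1) p by (subst ln_le_cancel_iff) auto
      then have "- (\<theta>s + e / 2) * u \<le> ln (?p u)" by (simp only: ln_exp)
      then have low: "- (\<theta>s + e / 2) \<le> ln (?p u) / u" using u(1) by (simp only: pos_le_divide_eq)
      have "ln (?p u) \<le> ln (C * exp (- \<theta> * u))" using C(2)[OF u(1)] p C(1) by (subst ln_le_cancel_iff) auto
      also have "\<dots> = ln C - \<theta> * u" using C(1) by (simp add: ln_mult)
      finally have "ln (?p u) \<le> ln C - \<theta> * u" .
      moreover have "ln C < e / 2 * u" using u(2) e by (simp add: pos_divide_less_eq mult.commute)
      moreover have "(\<theta>s - e / 2) * u \<le> \<theta> * u" using t(3) u(1) by (intro mult_right_mono) auto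
      ultimately have "ln (?p u) < (e - \<theta>s) * u" by (simp add: algebra_simps)
      then have "ln (?p u) / u < e - \<theta>s" using u(1) by (simp only: pos_divide_less_eq)
      then show ?case using low e by (simp add: dist_real_def abs_less_iff)
    qed
  qed
qed

text \<open>Strict convexity excludes a second root between \<open>0\<close> and a root.\<close>

lemma root_unique:
  assumes fin: "AE \<omega> in M. \<forall>v. v \<noteq> [] \<longrightarrow> finite (cluster v \<omega>)" and r: "0 < r"
    and \<theta>: "0 < \<theta>" "cumulant_finite i \<theta>" "cumulant i \<theta> = r * \<theta>"
    and \<theta>': "0 < \<theta>'" "cumulant i \<theta>' = r * \<theta>'"
  shows "\<not> \<theta>' < \<theta>"
proof
  assume less: "\<theta>' < \<theta>"
  have s: "0 < \<theta>' / \<theta>" "\<theta>' / \<theta> < 1" and e: "\<theta>' / \<theta> * \<theta> = \<theta>'" using less \<theta> \<theta>' by simp_all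
  have "0 < cumulant i \<theta>" using r \<theta> by simp
  then have "cumulant i \<theta>' < \<theta>' / \<theta> * cumulant i \<theta>"
    using cumulant_scale(3)[OF fin s less_imp_le[OF \<theta>(1)] \<theta>(2)] e by simp
  also have "\<dots> = r * \<theta>'" using \<theta> by simp
  finally show False using \<theta>' by simp
qed

end

theorem theorem2:
  fixes M :: "'w measure"
    and base :: "real ^ 'd::finite"
    and g :: "'d \<Rightarrow> 'd \<Rightarrow> real \<Rightarrow> real"
    and mark_law :: "'d \<Rightarrow> (real ^ 'd) measure"
    and claim_law :: "'d \<Rightarrow> (real ^ 'e::finite) measure"
    and X :: "'d event \<Rightarrow> 'd \<Rightarrow> nat \<Rightarrow> 'w \<Rightarrow> ereal"
    and B :: "'d event \<Rightarrow> 'w \<Rightarrow> real ^ 'd"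
    and U :: "'d \<Rightarrow> nat \<Rightarrow> 'w \<Rightarrow> real ^ 'e"
    and i :: 'e and r \<theta>s :: real
  assumes "compound_hawkes M base g mark_law claim_law X B U"
    and "spectral_radius (branching_matrix g mark_law) < 1"
    and "marks_light_tailed mark_law"
    and "claims_attain_tilts g mark_law claim_law"
    and "0 < r" and "net_profit base g mark_law claim_law r i"
    and "0 < \<theta>s" and "limit_cumulant_net M base claim_law X r i \<theta>s = 0"
  shows "((\<lambda>u. ln (ruin_prob M X U r i u) / u) \<longlongrightarrow> - \<theta>s) at_top
    \<and> (\<forall>\<theta>>0. limit_cumulant_net M base claim_law X r i \<theta> = 0 \<longrightarrow> \<theta> = \<theta>s)"
proof -
  interpret compound_hawkes M base g mark_law claim_law X B U by fact
  have fin: "AE \<omega> in M. \<forall>v. v \<noteq> [] \<longrightarrow> finite (cluster v \<omega>)"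
    by (rule AE_finite_cluster_subcritical) fact+
  note root = limit_cumulant_net_eq_0[OF fin less_imp_le]
  note rs = root[OF \<open>0 < \<theta>s\<close> assms(8)]
  have "((\<lambda>u. ln (ruin_prob M X U r i u) / u) \<longlongrightarrow> - \<theta>s) at_top"
    by (rule ruin_asymptotics[OF fin \<open>0 < r\<close> \<open>0 < \<theta>s\<close> rs])
  moreover have "\<theta> = \<theta>s" if "0 < \<theta>" "limit_cumulant_net M base claim_law X r i \<theta> = 0" for \<theta>
  proof -
    note rt = root[OF that]
    have "\<not> \<theta> < \<theta>s" by (rule root_unique[OF fin \<open>0 < r\<close> \<open>0 < \<theta>s\<close> rs that(1) rt(2)])
    moreover have "\<not> \<theta>s < \<theta>" by (rule root_unique[OF fin \<open>0 < r\<close> that(1) rt \<open>0 < \<theta>s\<close> rs(2)])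
    ultimately show ?thesis by simp
  qed
  ultimately show ?thesis by blast
qed

end
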